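(* (Anti-symmetric case.) Let $A$ be an integer weighing matrix with primitive decomposition $$A\sim_H\bigoplus_i A_i^{\oplus m_i}\oplus\bigoplus_i B_i^{\oplus 2n_i}\oplus\bigoplus_i (C_i\oplus C_i^\top)^{\oplus o_i},$$ where all blocks are primitive, each $A_i$ is anti-symmetric, each class $[B_i]$ is symmetric but contains no anti-symmetric matrix, each class $[C_i]$ is not symmetric, and all the $A_i,B_i,C_i,C_i^\top$ are pairwise non H-equivalent. For each $i$ let $\{A_i^j\}_j$ be a classification list of the anti-symmetric members of $[A_i]$ up to SH-equivalence. For each $i$ choose nonnegative integers $a_i,b_i$ with $a_i+2b_i=m_i$ and a multiset $\Lambda_i=\{A_i^{j_1},\ldots,A_i^{j_{a_i}}\}$ of size $a_i$ from this list, and let $\Lambda=(\Lambda_i)_i$. Then, as the choices range over all possibilities, the matrices $$\Sigma_\Lambda:=\bigoplus_{i}\bigoplus_{k=1}^{a_i}A_i^{j_k}\oplus\bigoplus_i\begin{bmatrix}0&A_i\\-A_i^\top&0\end{bmatrix}^{\oplus b_i}\oplus\bigoplus_i\begin{bmatrix}0&B_i\\-B_i^\top&0\end{bmatrix}^{\oplus n_i}\oplus\bigoplus_i\begin{bmatrix}0&C_i\\-C_i^\top&0\end{bmatrix}^{\oplus o_i}$$ form a classification list of all anti-symmetric members of $[A]$ up to SH-equivalence. Moreover, let $\{X_i\}$ be the distinct blocks of type I of $\Sigma_\Lambda$ (the blocks $A_i^{j_k}$), $\{A_{Y_i}\}$ the distinct blocks of type II (the blocks $A_Y$ with $[Y]$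 symmetric, i.e. $Y=A_i$ or $Y=B_i$) and $\{A_{Z_i}\}$ the distinct blocks of type III (the blocks $A_Z$ with $Z=C_i$), with multiplicities $p_i,q_i,r_i$. Then $$\mathrm{SAut}(\Sigma_\Lambda)\cong\prod_i\mathrm{SAut}(X_i)\wr S_{p_i}\times\prod_i\mathrm{TAut}(Y_i)\wr S_{q_i}\times\prod_i\mathrm{Aut}(Z_i)\wr S_{r_i}.$$
   Context: An integer weighing matrix is $A\in\mathbb Z^{n\times n}$ with $AA^\top=kI$. $\mathrm{Mon}(n)$: monomial $n\times n$ matrices with entries in $\{0,\pm1\}$. $A\sim_H B$ means $B=LAR^\top$ with $L,R$ monomial; $[A]$ is the H-equivalence class; $[A]$ is a symmetric class if $A^\top\in[A]$. Two anti-symmetric matrices $B,C$ are SH-equivalent if $C=MBM^\top$ for a monomial $M$; $\mathrm{SAut}(B)=\{M:MBM^\top=B\}$. $\mathrm{Aut}(A)=\{(L,R):LAR^\top=A\}$. For $[A]$ symmetric, $\mathrm{TAut}(A)$ is the group of pairs in $\mathrm{Aut}(A)$ and formal triples $(L,R,\top)$ of monomials with $LA^\top R^\top=A$, with multiplication given by composition of the operations $X\mapsto LXR^\top$, $X\mapsto LX^\top R^\top$. $\oplus$ is block diagonal sum. A primitive integer weighing matrix is one not H-equivalent to a block diagonal sum of two or more smaller square blocks. For a square $X$, $A_X=\begin{bmatrix}0&X\\-X^\top&0\end{bmatrix}$. A classification list is a list such that every element is equivalent to exactly one list element. $H\wr S_r=H^r\rtimes S_r$.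
   Formalization: The weight k is taken positive (for A=0 different choices give the same matrix), and in TAut the product of two triples is (L,R,⊤)(L',R',⊤)=(-LR',-RL'), the same composite operation; with (LR',RL') the isomorphism fails, e.g. for B_1=[1], n_1=1. *)

theory Defs
  imports
    "Jordan_Normal_Form.Matrix"
    "HOL-Library.Multiset"
    "HOL-Algebra.Product_Groups"
    "HOL-Algebra.Sym_Groups"
begin

section \<open>Integer weighing matrices and equivalences\<close>

text \<open>The weight is positive, as is usual for weighing matrices: for weight \<open>0\<close> the zero
  matrix would qualify, for which the blocks \<open>X \<oplus> X\<close> and \<open>A\<^sub>X\<close> of the classification coincide.\<close>

definition int_weighing :: "int mat \<Rightarrow> bool" where
  "int_weighing A \<longleftrightarrow> square_mat A \<and>
     (\<exists>k>0. A * transpose_mat A = k \<cdot>\<^sub>m 1\<^sub>m (dim_row A))"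

definition Mon :: "nat \<Rightarrow> int mat set" where
  "Mon n = {M \<in> carrier_mat n n.
     (\<forall>i<n. \<forall>j<n. M $$ (i, j) \<in> {0, 1, - 1}) \<and>
     (\<forall>i<n. \<exists>!j. j < n \<and> M $$ (i, j) \<noteq> 0) \<and>
     (\<forall>j<n. \<exists>!i. i < n \<and> M $$ (i, j) \<noteq> 0)}"

definition H_equiv :: "int mat \<Rightarrow> int mat \<Rightarrow> bool" where
  "H_equiv A B \<longleftrightarrow> square_mat A \<and>
     (\<exists>L\<in>Mon (dim_row A). \<exists>R\<in>Mon (dim_row A). B = L * A * transpose_mat R)"

definition H_class :: "int mat \<Rightarrow> int mat set" where
  "H_class A = {B. H_equiv A B}"

definition symmetric_class :: "int mat \<Rightarrow> bool" where
  "symmetric_class A \<longleftrightarrow> transpose_mat A \<in> H_class A"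

definition antisymmetric :: "int mat \<Rightarrow> bool" where
  "antisymmetric A \<longleftrightarrow> transpose_mat A = - A"

definition antisym_members :: "int mat \<Rightarrow> int mat set" where
  "antisym_members A = {B \<in> H_class A. antisymmetric B}"

definition SH_equiv :: "int mat \<Rightarrow> int mat \<Rightarrow> bool" where
  "SH_equiv B C \<longleftrightarrow> square_mat B \<and>
     (\<exists>M\<in>Mon (dim_row B). C = M * B * transpose_mat M)"

definition primitive :: "int mat \<Rightarrow> bool" where
  "primitive A \<longleftrightarrow> int_weighing A \<and> 0 < dim_row A \<and>
     \<not> (\<exists>Bs. 2 \<le> length Bs \<and>
           (\<forall>B\<in>set Bs. square_mat B \<and> dim_row B < dim_row A) \<and>
           H_equiv A (diag_block_mat Bs))"

text \<open>A list is given by its finite index set \<open>I\<close> and its entries \<open>f\<close>; uniqueness is uniqueness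
  of the index, so no two entries of the list are equivalent.\<close>

definition classification_list ::
    "('a \<Rightarrow> 'a \<Rightarrow> bool) \<Rightarrow> 'a set \<Rightarrow> 'i set \<Rightarrow> ('i \<Rightarrow> 'a) \<Rightarrow> bool" where
  "classification_list R S I f \<longleftrightarrow>
     finite I \<and> (\<forall>i\<in>I. f i \<in> S) \<and> (\<forall>x\<in>S. \<exists>!i. i \<in> I \<and> R x (f i))"

section \<open>Automorphism groups\<close>

definition SAut :: "int mat \<Rightarrow> int mat monoid" where
  "SAut B = \<lparr>carrier = {M \<in> Mon (dim_row B). M * B * transpose_mat M = B},
     mult = (*), one = 1\<^sub>m (dim_row B)\<rparr>"

definition Aut :: "int mat \<Rightarrow> (int mat \<times> int mat) monoid" where
  "Aut A = \<lparr>carrier = {(L, R). L \<in> Mon (dim_row A) \<and> R \<in> Mon (dim_row A) \<and>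
                          L * A * transpose_mat R = A},
     mult = (\<lambda>(L, R) (L', R'). (L * L', R * R')),
     one = (1\<^sub>m (dim_row A), 1\<^sub>m (dim_row A))\<rparr>"

text \<open>\<open>Plain L R\<close> is the pair \<open>(L, R)\<close> and \<open>Transp L R\<close> the formal triple \<open>(L, R, \<top>)\<close>.\<close>

datatype taut_elem = Plain "int mat" "int mat" | Transp "int mat" "int mat"

fun taut_op :: "taut_elem \<Rightarrow> int mat \<Rightarrow> int mat" where
  "taut_op (Plain L R) X = L * X * transpose_mat R"
| "taut_op (Transp L R) X = L * transpose_mat X * transpose_mat R"

text \<open>An operation determines the matrices \<open>L\<close> and \<open>R\<close> only up to replacing \<open>(L, R)\<close> by
  \<open>(- L, - R)\<close>, so composition of operations determines a product of formal symbols only up to this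
  sign. The sign for two triples is the one of the anti-symmetric setting, where \<open>(L, R)\<close> and
  \<open>(L, R, \<top>)\<close> act on \<open>A\<^sub>X\<close> through congruence by the monomial matrices with block rows
  \<open>(L, 0), (0, R)\<close> and \<open>(0, L), (- R, 0)\<close>. With the opposite sign the
  isomorphism between \<open>SAut A\<^sub>Y\<close> and \<open>TAut Y\<close> fails, e.g. for the matrix \<open>Y\<close> of size one with entry
  \<open>1\<close>, where \<open>SAut A\<^sub>Y\<close> is cyclic of order four, but \<open>(1, 1, \<top>)\<close> would be an involution.\<close>

fun taut_mult :: "taut_elem \<Rightarrow> taut_elem \<Rightarrow> taut_elem" where
  "taut_mult (Plain L R) (Plain L' R') = Plain (L * L') (R * R')"
| "taut_mult (Plain L R) (Transp L' R') = Transp (L * L') (R * R')"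
| "taut_mult (Transp L R) (Plain L' R') = Transp (L * R') (R * L')"
| "taut_mult (Transp L R) (Transp L' R') = Plain (- (L * R')) (- (R * L'))"

definition taut_elems :: "nat \<Rightarrow> taut_elem set" where
  "taut_elems n = {Plain L R | L R. L \<in> Mon n \<and> R \<in> Mon n} \<union>
                  {Transp L R | L R. L \<in> Mon n \<and> R \<in> Mon n}"

lemma taut_op_mult:
  assumes "x \<in> taut_elems n" "y \<in> taut_elems n" "X \<in> carrier_mat n n"
  shows "taut_op (taut_mult x y) X = taut_op x (taut_op y X)"
proof -
  have tm: "transpose_mat (P * Q) = transpose_mat Q * transpose_mat P"
    if "P \<in> carrier_mat n n" "Q \<in> carrier_mat n n" for P Q :: "int mat"
    using that by (rule transpose_mult)
  have as: "P * (Q * S) = P * Q * S"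
    if "P \<in> carrier_mat n n" "Q \<in> carrier_mat n n" "S \<in> carrier_mat n n" for P Q S :: "int mat"
    using that by simp
  have neg: "(- P) * Z * transpose_mat (- Q) = P * Z * transpose_mat Q"
    if "P \<in> carrier_mat n n" "Q \<in> carrier_mat n n" "Z \<in> carrier_mat n n" for P Q Z :: "int mat"
    using that by (simp add: transpose_uminus)
  have M: "M \<in> carrier_mat n n" if "M \<in> Mon n" for M
    using that by (simp add: Mon_def)
  have c: "P * Q \<in> carrier_mat n n"
    if "P \<in> carrier_mat n n" "Q \<in> carrier_mat n n" for P Q :: "int mat"
    using that by auto
  have t: "transpose_mat P \<in> carrier_mat n n" if "P \<in> carrier_mat n n" for P :: "int mat"
    using that by simp
  from assms show ?thesis
    by (auto simp: taut_elems_def neg M tm as c t simp del: assoc_mult_mat)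
qed

definition TAut :: "int mat \<Rightarrow> taut_elem monoid" where
  "TAut A = \<lparr>carrier = {x \<in> taut_elems (dim_row A). taut_op x A = A},
     mult = taut_mult, one = Plain (1\<^sub>m (dim_row A)) (1\<^sub>m (dim_row A))\<rparr>"

definition wreath_sym ::
    "('a, 'b) monoid_scheme \<Rightarrow> nat \<Rightarrow> ((nat \<Rightarrow> 'a) \<times> (nat \<Rightarrow> nat)) monoid" where
  "wreath_sym H r = (let P = product_group {1..r} (\<lambda>_. H); S = sym_group r in
     \<lparr>carrier = carrier P \<times> carrier S,
      mult = (\<lambda>(h, s) (h', s').
        (h \<otimes>\<^bsub>P\<^esub> (\<lambda>i\<in>{1..r}. h' (inv_into UNIV s i)), s \<otimes>\<^bsub>S\<^esub> s')),
      one = (\<one>\<^bsub>P\<^esub>, \<one>\<^bsub>S\<^esub>)\<rparr>)"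

text \<open>The product of the groups \<open>G X \<wr> S\<^sub>r\<close> over the distinct entries \<open>X\<close> of a list, where \<open>r\<close> is the
  multiplicity of \<open>X\<close> in the list.\<close>

definition wreath_product ::
    "('a \<Rightarrow> 'b monoid) \<Rightarrow> 'a list \<Rightarrow> ('a \<Rightarrow> (nat \<Rightarrow> 'b) \<times> (nat \<Rightarrow> nat)) monoid" where
  "wreath_product G Xs = product_group (set Xs) (\<lambda>X. wreath_sym (G X) (count_list Xs X))"

section \<open>The representatives\<close>

definition skew_block :: "int mat \<Rightarrow> int mat" where
  "skew_block X = four_block_mat (0\<^sub>m (dim_row X) (dim_row X)) X
                    (- transpose_mat X) (0\<^sub>m (dim_col X) (dim_col X))"

definition repeat_blocks :: "'a list \<Rightarrow> nat list \<Rightarrow> 'a list" where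
  "repeat_blocks Xs rs = concat (map2 (\<lambda>X r. replicate r X) Xs rs)"

definition decomposition_blocks ::
    "int mat list \<Rightarrow> nat list \<Rightarrow> int mat list \<Rightarrow> nat list \<Rightarrow> int mat list \<Rightarrow> nat list \<Rightarrow> int mat list" where
  "decomposition_blocks As ms Bs ns Cs os =
     repeat_blocks As ms @ repeat_blocks Bs (map (\<lambda>n. 2 * n) ns) @
     concat (repeat_blocks (map (\<lambda>C. [C, transpose_mat C]) Cs) os)"

definition block_types :: "int mat list \<Rightarrow> int mat list \<Rightarrow> int mat list \<Rightarrow> int mat list" where
  "block_types As Bs Cs = As @ Bs @ Cs @ map transpose_mat Cs"

text \<open>A choice \<open>(as, bs, \<Lambda>)\<close> consists of the numbers \<open>a\<^sub>i\<close> and \<open>b\<^sub>i\<close> and the multisets \<open>\<Lambda>\<^sub>i\<close>;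
  \<open>Ls ! i\<close> is the classification list from which the elements of \<open>\<Lambda>\<^sub>i\<close> are taken.\<close>

type_synonym choice = "nat list \<times> nat list \<times> int mat multiset list"

definition choices :: "nat list \<Rightarrow> int mat list list \<Rightarrow> choice set" where
  "choices ms Ls = {(as, bs, \<Lambda>).
     length as = length ms \<and> length bs = length ms \<and> length \<Lambda> = length ms \<and>
     (\<forall>i<length ms. as ! i + 2 * bs ! i = ms ! i \<and>
        size (\<Lambda> ! i) = as ! i \<and> set_mset (\<Lambda> ! i) \<subseteq> set (Ls ! i))}"

text \<open>Each multiset is enumerated in the order of its classification list.\<close>

fun type1_blocks :: "int mat list list \<Rightarrow> choice \<Rightarrow> int mat list" where
  "type1_blocks Ls (as, bs, \<Lambda>) =
     concat (map2 (\<lambda>L M. concat (map (\<lambda>X. replicate (count M X) X) L)) Ls \<Lambda>)"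

text \<open>Blocks \<open>A\<^sub>Y\<close> and \<open>A\<^sub>Z\<close> of types II and III are represented by \<open>Y\<close> and \<open>Z\<close>.\<close>

fun type2_blocks :: "int mat list \<Rightarrow> int mat list \<Rightarrow> nat list \<Rightarrow> choice \<Rightarrow> int mat list" where
  "type2_blocks As Bs ns (as, bs, \<Lambda>) = repeat_blocks As bs @ repeat_blocks Bs ns"

definition type3_blocks :: "int mat list \<Rightarrow> nat list \<Rightarrow> int mat list" where
  "type3_blocks Cs os = repeat_blocks Cs os"

definition Sigma_mat ::
    "int mat list \<Rightarrow> int mat list \<Rightarrow> nat list \<Rightarrow> int mat list \<Rightarrow> nat list \<Rightarrow>
     int mat list list \<Rightarrow> choice \<Rightarrow> int mat" where
  "Sigma_mat As Bs ns Cs os Ls c = diag_block_mat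
     (type1_blocks Ls c @ map skew_block (type2_blocks As Bs ns c) @
      map skew_block (type3_blocks Cs os))"

end

theory Submission
  imports Defs "Jordan_Normal_Form.Determinant" "HOL-Combinatorics.List_Permutation"
begin

text \<open>A square matrix carries two graphs: the index graph, where \<open>i\<close> and \<open>j\<close> are joined if the entry at
  \<open>(i, j)\<close> or \<open>(j, i)\<close> is nonzero, and the bipartite graph on rows and columns. SH-equivalences are
  signed isomorphisms of the former and H-equivalences of the latter, so both decompositions into
  connected components are unique. Since all rows and columns of a weighing matrix have the same
  square norm, a union of components of the bipartite graph has as many rows as columns; hence
  primitive matrices are connected in this sense. A component of the index graph of an anti-symmetric
  weighing matrix either has a connected bipartite graph (type I), or its double cover splits, and
  then it is SH-equivalent to \<open>A\<^sub>Y\<close> with \<open>Y\<close> connected; as an H-class \<open>A\<^sub>Y\<close> is \<open>Y \<oplus> Y\<^sup>\<top>\<close>. Comparing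
  multiplicities of H-classes yields the list. An automorphism permutes components, which gives the
  wreath products, and an automorphism of \<open>A\<^sub>Y\<close> preserves or exchanges the two colour classes of the
  index graph, which gives \<open>Aut\<close> and \<open>TAut\<close>.\<close>

section \<open>Monomial matrices as signed permutations\<close>

text \<open>The freedom in the list comes from what an H-class can see. A block
  \<open>skew_block Y\<close> contributes one copy of \<open>Y\<close> and one of its transpose. For
  \<open>Y = A_i\<close> these are two copies of the class of \<open>A_i\<close>, which two
  anti-symmetric members would contribute just as well, hence the free choice
  \<open>a_i + 2 b_i = m_i\<close>. A class \<open>[B_i]\<close> has no anti-symmetric member and
  must occur in pairs, and \<open>C_i\<close> is always paired with its transpose, so there nothing
  is left to choose. Different choices stay inequivalent because type I blocks can be recognised by
  their connected bipartite graph, so their multiset can be read off.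

  The main device trades matrix products for entries: an equivalence by signed permutations
  \<open>(p, s)\<close> and \<open>(q, t)\<close> moves the entry at \<open>(i, j)\<close> to
  \<open>(p i, q j)\<close> with sign \<open>s i * t j\<close>. Supports are then permuted and graph
  arguments apply. The automorphism groups need the permutations themselves, so the matching of
  blocks under a congruence returns a permutation and signs inside every block, not only
  SH-equivalences of blocks.\<close>

definition signed_perm :: "nat \<Rightarrow> (nat \<Rightarrow> nat) \<Rightarrow> (nat \<Rightarrow> int) \<Rightarrow> bool" where
  "signed_perm n p s \<longleftrightarrow> bij_betw p {..<n} {..<n} \<and> (\<forall>i<n. s i = 1 \<or> s i = - 1)"

text \<open>Column \<open>j\<close> has its entry in row \<open>p j\<close>, so basis vector
  \<open>j\<close> goes to \<open>s j\<close> times basis vector \<open>p j\<close> and products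
  compose permutations in the usual order. Values of \<open>p\<close> and \<open>s\<close> from
  \<open>n\<close> on leave no trace in the matrix.\<close>

definition monomial :: "nat \<Rightarrow> (nat \<Rightarrow> nat) \<Rightarrow> (nat \<Rightarrow> int) \<Rightarrow> int mat" where
  "monomial n p s = mat n n (\<lambda>(i, j). if i = p j then s j else 0)"

definition mon_perm :: "int mat \<Rightarrow> nat \<Rightarrow> nat" where
  "mon_perm M j = (THE i. i < dim_row M \<and> M $$ (i, j) \<noteq> 0)"

definition mon_sign :: "int mat \<Rightarrow> nat \<Rightarrow> int" where
  "mon_sign M j = M $$ (mon_perm M j, j)"

lemma monomial_carrier [simp]: "monomial n p s \<in> carrier_mat n n"
  by (simp add: monomial_def)

lemma monomial_dim [simp]: "dim_row (monomial n p s) = n" "dim_col (monomial n p s) = n"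
  by (simp_all add: monomial_def)

lemma signed_permD:
  assumes "signed_perm n p s" "i < n"
  shows "p i < n" "s i = 1 \<or> s i = - 1" "s i * s i = 1" "s i \<noteq> 0"
  using assms by (auto simp: signed_perm_def bij_betw_def)

lemma signed_perm_inj:
  assumes "signed_perm n p s" "i < n" "j < n"
  shows "p i = p j \<longleftrightarrow> i = j"
  using assms by (auto simp: signed_perm_def bij_betw_def inj_on_def)

lemma signed_perm_surj:
  assumes "signed_perm n p s" "i < n"
  obtains j where "j < n" "p j = i"
  using assms by (auto simp: signed_perm_def bij_betw_def) (metis imageE lessThan_iff)

lemma monomial_in_Mon:
  assumes "signed_perm n p s"
  shows "monomial n p s \<in> Mon n"
proof -
  have "\<exists>!j. j < n \<and> monomial n p s $$ (i, j) \<noteq> 0" if i: "i < n" for i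
  proof -
    obtain j where "j < n" "p j = i" using signed_perm_surj[OF assms i] .
    then show ?thesis
      using i signed_perm_inj[OF assms] signed_permD(4)[OF assms]
      by (intro ex1I[of _ j]) (auto simp: monomial_def split: if_splits)
  qed
  moreover have "\<exists>!i. i < n \<and> monomial n p s $$ (i, j) \<noteq> 0" if j: "j < n" for j
    using j signed_permD[OF assms j]
    by (intro ex1I[of _ "p j"]) (auto simp: monomial_def split: if_splits)
  moreover have "monomial n p s $$ (i, j) \<in> {0, 1, - 1}" if "i < n" "j < n" for i j
    using signed_permD(2)[OF assms that(2)] that by (auto simp: monomial_def)
  ultimately show ?thesis
    by (auto simp: Mon_def)
qed

lemma Mon_carrier: "M \<in> Mon n \<Longrightarrow> M \<in> carrier_mat n n"
  by (simp add: Mon_def)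

lemma mon_perm_eqI:
  assumes "M \<in> Mon n" "i < n" "j < n" "M $$ (i, j) \<noteq> 0"
  shows "mon_perm M j = i"
  using assms unfolding mon_perm_def Mon_def by (intro the1_equality) auto

lemma mon_perm_nonzero:
  assumes "M \<in> Mon n" "j < n"
  shows "mon_perm M j < n" "M $$ (mon_perm M j, j) \<noteq> 0"
proof -
  from assms obtain i where "i < n" "M $$ (i, j) \<noteq> 0"
    by (auto simp: Mon_def)
  with mon_perm_eqI[OF assms(1) this(1) assms(2) this(2)]
  show "mon_perm M j < n" "M $$ (mon_perm M j, j) \<noteq> 0" by auto
qed

lemma Mon_signed_perm:
  assumes M: "M \<in> Mon n"
  shows "signed_perm n (mon_perm M) (mon_sign M)"
proof -
  have "inj_on (mon_perm M) {..<n}"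
  proof (rule inj_onI)
    fix i j assume ij: "i \<in> {..<n}" "j \<in> {..<n}" "mon_perm M i = mon_perm M j"
    have "\<exists>!k. k < n \<and> M $$ (mon_perm M i, k) \<noteq> 0"
      using M ij mon_perm_nonzero[OF M] by (auto simp: Mon_def)
    with ij mon_perm_nonzero[OF M, of i] mon_perm_nonzero[OF M, of j] show "i = j" by auto
  qed
  moreover have "mon_perm M ` {..<n} \<subseteq> {..<n}"
    using mon_perm_nonzero[OF M] by auto
  ultimately have "bij_betw (mon_perm M) {..<n} {..<n}"
    by (simp add: bij_betw_def endo_inj_surj)
  moreover have "mon_sign M j = 1 \<or> mon_sign M j = - 1" if "j < n" for j
  proof -
    have "M $$ (mon_perm M j, j) \<in> {0, 1, - 1}"
      using M mon_perm_nonzero(1)[OF M that] that by (auto simp: Mon_def)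
    with mon_perm_nonzero(2)[OF M that] show ?thesis by (auto simp: mon_sign_def)
  qed
  ultimately show ?thesis by (simp add: signed_perm_def)
qed

lemma Mon_eq_monomial:
  assumes M: "M \<in> Mon n"
  shows "M = monomial n (mon_perm M) (mon_sign M)"
  using Mon_carrier[OF M] mon_perm_eqI[OF M]
  by (intro eq_matI) (auto simp: monomial_def mon_sign_def)

lemma mon_perm_monomial:
  assumes "signed_perm n p s" "j < n"
  shows "mon_perm (monomial n p s) j = p j" "mon_sign (monomial n p s) j = s j"
proof -
  show 1: "mon_perm (monomial n p s) j = p j"
    using assms signed_permD[OF assms]
    by (intro mon_perm_eqI[OF monomial_in_Mon]) (auto simp: monomial_def)
  show "mon_sign (monomial n p s) j = s j"
    using assms signed_permD[OF assms] by (simp add: mon_sign_def 1) (simp add: monomial_def)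
qed

lemma monomial_cong:
  assumes "\<And>j. j < n \<Longrightarrow> p j = p' j" "\<And>j. j < n \<Longrightarrow> s j = s' j"
  shows "monomial n p s = monomial n p' s'"
  using assms by (intro eq_matI) (auto simp: monomial_def)

lemma Mon_eqI:
  assumes "M \<in> Mon n" "N \<in> Mon n"
    and "\<And>j. j < n \<Longrightarrow> mon_perm M j = mon_perm N j" "\<And>j. j < n \<Longrightarrow> mon_sign M j = mon_sign N j"
  shows "M = N"
  by (subst Mon_eq_monomial[OF assms(1)], subst Mon_eq_monomial[OF assms(2)])
    (rule monomial_cong[OF assms(3,4)])

lemma signed_perm_comp:
  assumes "signed_perm n p s" "signed_perm n q t"
  shows "signed_perm n (\<lambda>j. p (q j)) (\<lambda>j. s (q j) * t j)"
proof -
  have "bij_betw (p \<circ> q) {..<n} {..<n}"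
    using assms by (auto simp: signed_perm_def intro: bij_betw_trans)
  moreover have "s (q i) * t i = 1 \<or> s (q i) * t i = - 1" if "i < n" for i
    using signed_permD(2)[OF assms(2) that]
      signed_permD(2)[OF assms(1) signed_permD(1)[OF assms(2) that]] by auto
  ultimately show ?thesis by (simp add: signed_perm_def comp_def)
qed

lemma monomial_mult:
  assumes "signed_perm n q t"
  shows "monomial n p s * monomial n q t = monomial n (\<lambda>j. p (q j)) (\<lambda>j. s (q j) * t j)"
proof (rule eq_matI)
  fix i j assume "i < dim_row (monomial n (\<lambda>j. p (q j)) (\<lambda>j. s (q j) * t j))"
    "j < dim_col (monomial n (\<lambda>j. p (q j)) (\<lambda>j. s (q j) * t j))"
  then have ij: "i < n" "j < n" by auto
  have "(monomial n p s * monomial n q t) $$ (i, j) =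
      (\<Sum>k<n. (if i = p k then s k else 0) * (if k = q j then t j else 0))"
    using ij by (simp add: scalar_prod_def monomial_def lessThan_atLeast0)
  also have "\<dots> = (\<Sum>k<n. if k = q j then (if i = p k then s k else 0) * t j else 0)"
    by (rule sum.cong) auto
  also have "\<dots> = (if i = p (q j) then s (q j) * t j else 0)"
    using signed_permD(1)[OF assms ij(2)] by (simp add: sum.delta)
  finally show "(monomial n p s * monomial n q t) $$ (i, j) =
      monomial n (\<lambda>j. p (q j)) (\<lambda>j. s (q j) * t j) $$ (i, j)"
    using ij by (simp add: monomial_def)
qed auto

lemma Mon_mult_closed:
  assumes "M \<in> Mon n" "N \<in> Mon n"
  shows "M * N \<in> Mon n"
  using monomial_mult[OF Mon_signed_perm[OF assms(2)], of "mon_perm M" "mon_sign M"]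
    monomial_in_Mon[OF signed_perm_comp[OF assms[THEN Mon_signed_perm]]]
  by (simp add: Mon_eq_monomial[OF assms(1), symmetric] Mon_eq_monomial[OF assms(2), symmetric])

lemma mon_perm_mult:
  assumes "M \<in> Mon n" "N \<in> Mon n" "j < n"
  shows "mon_perm (M * N) j = mon_perm M (mon_perm N j)"
    "mon_sign (M * N) j = mon_sign M (mon_perm N j) * mon_sign N j"
proof -
  have eq: "M * N = monomial n (\<lambda>j. mon_perm M (mon_perm N j))
      (\<lambda>j. mon_sign M (mon_perm N j) * mon_sign N j)"
    using monomial_mult[OF Mon_signed_perm[OF assms(2)], of "mon_perm M" "mon_sign M"]
    by (simp add: Mon_eq_monomial[OF assms(1), symmetric] Mon_eq_monomial[OF assms(2), symmetric])
  show "mon_perm (M * N) j = mon_perm M (mon_perm N j)"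
    "mon_sign (M * N) j = mon_sign M (mon_perm N j) * mon_sign N j"
    unfolding eq
    using mon_perm_monomial[OF signed_perm_comp[OF assms(1,2)[THEN Mon_signed_perm]] assms(3)]
    by auto
qed

lemma monomial_equivalence_index:
  assumes p: "signed_perm n p s" and q: "signed_perm n q t" and X: "X \<in> carrier_mat n n"
    and ij: "i < n" "j < n"
  shows "(monomial n p s * X * transpose_mat (monomial n q t)) $$ (p i, q j) = s i * t j * X $$ (i, j)"
proof -
  have L: "(monomial n p s * X) $$ (p i, k) = s i * X $$ (i, k)" if k: "k < n" for k
  proof -
    have "(monomial n p s * X) $$ (p i, k) = (\<Sum>l<n. (if p i = p l then s l else 0) * X $$ (l, k))"
      using ij k X signed_permD(1)[OF p]
      by (simp add: scalar_prod_def monomial_def lessThan_atLeast0)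
    also have "\<dots> = (\<Sum>l<n. if l = i then s i * X $$ (i, k) else 0)"
      using signed_perm_inj[OF p] ij by (intro sum.cong) auto
    finally show ?thesis using ij by simp
  qed
  have "(monomial n p s * X * transpose_mat (monomial n q t)) $$ (p i, q j) =
      (\<Sum>k<n. (monomial n p s * X) $$ (p i, k) * (if q j = q k then t k else 0))"
    using ij X signed_permD(1)[OF p] signed_permD(1)[OF q]
    by (simp add: scalar_prod_def lessThan_atLeast0 monomial_def)
  also have "\<dots> = (\<Sum>k<n. if k = j then s i * X $$ (i, j) * t j else 0)"
    using signed_perm_inj[OF q] ij L by (intro sum.cong) auto
  finally show ?thesis using ij by simp
qed

text \<open>Since \<open>p\<close> and \<open>q\<close> are surjective, the positions
  \<open>(p i, q j)\<close> exhaust \<open>Y\<close>. This is the entrywise form in which the graph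
  arguments use equivalences and automorphisms.\<close>

lemma monomial_equivalence_iff:
  assumes p: "signed_perm n p s" and q: "signed_perm n q t"
    and X: "X \<in> carrier_mat n n" and Y: "Y \<in> carrier_mat n n"
  shows "monomial n p s * X * transpose_mat (monomial n q t) = Y \<longleftrightarrow>
    (\<forall>i<n. \<forall>j<n. Y $$ (p i, q j) = s i * t j * X $$ (i, j))"
proof
  assume "monomial n p s * X * transpose_mat (monomial n q t) = Y"
  then show "\<forall>i<n. \<forall>j<n. Y $$ (p i, q j) = s i * t j * X $$ (i, j)"
    using monomial_equivalence_index[OF p q X] by auto
next
  assume *: "\<forall>i<n. \<forall>j<n. Y $$ (p i, q j) = s i * t j * X $$ (i, j)"
  show "monomial n p s * X * transpose_mat (monomial n q t) = Y"
  proof (rule eq_matI)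
    fix a b assume "a < dim_row Y" "b < dim_col Y"
    with Y have "a < n" "b < n" by auto
    then obtain i j where "i < n" "p i = a" "j < n" "q j = b"
      using signed_perm_surj[OF p] signed_perm_surj[OF q] by metis
    with * monomial_equivalence_index[OF p q X]
    show "(monomial n p s * X * transpose_mat (monomial n q t)) $$ (a, b) = Y $$ (a, b)" by metis
  qed (use X Y in auto)
qed

lemma Mon_transpose:
  assumes M: "M \<in> Mon n"
  shows "transpose_mat M \<in> Mon n"
proof -
  have t: "transpose_mat M $$ (i, j) = M $$ (j, i)" if "i < n" "j < n" for i j
    using Mon_carrier[OF M] that by simp
  have "(\<exists>!j. j < n \<and> transpose_mat M $$ (i, j) \<noteq> 0) \<longleftrightarrow> (\<exists>!j. j < n \<and> M $$ (j, i) \<noteq> 0)"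
    "(\<exists>!j. j < n \<and> transpose_mat M $$ (j, i) \<noteq> 0) \<longleftrightarrow> (\<exists>!j. j < n \<and> M $$ (i, j) \<noteq> 0)"
    if "i < n" for i
    using t that by (metis (no_types, lifting))+
  then show ?thesis
    using M t by (auto simp: Mon_def)
qed

lemma Mon_orthogonal:
  assumes "M \<in> Mon n"
  shows "M * transpose_mat M = 1\<^sub>m n" "transpose_mat M * M = 1\<^sub>m n"
proof -
  have *: "M * transpose_mat M = 1\<^sub>m n" if M: "M \<in> Mon n" for M
  proof -
    note p = Mon_signed_perm[OF M]
    \<comment> \<open>The entrywise criterion with both matrices equal to the identity: the diagonal
      is kept because \<open>s i * s i = 1\<close>, the rest because \<open>p\<close> is
      injective.\<close>
    have "M * 1\<^sub>m n * transpose_mat M = 1\<^sub>m n"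
      using monomial_equivalence_iff[OF p p one_carrier_mat one_carrier_mat]
        signed_permD[OF p] signed_perm_inj[OF p]
      by (simp add: Mon_eq_monomial[OF M, symmetric])
    then show ?thesis using Mon_carrier[OF M] by simp
  qed
  show "M * transpose_mat M = 1\<^sub>m n" using *[OF assms] .
  show "transpose_mat M * M = 1\<^sub>m n" using *[OF Mon_transpose[OF assms]] by simp
qed

section \<open>Integral orthogonal matrices and monomial block matrices\<close>

lemma sum_squares_eq_1:
  fixes f :: "nat \<Rightarrow> int"
  assumes "(\<Sum>j<n. f j * f j) = 1"
  shows "\<exists>!j. j < n \<and> f j \<noteq> 0" "\<And>j. j < n \<Longrightarrow> f j \<in> {0, 1, - 1}"
proof -
  have "\<exists>j<n. f j \<noteq> 0"
  proof (rule ccontr)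
    assume "\<not> ?thesis"
    then have "(\<Sum>j<n. f j * f j) = 0" by (intro sum.neutral) auto
    with assms show False by simp
  qed
  then obtain j where j: "j < n" "f j \<noteq> 0" by auto
  have pos: "1 \<le> f k * f k" if "f k \<noteq> 0" for k
  proof -
    have "f k * f k > 0" using that by (simp add: zero_less_mult_iff) linarith
    then show ?thesis by linarith
  qed
  \<comment> \<open>A nonzero integer has square at least one, so this single summand uses up the
    whole sum and all other squares vanish.\<close>
  have "(\<Sum>j<n. f j * f j) = f j * f j + (\<Sum>k\<in>{..<n} - {j}. f k * f k)"
    using j by (intro sum.remove) auto
  moreover have nn: "0 \<le> (\<Sum>k\<in>{..<n} - {j}. f k * f k)"
    by (intro sum_nonneg) simp
  ultimately have z: "(\<Sum>k\<in>{..<n} - {j}. f k * f k) = 0" and one: "f j * f j = 1"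
    using assms pos[OF j(2)] by linarith+
  have zero: "f k = 0" if "k < n" "k \<noteq> j" for k
    using z that by (subst (asm) sum_nonneg_eq_0_iff) auto
  show "\<exists>!j. j < n \<and> f j \<noteq> 0" using j zero by blast
  have "f j = 1 \<or> f j = - 1" using one zmult_eq_1_iff by auto
  then show "f k \<in> {0, 1, - 1}" if "k < n" for k
    using zero[OF that] by auto
qed

text \<open>Each row and each column is an integer vector of squared length one, hence a signed unit
  vector. Membership in \<open>Mon\<close> thereby becomes a pair of matrix identities, which can be
  checked blockwise for block matrices.\<close>

lemma orthogonal_in_Mon:
  assumes M: "M \<in> carrier_mat n n" and "M * transpose_mat M = 1\<^sub>m n" "transpose_mat M * M = 1\<^sub>m n"
  shows "M \<in> Mon n"
proof -
  have r: "(\<Sum>j<n. M $$ (i, j) * M $$ (i, j)) = 1" if "i < n" for i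
  proof -
    have "(M * transpose_mat M) $$ (i, i) = 1" using assms that by simp
    then show ?thesis using M that by (simp add: scalar_prod_def lessThan_atLeast0)
  qed
  have c: "(\<Sum>i<n. M $$ (i, j) * M $$ (i, j)) = 1" if "j < n" for j
  proof -
    have "(transpose_mat M * M) $$ (j, j) = 1" using assms that by simp
    then show ?thesis using M that by (simp add: scalar_prod_def lessThan_atLeast0)
  qed
  show ?thesis
    using M sum_squares_eq_1[OF r] sum_squares_eq_1(1)[OF c] by (auto simp: Mon_def)
qed

lemma one_in_Mon: "1\<^sub>m n \<in> Mon n"
  by (rule orthogonal_in_Mon) auto

lemma uminus_in_Mon: "M \<in> Mon n \<Longrightarrow> - M \<in> Mon n"
  using Mon_carrier[of M n] Mon_orthogonal[of M n]
  by (intro orthogonal_in_Mon) (auto simp: transpose_uminus)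

lemma Mon_four_block_diag:
  assumes "L \<in> Mon n" "R \<in> Mon m"
  shows "four_block_mat L (0\<^sub>m n m) (0\<^sub>m m n) R \<in> Mon (n + m)"
  using Mon_carrier[OF assms(1)] Mon_carrier[OF assms(2)]
  by (intro orthogonal_in_Mon)
    (auto simp: transpose_four_block_mat[of _ n n _ m _ m] mult_four_block_mat[of _ n n _ m _ m _ _
        n _ m]
      Mon_orthogonal[OF assms(1)] Mon_orthogonal[OF assms(2)])

lemma Mon_four_block_antidiag:
  assumes "L \<in> Mon n" "R \<in> Mon n"
  shows "four_block_mat (0\<^sub>m n n) L R (0\<^sub>m n n) \<in> Mon (n + n)"
  using Mon_carrier[OF assms(1)] Mon_carrier[OF assms(2)]
  by (intro orthogonal_in_Mon)
    (auto simp: transpose_four_block_mat[of _ n n _ n _ n] mult_four_block_mat[of _ n n _ n _ n _ _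
        n _ n]
      Mon_orthogonal[OF assms(1)] Mon_orthogonal[OF assms(2)])

lemma four_block_mat_eqD:
  assumes eq: "four_block_mat A B C D = four_block_mat A' B' C' D'"
    and c: "A \<in> carrier_mat n1 m1" "B \<in> carrier_mat n1 m2" "C \<in> carrier_mat n2 m1" "D \<in> carrier_mat
        n2 m2"
      "A' \<in> carrier_mat n1 m1" "B' \<in> carrier_mat n1 m2" "C' \<in> carrier_mat n2 m1" "D' \<in> carrier_mat
          n2 m2"
  shows "A = A'" "B = B'" "C = C'" "D = D'"
proof -
  have *: "four_block_mat A B C D $$ ij = four_block_mat A' B' C' D' $$ ij" for ij
    by (simp only: eq)
  have "A $$ (i, j) = A' $$ (i, j)" if "i < n1" "j < m1" for i j
    using c *[of "(i, j)"] that by simp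
  then show "A = A'" using c by (intro eq_matI) auto
  have "B $$ (i, j) = B' $$ (i, j)" if "i < n1" "j < m2" for i j
    using c *[of "(i, m1 + j)"] that by simp
  then show "B = B'" using c by (intro eq_matI) auto
  have "C $$ (i, j) = C' $$ (i, j)" if "i < n2" "j < m1" for i j
    using c *[of "(n1 + i, j)"] that by simp
  then show "C = C'" using c by (intro eq_matI) auto
  have "D $$ (i, j) = D' $$ (i, j)" if "i < n2" "j < m2" for i j
    using c *[of "(n1 + i, m1 + j)"] that by simp
  then show "D = D'" using c by (intro eq_matI) auto
qed

lemma mult_carrier_square [simp]:
  "A \<in> carrier_mat n n \<Longrightarrow> B \<in> carrier_mat n n \<Longrightarrow> A * B \<in> carrier_mat n n"
  by (rule mult_carrier_mat)

text \<open>The two orthogonality relations of the whole matrix split into those of its diagonal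
  blocks.\<close>

lemma Mon_four_block_diagD:
  assumes "four_block_mat L (0\<^sub>m n m) (0\<^sub>m m n) R \<in> Mon (n + m)"
    and L: "L \<in> carrier_mat n n" and R: "R \<in> carrier_mat m m"
  shows "L \<in> Mon n" "R \<in> Mon m"
proof -
  have "four_block_mat (L * transpose_mat L) (0\<^sub>m n m) (0\<^sub>m m n) (R * transpose_mat R)
      = four_block_mat (1\<^sub>m n) (0\<^sub>m n m) (0\<^sub>m m n) (1\<^sub>m m)"
    using Mon_orthogonal(1)[OF assms(1)] L R
    by (simp add: transpose_four_block_mat[of _ n n _ m _ m] mult_four_block_mat[of _ n n _ m _ m _
        _ n _ m])
  from four_block_mat_eqD[OF this, of n n m m] L R
  have 1: "L * transpose_mat L = 1\<^sub>m n" "R * transpose_mat R = 1\<^sub>m m" by simp_all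
  have "four_block_mat (transpose_mat L * L) (0\<^sub>m n m) (0\<^sub>m m n) (transpose_mat R * R)
      = four_block_mat (1\<^sub>m n) (0\<^sub>m n m) (0\<^sub>m m n) (1\<^sub>m m)"
    using Mon_orthogonal(2)[OF assms(1)] L R
    by (simp add: transpose_four_block_mat[of _ n n _ m _ m] mult_four_block_mat[of _ n n _ m _ m _
        _ n _ m])
  from four_block_mat_eqD[OF this, of n n m m] L R
  have 2: "transpose_mat L * L = 1\<^sub>m n" "transpose_mat R * R = 1\<^sub>m m" by simp_all
  show "L \<in> Mon n" "R \<in> Mon m"
    using orthogonal_in_Mon[OF L 1(1) 2(1)] orthogonal_in_Mon[OF R 1(2) 2(2)] by auto
qed

lemma Mon_four_block_antidiagD:
  assumes "four_block_mat (0\<^sub>m n n) L R (0\<^sub>m n n) \<in> Mon (n + n)"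
    and L: "L \<in> carrier_mat n n" and R: "R \<in> carrier_mat n n"
  shows "L \<in> Mon n" "R \<in> Mon n"
proof -
  have "four_block_mat (L * transpose_mat L) (0\<^sub>m n n) (0\<^sub>m n n) (R * transpose_mat R)
      = four_block_mat (1\<^sub>m n) (0\<^sub>m n n) (0\<^sub>m n n) (1\<^sub>m n)"
    using Mon_orthogonal(1)[OF assms(1)] L R
    by (simp add: transpose_four_block_mat[of _ n n _ n _ n] mult_four_block_mat[of _ n n _ n _ n _
        _ n _ n])
  from four_block_mat_eqD[OF this, of n n n n] L R
  have 1: "L * transpose_mat L = 1\<^sub>m n" "R * transpose_mat R = 1\<^sub>m n" by simp_all
  have "four_block_mat (transpose_mat R * R) (0\<^sub>m n n) (0\<^sub>m n n) (transpose_mat L * L)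
      = four_block_mat (1\<^sub>m n) (0\<^sub>m n n) (0\<^sub>m n n) (1\<^sub>m n)"
    using Mon_orthogonal(2)[OF assms(1)] L R
    by (simp add: transpose_four_block_mat[of _ n n _ n _ n] mult_four_block_mat[of _ n n _ n _ n _
        _ n _ n])
  from four_block_mat_eqD[OF this, of n n n n] L R
  have 2: "transpose_mat L * L = 1\<^sub>m n" "transpose_mat R * R = 1\<^sub>m n" by simp_all
  show "L \<in> Mon n" "R \<in> Mon n"
    using orthogonal_in_Mon[OF L 1(1) 2(1)] orthogonal_in_Mon[OF R 1(2) 2(2)] by auto
qed

section \<open>H- and SH-equivalence as equivalence relations\<close>

lemma square_mat_carrier: "square_mat X \<longleftrightarrow> X \<in> carrier_mat (dim_row X) (dim_row X)"
  by (metis carrier_matD(2) carrier_matI square_mat.simps)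

lemma H_equivI:
  assumes "X \<in> carrier_mat n n" "L \<in> Mon n" "R \<in> Mon n" "Y = L * X * transpose_mat R"
  shows "H_equiv X Y"
  using assms by (auto simp: H_equiv_def)

lemma SH_equivI:
  assumes "X \<in> carrier_mat n n" "M \<in> Mon n" "Y = M * X * transpose_mat M"
  shows "SH_equiv X Y"
  using assms by (auto simp: SH_equiv_def)

lemma H_equivE:
  assumes "H_equiv X Y"
  obtains n L R where "X \<in> carrier_mat n n" "Y \<in> carrier_mat n n" "L \<in> Mon n" "R \<in> Mon n"
    "Y = L * X * transpose_mat R"
proof -
  from assms obtain L R where "square_mat X" "L \<in> Mon (dim_row X)" "R \<in> Mon (dim_row X)"
    "Y = L * X * transpose_mat R" by (auto simp: H_equiv_def)
  then show ?thesis
    by (intro that[of "dim_row X" L R]) (auto simp: square_mat_carrier dest!: Mon_carrier)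
qed

lemma SH_imp_H_equiv: "SH_equiv X Y \<Longrightarrow> H_equiv X Y"
  by (auto simp: SH_equiv_def H_equiv_def)

lemma SH_equivE:
  assumes "SH_equiv X Y"
  obtains n M where "X \<in> carrier_mat n n" "Y \<in> carrier_mat n n" "M \<in> Mon n"
    "Y = M * X * transpose_mat M"
proof -
  from assms obtain M where "square_mat X" "M \<in> Mon (dim_row X)"
    "Y = M * X * transpose_mat M" by (auto simp: SH_equiv_def)
  then show ?thesis
    by (intro that[of "dim_row X" M]) (auto simp: square_mat_carrier dest!: Mon_carrier)
qed

lemma H_equiv_dim:
  assumes "H_equiv X Y"
  shows "X \<in> carrier_mat (dim_row X) (dim_row X)" "Y \<in> carrier_mat (dim_row X) (dim_row X)"
    "dim_row Y = dim_row X"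
  using assms by (auto elim!: H_equivE)

lemma H_equiv_refl: "X \<in> carrier_mat n n \<Longrightarrow> H_equiv X X"
  by (rule H_equivI[OF _ one_in_Mon one_in_Mon]) auto

lemma SH_equiv_refl: "X \<in> carrier_mat n n \<Longrightarrow> SH_equiv X X"
  by (rule SH_equivI[OF _ one_in_Mon]) auto

lemma Mon_equivalence_comp:
  assumes "L \<in> Mon n" "R \<in> Mon n" "L' \<in> Mon n" "R' \<in> Mon n" "X \<in> carrier_mat n n"
  shows "L' * (L * X * transpose_mat R) * transpose_mat R' =
    L' * L * X * transpose_mat (R' * R)"
proof -
  note c [simp] = assms(1-4)[THEN Mon_carrier] assms(5)
  have "L' * (L * X * transpose_mat R) * transpose_mat R' =
      (L' * L * X) * transpose_mat R * transpose_mat R'"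
    by (simp add: assoc_mult_mat[of _ n n _ n _ n, symmetric] del: assoc_mult_mat)
  also have "\<dots> = (L' * L * X) * (transpose_mat R * transpose_mat R')"
    by (rule assoc_mult_mat[of _ n n _ n _ n]) (auto intro!: mult_carrier_mat[of _ n n])
  also have "transpose_mat R * transpose_mat R' = transpose_mat (R' * R)"
    by (rule transpose_mult[of _ n n _ n, symmetric]) auto
  finally show ?thesis .
qed

text \<open>The inverse of a monomial matrix is its transpose, so the reverse equivalence again has
  monomial factors.\<close>

lemma Mon_equivalence_cancel:
  assumes "L \<in> Mon n" "R \<in> Mon n" "X \<in> carrier_mat n n"
  shows "transpose_mat L * (L * X * transpose_mat R) * transpose_mat (transpose_mat R) = X"
  using assms
  by (subst Mon_equivalence_comp[OF assms(1,2) Mon_transpose[OF assms(1)] Mon_transpose[OF assms(2)]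
      assms(3)])
    (simp add: Mon_orthogonal)

lemma H_equiv_sym: "H_equiv X Y \<Longrightarrow> H_equiv Y X"
  by (elim H_equivE) (metis H_equivI Mon_equivalence_cancel Mon_transpose)

lemma SH_equiv_sym: "SH_equiv X Y \<Longrightarrow> SH_equiv Y X"
  by (elim SH_equivE) (metis SH_equivI Mon_equivalence_cancel Mon_transpose)

lemma H_equiv_trans: "H_equiv X Y \<Longrightarrow> H_equiv Y Z \<Longrightarrow> H_equiv X Z"
proof (elim H_equivE)
  fix n n' L R L' R'
  assume *: "X \<in> carrier_mat n n" "Y \<in> carrier_mat n n" "L \<in> Mon n" "R \<in> Mon n" "Y = L * X *
      transpose_mat R"
    "Y \<in> carrier_mat n' n'" "Z \<in> carrier_mat n' n'" "L' \<in> Mon n'" "R' \<in> Mon n'" "Z = L' * Y *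
        transpose_mat R'"
  then have n: "n' = n" by auto
  have "Z = (L' * L) * X * transpose_mat (R' * R)"
    using * n Mon_equivalence_comp[of L n R L' R' X] by simp
  then show ?thesis
    using * n by (intro H_equivI[of X n "L' * L" "R' * R"]) (auto simp: Mon_mult_closed)
qed

lemma SH_equiv_trans: "SH_equiv X Y \<Longrightarrow> SH_equiv Y Z \<Longrightarrow> SH_equiv X Z"
proof (elim SH_equivE)
  fix n n' L L'
  assume *: "X \<in> carrier_mat n n" "Y \<in> carrier_mat n n" "L \<in> Mon n" "Y = L * X * transpose_mat L"
    "Y \<in> carrier_mat n' n'" "Z \<in> carrier_mat n' n'" "L' \<in> Mon n'" "Z = L' * Y * transpose_mat L'"
  then have n: "n' = n" by auto
  have "Z = (L' * L) * X * transpose_mat (L' * L)"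
    using * n Mon_equivalence_comp[of L n L L' L' X] by simp
  then show ?thesis
    using * n by (intro SH_equivI[of X n "L' * L"]) (auto simp: Mon_mult_closed)
qed

lemma H_equiv_transpose: "H_equiv X Y \<Longrightarrow> H_equiv (transpose_mat X) (transpose_mat Y)"
proof (elim H_equivE)
  fix n L R
  assume *: "X \<in> carrier_mat n n" "Y \<in> carrier_mat n n" "L \<in> Mon n" "R \<in> Mon n" "Y = L * X *
      transpose_mat R"
  note c [simp] = *(1) *(3,4)[THEN Mon_carrier]
  have "transpose_mat Y = R * transpose_mat (L * X)"
    unfolding *(5) by (subst transpose_mult[of _ n n _ n]) auto
  also have "\<dots> = R * transpose_mat X * transpose_mat L"
    by (simp add: transpose_mult[OF c(2,1)] assoc_mult_mat[of _ n n _ n _ n])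
  finally show ?thesis
    using * by (intro H_equivI[of _ n R L]) auto
qed

lemma H_equiv_uminus: "X \<in> carrier_mat n n \<Longrightarrow> H_equiv X (- X)"
  by (rule H_equivI[OF _ uminus_in_Mon[OF one_in_Mon] one_in_Mon]) auto

text \<open>The transpose is \<open>- X\<close>, and a global sign is a monomial factor.\<close>

lemma antisymmetric_imp_symmetric_class:
  assumes "X \<in> carrier_mat n n" "antisymmetric X"
  shows "H_equiv X (transpose_mat X)"
  using assms H_equiv_uminus by (simp add: antisymmetric_def)

lemma H_equiv_iff:
  assumes X: "X \<in> carrier_mat n n"
  shows "H_equiv X Y \<longleftrightarrow> Y \<in> carrier_mat n n \<and> (\<exists>p s q t. signed_perm n p s \<and> signed_perm n q t \<and>
    (\<forall>i<n. \<forall>j<n. Y $$ (p i, q j) = s i * t j * X $$ (i, j)))" (is "_ \<longleftrightarrow> ?R")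
proof
  assume "H_equiv X Y"
  then obtain L R where *: "Y \<in> carrier_mat n n" "L \<in> Mon n" "R \<in> Mon n" "Y = L * X * transpose_mat R"
    using X by (auto elim!: H_equivE)
  then show ?R
    using monomial_equivalence_iff[OF *(2,3)[THEN Mon_signed_perm] X *(1)] *(2,3)[THEN Mon_signed_perm]
    by (auto simp: Mon_eq_monomial[OF *(2), symmetric] Mon_eq_monomial[OF *(3), symmetric])
next
  assume ?R
  then show "H_equiv X Y"
    using monomial_equivalence_iff[OF _ _ X]
    by (metis H_equivI X monomial_in_Mon)
qed

lemma SH_equiv_iff:
  assumes X: "X \<in> carrier_mat n n"
  shows "SH_equiv X Y \<longleftrightarrow> Y \<in> carrier_mat n n \<and> (\<exists>p s. signed_perm n p s \<and>
    (\<forall>i<n. \<forall>j<n. Y $$ (p i, p j) = s i * s j * X $$ (i, j)))" (is "_ \<longleftrightarrow> ?R")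
proof
  assume "SH_equiv X Y"
  then obtain L where *: "Y \<in> carrier_mat n n" "L \<in> Mon n" "Y = L * X * transpose_mat L"
    using X by (auto elim!: SH_equivE)
  then show ?R
    using monomial_equivalence_iff[OF *(2,2)[THEN Mon_signed_perm] X *(1)] *(2)[THEN Mon_signed_perm]
    by (auto simp: Mon_eq_monomial[OF *(2), symmetric])
next
  assume ?R
  then show "SH_equiv X Y"
    using monomial_equivalence_iff[OF _ _ X]
    by (metis SH_equivI X monomial_in_Mon)
qed

section \<open>Block diagonal matrices and connected components\<close>

definition block_pos :: "int mat list \<Rightarrow> nat \<Rightarrow> nat \<Rightarrow> nat" where
  "block_pos Xs k i = sum_list (map dim_row (take k Xs)) + i"

text \<open>The inverse of \<open>block_pos\<close> on positions inside the matrix; elsewhere the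
  chosen pair carries no meaning.\<close>

definition block_inv :: "int mat list \<Rightarrow> nat \<Rightarrow> nat \<times> nat" where
  "block_inv Xs a = (SOME (k, i). k < length Xs \<and> i < dim_row (Xs ! k) \<and> block_pos Xs k i = a)"

lemma block_pos_0 [simp]: "block_pos Xs 0 i = i"
  by (simp add: block_pos_def)

lemma block_pos_Suc [simp]: "block_pos (X # Xs) (Suc k) i = dim_row X + block_pos Xs k i"
  by (simp add: block_pos_def)

lemma block_pos_less:
  assumes "k < length Xs" "i < dim_row (Xs ! k)"
  shows "block_pos Xs k i < sum_list (map dim_row Xs)"
  using assms
proof (induction Xs arbitrary: k)
  case (Cons X Xs)
  then show ?case by (cases k) auto
qed simp

lemma block_pos_eq_iff:
  assumes "k < length Xs" "i < dim_row (Xs ! k)" "l < length Xs" "j < dim_row (Xs ! l)"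
  shows "block_pos Xs k i = block_pos Xs l j \<longleftrightarrow> k = l \<and> i = j"
  using assms
proof (induction Xs arbitrary: k l)
  case (Cons X Xs)
  then show ?case by (cases k; cases l) auto
qed simp

lemma block_pos_surj:
  assumes "a < sum_list (map dim_row Xs)"
  obtains k i where "k < length Xs" "i < dim_row (Xs ! k)" "block_pos Xs k i = a"
  using assms
proof (induction Xs arbitrary: a thesis)
  case (Cons X Xs)
  show ?case
  proof (cases "a < dim_row X")
    case True
    then show ?thesis by (intro Cons.prems(1)[of 0 a]) auto
  next
    case False
    then have "a - dim_row X < sum_list (map dim_row Xs)" using Cons.prems(2) by auto
    from Cons.IH[OF _ this] obtain k i where
      "k < length Xs" "i < dim_row (Xs ! k)" "block_pos Xs k i = a - dim_row X" by blast
    then show ?thesis using False by (intro Cons.prems(1)[of "Suc k" i]) auto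
  qed
qed simp

lemma block_inv_pos:
  assumes "k < length Xs" "i < dim_row (Xs ! k)"
  shows "block_inv Xs (block_pos Xs k i) = (k, i)"
proof -
  have "case block_inv Xs (block_pos Xs k i) of (l, j) \<Rightarrow>
      l < length Xs \<and> j < dim_row (Xs ! l) \<and> block_pos Xs l j = block_pos Xs k i"
    unfolding block_inv_def by (rule someI[of _ "(k, i)"]) (use assms in auto)
  then show ?thesis
    using block_pos_eq_iff[OF _ _ assms] by auto
qed

lemma diag_block_carrier:
  assumes "\<forall>X\<in>set Xs. square_mat X"
  shows "diag_block_mat Xs \<in> carrier_mat (sum_list (map dim_row Xs)) (sum_list (map dim_row Xs))"
  using diag_block_mat_square[of Xs] assms dim_diag_block_mat[of Xs]
  by (metis carrier_matI square_mat.simps)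

lemma diag_block_index:
  assumes "\<forall>X\<in>set Xs. square_mat X"
    and "k < length Xs" "i < dim_row (Xs ! k)" "l < length Xs" "j < dim_row (Xs ! l)"
  shows "diag_block_mat Xs $$ (block_pos Xs k i, block_pos Xs l j) = (if k = l then Xs ! k $$ (i, j)
      else 0)"
  using assms
proof (induction Xs arbitrary: k l)
  case (Cons X Xs)
  have c: "diag_block_mat Xs \<in> carrier_mat (sum_list (map dim_row Xs)) (sum_list (map dim_row Xs))"
    using Cons.prems(1) by (intro diag_block_carrier) auto
  have X: "dim_col X = dim_row X" using Cons.prems(1) by auto
  show ?case
  proof (cases k)
    case 0
    then show ?thesis
      using Cons.prems c X block_pos_less[of "l - 1" Xs j] by (cases l) (auto simp: Let_def)
  next
    case (Suc k')
    then show ?thesis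
      using Cons.prems c X block_pos_less[of k' Xs i] block_pos_less[of "l - 1" Xs j] Cons.IH[of k'
          "l - 1"]
      by (cases l) (auto simp: Let_def)
  qed
qed simp

text \<open>Assembles permutations of single blocks into one permutation of the whole matrix. The
  target list \<open>Ys\<close> may order its blocks differently, and \<open>\<sigma>\<close>
  records where each block goes.\<close>

definition block_perm ::
    "int mat list \<Rightarrow> int mat list \<Rightarrow> (nat \<Rightarrow> nat) \<Rightarrow> (nat \<Rightarrow> nat \<Rightarrow> nat) \<Rightarrow> nat \<Rightarrow> nat" where
  "block_perm Xs Ys \<sigma> p a = (case block_inv Xs a of (k, i) \<Rightarrow> block_pos Ys (\<sigma> k) (p k i))"

definition block_sign :: "int mat list \<Rightarrow> (nat \<Rightarrow> nat \<Rightarrow> int) \<Rightarrow> nat \<Rightarrow> int" where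
  "block_sign Xs s a = (case block_inv Xs a of (k, i) \<Rightarrow> s k i)"

lemma block_perm_pos:
  assumes "k < length Xs" "i < dim_row (Xs ! k)"
  shows "block_perm Xs Ys \<sigma> p (block_pos Xs k i) = block_pos Ys (\<sigma> k) (p k i)"
    "block_sign Xs s (block_pos Xs k i) = s k i"
  using block_inv_pos[OF assms] by (auto simp: block_perm_def block_sign_def)

lemma sum_dims_bij:
  assumes "bij_betw \<sigma> {..<length Xs} {..<length Ys}"
    and "\<And>k. k < length Xs \<Longrightarrow> dim_row (Ys ! \<sigma> k) = dim_row (Xs ! k)"
  shows "sum_list (map dim_row Ys) = sum_list (map dim_row Xs)"
proof -
  have "sum_list (map dim_row Ys) = (\<Sum>l<length Ys. dim_row (Ys ! l))"
    by (simp add: sum_list_sum_nth lessThan_atLeast0)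
  also have "\<dots> = (\<Sum>k<length Xs. dim_row (Ys ! \<sigma> k))"
    by (rule sum.reindex_bij_betw[OF assms(1), symmetric])
  also have "\<dots> = sum_list (map dim_row Xs)"
    using assms(2) by (simp add: sum_list_sum_nth lessThan_atLeast0)
  finally show ?thesis .
qed

lemma signed_perm_block:
  assumes \<sigma>: "bij_betw \<sigma> {..<length Xs} {..<length Ys}"
    and dim: "\<And>k. k < length Xs \<Longrightarrow> dim_row (Ys ! \<sigma> k) = dim_row (Xs ! k)"
    and p: "\<And>k. k < length Xs \<Longrightarrow> signed_perm (dim_row (Xs ! k)) (p k) (s k)"
  shows "signed_perm (sum_list (map dim_row Xs)) (block_perm Xs Ys \<sigma> p) (block_sign Xs s)"
proof -
  let ?N = "sum_list (map dim_row Xs)"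
  have N: "sum_list (map dim_row Ys) = ?N" by (rule sum_dims_bij[OF \<sigma> dim])
  have \<sigma>l: "\<sigma> k < length Ys" if "k < length Xs" for k using \<sigma> that by (auto simp: bij_betw_def)
  have "inj_on (block_perm Xs Ys \<sigma> p) {..<?N}"
  proof (rule inj_onI)
    fix a b assume a: "a \<in> {..<?N}" and b: "b \<in> {..<?N}"
      and eq: "block_perm Xs Ys \<sigma> p a = block_perm Xs Ys \<sigma> p b"
    from a obtain k i where k: "k < length Xs" "i < dim_row (Xs ! k)" "block_pos Xs k i = a"
      by (auto elim: block_pos_surj)
    from b obtain l j where l: "l < length Xs" "j < dim_row (Xs ! l)" "block_pos Xs l j = b"
      by (auto elim: block_pos_surj)
    have "block_pos Ys (\<sigma> k) (p k i) = block_pos Ys (\<sigma> l) (p l j)"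
      using eq block_perm_pos(1)[OF k(1,2)] block_perm_pos(1)[OF l(1,2)] k(3) l(3) by metis
    then have "\<sigma> k = \<sigma> l" "p k i = p l j"
      using block_pos_eq_iff[of "\<sigma> k" Ys "p k i" "\<sigma> l" "p l j"] \<sigma>l k l dim
        signed_permD(1)[OF p] by auto
    then have "k = l" using \<sigma> k l by (auto simp: bij_betw_def inj_on_def)
    with \<open>p k i = p l j\<close> have "i = j" using signed_perm_inj[OF p] k l by auto
    with \<open>k = l\<close> show "a = b" using k l by auto
  qed
  moreover have "block_perm Xs Ys \<sigma> p ` {..<?N} \<subseteq> {..<?N}"
  proof
    fix b assume "b \<in> block_perm Xs Ys \<sigma> p ` {..<?N}"
    then obtain a where a: "a < ?N" "b = block_perm Xs Ys \<sigma> p a" by auto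
    then obtain k i where k: "k < length Xs" "i < dim_row (Xs ! k)" "block_pos Xs k i = a"
      by (auto elim: block_pos_surj)
    then have "b = block_pos Ys (\<sigma> k) (p k i)" using a block_perm_pos by auto
    then show "b \<in> {..<?N}"
      using block_pos_less[of "\<sigma> k" Ys "p k i"] N \<sigma>l k dim signed_permD(1)[OF p] by auto
  qed
  ultimately have "bij_betw (block_perm Xs Ys \<sigma> p) {..<?N} {..<?N}"
    by (simp add: bij_betw_def endo_inj_surj)
  moreover have "block_sign Xs s a = 1 \<or> block_sign Xs s a = - 1" if "a < ?N" for a
    using that signed_permD(2)[OF p] block_perm_pos(2)[of _ Xs _ s] by (metis block_pos_surj)
  ultimately show ?thesis by (simp add: signed_perm_def)
qed

text \<open>Rows and columns may be permuted differently inside a block, but both follow the same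
  \<open>\<sigma>\<close>, so blocks stay on the diagonal. H-equivalences use this with two families
  of permutations, congruences with one family taken twice.\<close>

lemma diag_block_equivalence:
  assumes \<sigma>: "bij_betw \<sigma> {..<length Xs} {..<length Ys}"
    and sq: "\<forall>X\<in>set Xs. square_mat X" "\<forall>Y\<in>set Ys. square_mat Y"
    and dim: "\<And>k. k < length Xs \<Longrightarrow> dim_row (Ys ! \<sigma> k) = dim_row (Xs ! k)"
    and p: "\<And>k. k < length Xs \<Longrightarrow> signed_perm (dim_row (Xs ! k)) (p k) (s k)"
    and q: "\<And>k. k < length Xs \<Longrightarrow> signed_perm (dim_row (Xs ! k)) (q k) (t k)"
    and eq: "\<And>k i j. k < length Xs \<Longrightarrow> i < dim_row (Xs ! k) \<Longrightarrow> j < dim_row (Xs ! k) \<Longrightarrow>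
      Ys ! \<sigma> k $$ (p k i, q k j) = s k i * t k j * Xs ! k $$ (i, j)"
    and a: "a < sum_list (map dim_row Xs)" and b: "b < sum_list (map dim_row Xs)"
  shows "diag_block_mat Ys $$ (block_perm Xs Ys \<sigma> p a, block_perm Xs Ys \<sigma> q b) =
      block_sign Xs s a * block_sign Xs t b * diag_block_mat Xs $$ (a, b)"
proof -
  have \<sigma>l: "\<sigma> k < length Ys" if "k < length Xs" for k using \<sigma> that by (auto simp: bij_betw_def)
  from a obtain k i where k: "k < length Xs" "i < dim_row (Xs ! k)" "block_pos Xs k i = a"
    by (auto elim: block_pos_surj)
  from b obtain l j where l: "l < length Xs" "j < dim_row (Xs ! l)" "block_pos Xs l j = b"
    by (auto elim: block_pos_surj)
  have "\<sigma> k = \<sigma> l \<longleftrightarrow> k = l" using \<sigma> k l by (auto simp: bij_betw_def inj_on_def)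
  then show ?thesis
    using k l eq[of k i j] block_perm_pos[OF k(1,2)] block_perm_pos[OF l(1,2)]
      diag_block_index[OF sq(1) k(1,2) l(1,2)]
      diag_block_index[OF sq(2), of "\<sigma> k" "p k i" "\<sigma> l" "q l j"] \<sigma>l dim
      signed_permD(1)[OF p, of k i] signed_permD(1)[OF q, of l j]
    by auto
qed

lemma diag_block_H_equiv:
  assumes \<sigma>: "bij_betw \<sigma> {..<length Xs} {..<length Ys}"
    and eq: "\<And>k. k < length Xs \<Longrightarrow> H_equiv (Xs ! k) (Ys ! \<sigma> k)"
  shows "H_equiv (diag_block_mat Xs) (diag_block_mat Ys)"
proof -
  let ?n = "\<lambda>k. dim_row (Xs ! k)"
  have "\<exists>p s q t. signed_perm (?n k) p s \<and> signed_perm (?n k) q t \<and>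
      (\<forall>i<?n k. \<forall>j<?n k. Ys ! \<sigma> k $$ (p i, q j) = s i * t j * Xs ! k $$ (i, j))" if "k < length Xs"
          for k
    using eq[OF that] H_equiv_iff[OF H_equiv_dim(1)[OF eq[OF that]]] by blast
  then obtain p s q t where *: "\<And>k. k < length Xs \<Longrightarrow> signed_perm (?n k) (p k) (s k)"
    "\<And>k. k < length Xs \<Longrightarrow> signed_perm (?n k) (q k) (t k)"
    "\<And>k i j. k < length Xs \<Longrightarrow> i < ?n k \<Longrightarrow> j < ?n k \<Longrightarrow>
      Ys ! \<sigma> k $$ (p k i, q k j) = s k i * t k j * Xs ! k $$ (i, j)"
    by metis
  have dim: "dim_row (Ys ! \<sigma> k) = ?n k" if "k < length Xs" for k
    using H_equiv_dim(3)[OF eq[OF that]] .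
  have sqX: "\<forall>X\<in>set Xs. square_mat X"
    using H_equiv_dim(1)[OF eq] by (metis in_set_conv_nth square_mat_carrier)
  have sqY: "\<forall>Y\<in>set Ys. square_mat Y"
  proof
    fix Y assume "Y \<in> set Ys"
    then obtain l where "l < length Ys" "Y = Ys ! l" by (auto simp: in_set_conv_nth)
    then obtain k where "k < length Xs" "Y = Ys ! \<sigma> k" using \<sigma>
      by (metis bij_betw_imp_surj_on imageE lessThan_iff)
    then show "square_mat Y" using H_equiv_dim(2,3)[OF eq] by (metis square_mat_carrier)
  qed
  show ?thesis
    unfolding H_equiv_iff[OF diag_block_carrier[OF sqX]]
    using diag_block_carrier[OF sqY] sum_dims_bij[OF \<sigma> dim]
      signed_perm_block[OF \<sigma> dim *(1)] signed_perm_block[OF \<sigma> dim *(2)]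
      diag_block_equivalence[OF \<sigma> sqX sqY dim *]
    by auto blast
qed

lemma diag_block_SH_equiv:
  assumes \<sigma>: "bij_betw \<sigma> {..<length Xs} {..<length Ys}"
    and eq: "\<And>k. k < length Xs \<Longrightarrow> SH_equiv (Xs ! k) (Ys ! \<sigma> k)"
  shows "SH_equiv (diag_block_mat Xs) (diag_block_mat Ys)"
proof -
  let ?n = "\<lambda>k. dim_row (Xs ! k)"
  note eqH = SH_imp_H_equiv[OF eq]
  have "\<exists>p s. signed_perm (?n k) p s \<and>
      (\<forall>i<?n k. \<forall>j<?n k. Ys ! \<sigma> k $$ (p i, p j) = s i * s j * Xs ! k $$ (i, j))" if "k < length Xs"
          for k
    using eq[OF that] SH_equiv_iff[OF H_equiv_dim(1)[OF eqH[OF that]]] by blast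
  then obtain p s where *: "\<And>k. k < length Xs \<Longrightarrow> signed_perm (?n k) (p k) (s k)"
    "\<And>k i j. k < length Xs \<Longrightarrow> i < ?n k \<Longrightarrow> j < ?n k \<Longrightarrow>
      Ys ! \<sigma> k $$ (p k i, p k j) = s k i * s k j * Xs ! k $$ (i, j)"
    by metis
  have dim: "dim_row (Ys ! \<sigma> k) = ?n k" if "k < length Xs" for k
    using H_equiv_dim(3)[OF eqH[OF that]] .
  have sqX: "\<forall>X\<in>set Xs. square_mat X"
    using H_equiv_dim(1)[OF eqH] by (metis in_set_conv_nth square_mat_carrier)
  have sqY: "\<forall>Y\<in>set Ys. square_mat Y"
  proof
    fix Y assume "Y \<in> set Ys"
    then obtain l where "l < length Ys" "Y = Ys ! l" by (auto simp: in_set_conv_nth)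
    then obtain k where "k < length Xs" "Y = Ys ! \<sigma> k" using \<sigma>
      by (metis bij_betw_imp_surj_on imageE lessThan_iff)
    then show "square_mat Y" using H_equiv_dim(2,3)[OF eqH] by (metis square_mat_carrier)
  qed
  show ?thesis
    unfolding SH_equiv_iff[OF diag_block_carrier[OF sqX]]
    using diag_block_carrier[OF sqY] sum_dims_bij[OF \<sigma> dim]
      signed_perm_block[OF \<sigma> dim *(1)]
      diag_block_equivalence[OF \<sigma> sqX sqY dim *(1,1,2)]
    by auto
qed

lemma diag_block_map_H_equiv:
  assumes "\<And>x. x \<in> set xs \<Longrightarrow> H_equiv (f x) (g x)"
  shows "H_equiv (diag_block_mat (map f xs)) (diag_block_mat (map g xs))"
  by (rule diag_block_H_equiv[of id]) (use assms in auto)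

lemma diag_block_map_SH_equiv:
  assumes "\<And>x. x \<in> set xs \<Longrightarrow> SH_equiv (f x) (g x)"
  shows "SH_equiv (diag_block_mat (map f xs)) (diag_block_mat (map g xs))"
  by (rule diag_block_SH_equiv[of id]) (use assms in auto)

text \<open>Equal multisets give a bijection of positions, so reordering diagonal blocks is a
  congruence. From here on a block diagonal matrix may be treated as a multiset of blocks.\<close>

lemma diag_block_mset_SH_equiv:
  assumes "mset Xs = mset Ys" "\<forall>X\<in>set Xs. square_mat X"
  shows "SH_equiv (diag_block_mat Xs) (diag_block_mat Ys)"
proof -
  obtain \<sigma> where "bij_betw \<sigma> {..<length Xs} {..<length Ys}" "\<forall>i<length Xs. Xs ! i = Ys ! \<sigma> i"
    using permutation_Ex_bij[of Xs Ys] assms(1) by auto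
  then show ?thesis
    using assms(2)
    by (intro diag_block_SH_equiv[of \<sigma>]) (metis SH_equiv_refl nth_mem square_mat_carrier)+
qed

section \<open>Connected components and their matching\<close>

definition connected_on :: "('a \<Rightarrow> 'a \<Rightarrow> bool) \<Rightarrow> 'a set \<Rightarrow> bool" where
  "connected_on adj C \<longleftrightarrow> C \<noteq> {} \<and>
     (\<forall>S\<subseteq>C. S \<noteq> {} \<longrightarrow> (\<forall>x\<in>S. \<forall>y\<in>C. adj x y \<longrightarrow> y \<in> S) \<longrightarrow> S = C)"

lemma connected_onD:
  assumes "connected_on adj C" "S \<subseteq> C" "S \<noteq> {}" "\<And>x y. x \<in> S \<Longrightarrow> y \<in> C \<Longrightarrow> adj x y \<Longrightarrow> y \<in> S"
  shows "S = C"
  using assms unfolding connected_on_def by blast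

text \<open>The points of \<open>C\<close> that land in the same piece as one chosen point form a
  closed set, since no edge joins two different pieces. Connectedness, stated by closed sets rather
  than paths, makes this set all of \<open>C\<close>.\<close>

lemma component_image_subset:
  assumes "connected_on adj C" "\<pi> ` C \<subseteq> (\<Union>l\<in>L. D l)"
    and "\<And>x y. x \<in> C \<Longrightarrow> y \<in> C \<Longrightarrow> adj x y \<Longrightarrow> adj' (\<pi> x) (\<pi> y)"
    and sep: "\<And>l l' x y. l \<in> L \<Longrightarrow> l' \<in> L \<Longrightarrow> x \<in> D l \<Longrightarrow> y \<in> D l' \<Longrightarrow> adj' x y \<Longrightarrow> l = l'"
  shows "\<exists>l\<in>L. \<pi> ` C \<subseteq> D l"
proof -
  from assms(1) obtain x where x: "x \<in> C" by (auto simp: connected_on_def)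
  with assms(2) obtain l where l: "l \<in> L" "\<pi> x \<in> D l" by blast
  have "{y \<in> C. \<pi> y \<in> D l} = C"
  proof (rule connected_onD[OF assms(1)])
    fix y z assume y: "y \<in> {y \<in> C. \<pi> y \<in> D l}" and z: "z \<in> C" "adj y z"
    then obtain l' where l': "l' \<in> L" "\<pi> z \<in> D l'" using assms(2) by blast
    have "adj' (\<pi> y) (\<pi> z)" using y z assms(3) by auto
    then have "l = l'" using sep[OF l(1) l'(1) _ l'(2)] y by auto
    then show "z \<in> {y \<in> C. \<pi> y \<in> D l}" using z l' by auto
  qed (use x l in auto)
  then show ?thesis using l(1) by auto
qed

text \<open>The preceding inclusion, applied to \<open>\<pi>\<close> and to its inverse, yields maps
  \<open>\<sigma>\<close> and \<open>\<tau>\<close> between the index sets. They are mutually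
  inverse: follow one point of a component there and back and use that components are nonempty and
  disjoint.\<close>

lemma components_bij:
  assumes \<pi>: "bij_betw \<pi> (\<Union>k\<in>K. C k) (\<Union>l\<in>L. D l)"
    and adj: "\<And>x y. x \<in> (\<Union>k\<in>K. C k) \<Longrightarrow> y \<in> (\<Union>k\<in>K. C k) \<Longrightarrow> adj' (\<pi> x) (\<pi> y) \<longleftrightarrow> adj x y"
    and disjC: "\<And>k k' x. k \<in> K \<Longrightarrow> k' \<in> K \<Longrightarrow> x \<in> C k \<Longrightarrow> x \<in> C k' \<Longrightarrow> k = k'"
    and disjD: "\<And>l l' x. l \<in> L \<Longrightarrow> l' \<in> L \<Longrightarrow> x \<in> D l \<Longrightarrow> x \<in> D l' \<Longrightarrow> l = l'"
    and sepC: "\<And>k k' x y. k \<in> K \<Longrightarrow> k' \<in> K \<Longrightarrow> x \<in> C k \<Longrightarrow> y \<in> C k' \<Longrightarrow> adj x y \<Longrightarrow> k = k'"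
    and sepD: "\<And>l l' x y. l \<in> L \<Longrightarrow> l' \<in> L \<Longrightarrow> x \<in> D l \<Longrightarrow> y \<in> D l' \<Longrightarrow> adj' x y \<Longrightarrow> l = l'"
    and connC: "\<And>k. k \<in> K \<Longrightarrow> connected_on adj (C k)"
    and connD: "\<And>l. l \<in> L \<Longrightarrow> connected_on adj' (D l)"
  obtains \<sigma> where "bij_betw \<sigma> K L" "\<And>k. k \<in> K \<Longrightarrow> \<pi> ` C k = D (\<sigma> k)"
proof -
  define V W where "V = (\<Union>k\<in>K. C k)" and "W = (\<Union>l\<in>L. D l)"
  define \<rho> where "\<rho> = the_inv_into V \<pi>"
  have \<pi>V: "bij_betw \<pi> V W" using \<pi> by (simp add: V_def W_def)
  have \<rho>: "bij_betw \<rho> W V" unfolding \<rho>_def by (rule bij_betw_the_inv_into[OF \<pi>V])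
  have \<rho>\<pi>: "\<rho> (\<pi> x) = x" if "x \<in> V" for x
    using that \<pi>V by (simp add: \<rho>_def bij_betw_def the_inv_into_f_f)
  have \<pi>\<rho>: "\<pi> (\<rho> y) = y" if "y \<in> W" for y
    using that \<pi>V unfolding \<rho>_def bij_betw_def by (metis f_the_inv_into_f)
  have "\<exists>l\<in>L. \<pi> ` C k \<subseteq> D l" if "k \<in> K" for k
  proof (rule component_image_subset[OF connC[OF that] _ _ sepD])
    show "\<pi> ` C k \<subseteq> (\<Union>l\<in>L. D l)"
      using bij_betw_imp_surj_on[OF \<pi>] that by blast
  qed (use that adj in auto)
  then obtain \<sigma> where \<sigma>: "\<And>k. k \<in> K \<Longrightarrow> \<sigma> k \<in> L" "\<And>k. k \<in> K \<Longrightarrow> \<pi> ` C k \<subseteq> D (\<sigma> k)" by metis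
  have "\<exists>k\<in>K. \<rho> ` D l \<subseteq> C k" if "l \<in> L" for l
  proof (rule component_image_subset[OF connD[OF that] _ _ sepC])
    show "\<rho> ` D l \<subseteq> \<Union> (C ` K)" using \<rho> that by (auto simp: bij_betw_def V_def W_def)
    show "adj (\<rho> x) (\<rho> y)" if xy: "x \<in> D l" "y \<in> D l" "adj' x y" for x y
    proof -
      have "x \<in> W" "y \<in> W" using xy \<open>l \<in> L\<close> by (auto simp: W_def)
      moreover then have "\<rho> x \<in> V" "\<rho> y \<in> V" using \<rho> by (auto simp: bij_betw_def)
      ultimately show ?thesis using adj[of "\<rho> x" "\<rho> y"] \<pi>\<rho> xy by (simp add: V_def)
    qed
  qed
  then obtain \<tau> where \<tau>: "\<And>l. l \<in> L \<Longrightarrow> \<tau> l \<in> K" "\<And>l. l \<in> L \<Longrightarrow> \<rho> ` D l \<subseteq> C (\<tau> l)" by metis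
  have \<tau>\<sigma>: "\<tau> (\<sigma> k) = k" if k: "k \<in> K" for k
  proof -
    from connC[OF k] obtain x where x: "x \<in> C k" by (auto simp: connected_on_def)
    then have "\<rho> (\<pi> x) \<in> C (\<tau> (\<sigma> k))" using \<sigma> \<tau> k by blast
    moreover have "\<rho> (\<pi> x) = x" using x k by (intro \<rho>\<pi>) (auto simp: V_def)
    ultimately show ?thesis using disjC[OF _ k _ x] \<sigma> \<tau> k by auto
  qed
  have \<sigma>\<tau>: "\<sigma> (\<tau> l) = l" if l: "l \<in> L" for l
  proof -
    from connD[OF l] obtain x where x: "x \<in> D l" by (auto simp: connected_on_def)
    then have "\<pi> (\<rho> x) \<in> D (\<sigma> (\<tau> l))" using \<sigma> \<tau> l by blast
    moreover have "\<pi> (\<rho> x) = x" using x l by (intro \<pi>\<rho>) (auto simp: W_def)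
    ultimately show ?thesis using disjD[OF _ l _ x] \<sigma> \<tau> l by auto
  qed
  have "\<pi> ` C k = D (\<sigma> k)" if k: "k \<in> K" for k
  proof
    show "\<pi> ` C k \<subseteq> D (\<sigma> k)" using \<sigma> k by auto
    show "D (\<sigma> k) \<subseteq> \<pi> ` C k"
    proof
      fix y assume y: "y \<in> D (\<sigma> k)"
      then have "\<rho> y \<in> C k" using \<tau>[OF \<sigma>(1)[OF k]] \<tau>\<sigma>[OF k] by auto
      moreover have "\<pi> (\<rho> y) = y" using y \<sigma>(1)[OF k] by (intro \<pi>\<rho>) (auto simp: W_def)
      ultimately show "y \<in> \<pi> ` C k" by (metis imageI)
    qed
  qed
  moreover have "bij_betw \<sigma> K L"
    using \<tau>\<sigma> \<sigma>\<tau> \<sigma>(1) \<tau>(1) by (intro bij_betw_byWitness[of _ \<tau>]) auto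
  ultimately show ?thesis using that by blast
qed

definition index_adj :: "int mat \<Rightarrow> nat \<Rightarrow> nat \<Rightarrow> bool" where
  "index_adj X i j \<longleftrightarrow> X $$ (i, j) \<noteq> 0 \<or> X $$ (j, i) \<noteq> 0"

text \<open>The vertices \<open>(True, i)\<close> and \<open>(False, i)\<close> are the rows and columns.\<close>

fun bip_adj :: "int mat \<Rightarrow> bool \<times> nat \<Rightarrow> bool \<times> nat \<Rightarrow> bool" where
  "bip_adj X (b, i) (c, j) \<longleftrightarrow> b \<noteq> c \<and> (if b then X $$ (i, j) else X $$ (j, i)) \<noteq> 0"

definition index_connected :: "int mat \<Rightarrow> bool" where
  "index_connected X \<longleftrightarrow> square_mat X \<and> connected_on (index_adj X) {..<dim_row X}"

definition bip_connected :: "int mat \<Rightarrow> bool" where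
  "bip_connected X \<longleftrightarrow> square_mat X \<and> connected_on (bip_adj X) (UNIV \<times> {..<dim_row X})"

text \<open>The preimage of a closed set under a map preserving edges is closed. All transfers of
  connectedness below have this form, with \<open>e\<close> renaming, exchanging or merging
  vertices.\<close>

lemma connected_on_image:
  assumes "connected_on adj C" "\<And>x y. x \<in> C \<Longrightarrow> y \<in> C \<Longrightarrow> adj x y \<Longrightarrow> adj' (e x) (e y)"
  shows "connected_on adj' (e ` C)"
  unfolding connected_on_def
proof (intro conjI allI impI)
  show "e ` C \<noteq> {}" using assms(1) by (auto simp: connected_on_def)
  fix S assume S: "S \<subseteq> e ` C" "S \<noteq> {}" "\<forall>x\<in>S. \<forall>y\<in>e ` C. adj' x y \<longrightarrow> y \<in> S"
  have "{x \<in> C. e x \<in> S} = C"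
    by (rule connected_onD[OF assms(1)]) (use S assms(2) in auto)
  then show "S = e ` C" using S(1) by blast
qed

text \<open>Signs do not change supports, so a congruence is an isomorphism of index graphs and
  permutes their components, which are the blocks. The conclusion keeps the permutation
  \<open>q k\<close> inside each block and its link to \<open>p\<close>, because the automorphism
  groups are computed from these data.\<close>

theorem diag_block_congruence_blocks:
  assumes X: "\<forall>X\<in>set Xs. index_connected X" and Y: "\<forall>Y\<in>set Ys. index_connected Y"
    and N: "sum_list (map dim_row Xs) = N" "sum_list (map dim_row Ys) = N"
    and p: "signed_perm N p s"
    and eq: "\<And>i j. i < N \<Longrightarrow> j < N \<Longrightarrow> diag_block_mat Ys $$ (p i, p j) = s i * s j * diag_block_mat Xs
        $$ (i, j)"
  obtains \<sigma> q where "bij_betw \<sigma> {..<length Xs} {..<length Ys}"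
    "\<And>k. k < length Xs \<Longrightarrow> dim_row (Ys ! \<sigma> k) = dim_row (Xs ! k)"
    "\<And>k. k < length Xs \<Longrightarrow> signed_perm (dim_row (Xs ! k)) (q k) (\<lambda>i. s (block_pos Xs k i))"
    "\<And>k i j. k < length Xs \<Longrightarrow> i < dim_row (Xs ! k) \<Longrightarrow> j < dim_row (Xs ! k) \<Longrightarrow>
       Ys ! \<sigma> k $$ (q k i, q k j) = s (block_pos Xs k i) * s (block_pos Xs k j) * Xs ! k $$ (i, j)"
    "\<And>k i. k < length Xs \<Longrightarrow> i < dim_row (Xs ! k) \<Longrightarrow> p (block_pos Xs k i) = block_pos Ys (\<sigma> k) (q k i)"
proof -
  let ?C = "\<lambda>k. block_pos Xs k ` {..<dim_row (Xs ! k)}"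
  let ?D = "\<lambda>l. block_pos Ys l ` {..<dim_row (Ys ! l)}"
  let ?K = "{..<length Xs}" and ?L = "{..<length Ys}"
  have sqX: "\<forall>X\<in>set Xs. square_mat X" and sqY: "\<forall>Y\<in>set Ys. square_mat Y"
    using X Y by (auto simp: index_connected_def)
  have U: "(\<Union>k<length Zs. block_pos Zs k ` {..<dim_row (Zs ! k)}) = {..<sum_list (map dim_row Zs)}"
      for Zs
  proof -
    have "a \<in> (\<Union>k<length Zs. block_pos Zs k ` {..<dim_row (Zs ! k)})"
      if "a < sum_list (map dim_row Zs)" for a
      by (rule block_pos_surj[OF that]) auto
    then show ?thesis using block_pos_less[of _ Zs] by auto
  qed
  have V: "(\<Union>k\<in>?K. ?C k) = {..<N}" and W: "(\<Union>l\<in>?L. ?D l) = {..<N}"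
    using U[of Xs] U[of Ys] N by auto
  have conn: "connected_on (index_adj (diag_block_mat Zs)) (block_pos Zs k ` {..<dim_row (Zs ! k)})"
    if "\<forall>X\<in>set Zs. index_connected X" "k < length Zs" for Zs k
    using that diag_block_index[of Zs k _ k]
    by (intro connected_on_image[of "index_adj (Zs ! k)"]) (auto simp: index_connected_def
        index_adj_def)
  have disj: "k = k'" if "k < length Zs" "k' < length Zs" "x \<in> block_pos Zs k ` {..<dim_row (Zs ! k)}"
    "x \<in> block_pos Zs k' ` {..<dim_row (Zs ! k')}" for Zs k k' x
    using that block_pos_eq_iff[of k Zs _ k'] by auto
  have sep: "k = k'" if "\<forall>X\<in>set Zs. square_mat X" "k < length Zs" "k' < length Zs"
    "x \<in> block_pos Zs k ` {..<dim_row (Zs ! k)}"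
    "y \<in> block_pos Zs k' ` {..<dim_row (Zs ! k')}" "index_adj (diag_block_mat Zs) x y" for Zs k k' x y
    using that diag_block_index[of Zs k _ k'] diag_block_index[of Zs k' _ k]
    by (auto simp: index_adj_def split: if_splits)
  obtain \<sigma> where \<sigma>: "bij_betw \<sigma> ?K ?L" "\<And>k. k \<in> ?K \<Longrightarrow> p ` ?C k = ?D (\<sigma> k)"
  proof (rule components_bij[of p ?C ?K ?D ?L "index_adj (diag_block_mat Ys)" "index_adj
      (diag_block_mat Xs)"])
    show "bij_betw p (\<Union>k\<in>?K. ?C k) (\<Union>l\<in>?L. ?D l)" using p unfolding V W by (simp add: signed_perm_def)
    show "index_adj (diag_block_mat Ys) (p x) (p y) = index_adj (diag_block_mat Xs) x y"
      if "x \<in> (\<Union>k\<in>?K. ?C k)" "y \<in> (\<Union>k\<in>?K. ?C k)" for x y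
      using that eq signed_permD(4)[OF p] unfolding V by (simp add: index_adj_def)
  qed (use conn[OF X] conn[OF Y] disj sep[OF sqX] sep[OF sqY] in auto)
  \<comment> \<open>The image of block \<open>k\<close> is known to be block
    \<open>\<sigma> k\<close> of \<open>Ys\<close>, so only the position within the block is new
    information.\<close>
  define q where "q k i = snd (block_inv Ys (p (block_pos Xs k i)))" for k i
  have \<sigma>l: "\<sigma> k < length Ys" if "k < length Xs" for k using \<sigma> that by (auto simp: bij_betw_def)
  have q: "p (block_pos Xs k i) = block_pos Ys (\<sigma> k) (q k i)" "q k i < dim_row (Ys ! \<sigma> k)"
    if "k < length Xs" "i < dim_row (Xs ! k)" for k i
  proof -
    have "p (block_pos Xs k i) \<in> ?D (\<sigma> k)" using \<sigma>(2)[of k] that by auto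
    then obtain j where j: "j < dim_row (Ys ! \<sigma> k)" "p (block_pos Xs k i) = block_pos Ys (\<sigma> k) j" by
        auto
    then have "q k i = j" using block_inv_pos[OF \<sigma>l[OF that(1)] j(1)] by (simp add: q_def)
    with j show "p (block_pos Xs k i) = block_pos Ys (\<sigma> k) (q k i)" "q k i < dim_row (Ys ! \<sigma> k)" by auto
  qed
  have bij: "bij_betw (q k) {..<dim_row (Xs ! k)} {..<dim_row (Ys ! \<sigma> k)}" if k: "k < length Xs" for k
  proof (rule bij_betwI')
    fix i j assume ij: "i \<in> {..<dim_row (Xs ! k)}" "j \<in> {..<dim_row (Xs ! k)}"
    show "q k i = q k j \<longleftrightarrow> i = j"
      using signed_perm_inj[OF p, of "block_pos Xs k i" "block_pos Xs k j"] ij k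
        block_pos_less[of k Xs i] block_pos_less[of k Xs j] N q block_pos_eq_iff[OF k _ k, of i j]
            by auto
  next
    fix i assume "i \<in> {..<dim_row (Xs ! k)}"
    then show "q k i \<in> {..<dim_row (Ys ! \<sigma> k)}" using q k by auto
  next
    fix j assume j: "j \<in> {..<dim_row (Ys ! \<sigma> k)}"
    then have "block_pos Ys (\<sigma> k) j \<in> p ` ?C k" using \<sigma>(2)[of k] k by auto
    then obtain i where i: "i < dim_row (Xs ! k)" "block_pos Ys (\<sigma> k) j = p (block_pos Xs k i)" by auto
    then have "j = q k i" using q[OF k i(1)] block_pos_eq_iff[of "\<sigma> k" Ys j "\<sigma> k" "q k i"] \<sigma>l[OF k]
        j by auto
    then show "\<exists>i\<in>{..<dim_row (Xs ! k)}. j = q k i" using i by auto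
  qed
  have dim: "dim_row (Ys ! \<sigma> k) = dim_row (Xs ! k)" if "k < length Xs" for k
    using bij_betw_same_card[OF bij[OF that]] by simp
  show ?thesis
  proof (rule that[OF \<sigma>(1) dim])
    fix k assume k: "k < length Xs"
    show "signed_perm (dim_row (Xs ! k)) (q k) (\<lambda>i. s (block_pos Xs k i))"
      using bij[OF k] dim[OF k] signed_permD(2)[OF p] block_pos_less[OF k] N by (auto simp:
          signed_perm_def)
    fix i assume i: "i < dim_row (Xs ! k)"
    show "p (block_pos Xs k i) = block_pos Ys (\<sigma> k) (q k i)" using q k i by auto
    fix j assume j: "j < dim_row (Xs ! k)"
    show "Ys ! \<sigma> k $$ (q k i, q k j) = s (block_pos Xs k i) * s (block_pos Xs k j) * Xs ! k $$ (i, j)"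
      using eq[of "block_pos Xs k i" "block_pos Xs k j"] block_pos_less[OF k i] block_pos_less[OF k j] N
        diag_block_index[OF sqX k i k j] q[OF k i] q[OF k j]
        diag_block_index[OF sqY \<sigma>l[OF k] _ \<sigma>l[OF k], of "q k i" "q k j"] by auto
  qed auto
qed

corollary diag_block_SH_equiv_blocks:
  assumes X: "\<forall>X\<in>set Xs. index_connected X" and Y: "\<forall>Y\<in>set Ys. index_connected Y"
    and "SH_equiv (diag_block_mat Xs) (diag_block_mat Ys)"
  obtains \<sigma> where "bij_betw \<sigma> {..<length Xs} {..<length Ys}"
    "\<And>k. k < length Xs \<Longrightarrow> SH_equiv (Xs ! k) (Ys ! \<sigma> k)"
proof -
  let ?N = "sum_list (map dim_row Xs)"
  have sqX: "\<forall>X\<in>set Xs. square_mat X" and sqY: "\<forall>Y\<in>set Ys. square_mat Y"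
    using X Y by (auto simp: index_connected_def)
  have "diag_block_mat Ys \<in> carrier_mat ?N ?N"
    using assms(3) SH_equiv_iff[OF diag_block_carrier[OF sqX]] by blast
  then have N: "sum_list (map dim_row Ys) = ?N" using diag_block_carrier[OF sqY] by auto
  from assms(3) obtain p s where p: "signed_perm ?N p s"
    and eq: "\<And>i j. i < ?N \<Longrightarrow> j < ?N \<Longrightarrow> diag_block_mat Ys $$ (p i, p j) = s i * s j * diag_block_mat Xs
        $$ (i, j)"
    unfolding SH_equiv_iff[OF diag_block_carrier[OF sqX]] by blast
  obtain \<sigma> q where *: "bij_betw \<sigma> {..<length Xs} {..<length Ys}"
    "\<And>k. k < length Xs \<Longrightarrow> dim_row (Ys ! \<sigma> k) = dim_row (Xs ! k)"
    "\<And>k. k < length Xs \<Longrightarrow> signed_perm (dim_row (Xs ! k)) (q k) (\<lambda>i. s (block_pos Xs k i))"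
    "\<And>k i j. k < length Xs \<Longrightarrow> i < dim_row (Xs ! k) \<Longrightarrow> j < dim_row (Xs ! k) \<Longrightarrow>
       Ys ! \<sigma> k $$ (q k i, q k j) = s (block_pos Xs k i) * s (block_pos Xs k j) * Xs ! k $$ (i, j)"
    using diag_block_congruence_blocks[OF X Y refl N p eq] by metis
  have "SH_equiv (Xs ! k) (Ys ! \<sigma> k)" if k: "k < length Xs" for k
  proof -
    have "Xs ! k \<in> carrier_mat (dim_row (Xs ! k)) (dim_row (Xs ! k))"
      using sqX k by (metis nth_mem square_mat_carrier)
    moreover have "Ys ! \<sigma> k \<in> carrier_mat (dim_row (Xs ! k)) (dim_row (Xs ! k))"
      using sqY k *(1) *(2)[OF k] by (metis bij_betwE lessThan_iff nth_mem square_mat_carrier)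
    ultimately show ?thesis using *(3,4)[OF k] SH_equiv_iff by blast
  qed
  with *(1) show ?thesis using that by blast
qed

text \<open>Rows and columns are permuted by different maps; on tagged vertices both act as one
  bijection \<open>\<pi>\<close> of the bipartite graph. A component consists of the rows and the
  columns of one block, so a single \<open>\<sigma>\<close> serves both sides.\<close>

theorem diag_block_H_equiv_blocks:
  assumes X: "\<forall>X\<in>set Xs. bip_connected X" and Y: "\<forall>Y\<in>set Ys. bip_connected Y"
    and "H_equiv (diag_block_mat Xs) (diag_block_mat Ys)"
  obtains \<sigma> where "bij_betw \<sigma> {..<length Xs} {..<length Ys}"
    "\<And>k. k < length Xs \<Longrightarrow> H_equiv (Xs ! k) (Ys ! \<sigma> k)"
proof -
  let ?N = "sum_list (map dim_row Xs)"
  let ?K = "{..<length Xs}" and ?L = "{..<length Ys}"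
  have sqX: "\<forall>X\<in>set Xs. square_mat X" and sqY: "\<forall>Y\<in>set Ys. square_mat Y"
    using X Y by (auto simp: bip_connected_def)
  have "diag_block_mat Ys \<in> carrier_mat ?N ?N"
    using assms(3) H_equiv_iff[OF diag_block_carrier[OF sqX]] by blast
  then have N: "sum_list (map dim_row Ys) = ?N" using diag_block_carrier[OF sqY] by auto
  from assms(3) obtain p s q t where p: "signed_perm ?N p s" and q: "signed_perm ?N q t"
    and eq: "\<And>i j. i < ?N \<Longrightarrow> j < ?N \<Longrightarrow> diag_block_mat Ys $$ (p i, q j) = s i * t j * diag_block_mat Xs
        $$ (i, j)"
    unfolding H_equiv_iff[OF diag_block_carrier[OF sqX]] by blast
  define \<pi> where "\<pi> = (\<lambda>(b, i). (b :: bool, if b then p i else q i))"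
  let ?E = "\<lambda>Zs k. (\<lambda>(b :: bool, i). (b, block_pos Zs k i)) ` (UNIV \<times> {..<dim_row (Zs ! k)})"
  have U: "(\<Union>k<length Zs. ?E Zs k) = UNIV \<times> {..<sum_list (map dim_row Zs)}" for Zs
  proof -
    have "(b, a) \<in> (\<Union>k<length Zs. ?E Zs k)" if "a < sum_list (map dim_row Zs)" for a b
      by (rule block_pos_surj[OF that]) (auto simp: image_iff)
    then show ?thesis using block_pos_less[of _ Zs] by auto
  qed
  have conn: "connected_on (bip_adj (diag_block_mat Zs)) (?E Zs k)"
    if "\<forall>X\<in>set Zs. bip_connected X" "k < length Zs" for Zs k
  proof (rule connected_on_image[of "bip_adj (Zs ! k)"])
    show "connected_on (bip_adj (Zs ! k)) (UNIV \<times> {..<dim_row (Zs ! k)})"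
      using that by (auto simp: bip_connected_def)
    have "\<forall>X\<in>set Zs. square_mat X" using that by (auto simp: bip_connected_def)
    note * = diag_block_index[OF this that(2) _ that(2)]
    show "bip_adj (diag_block_mat Zs) (case x of (b, i) \<Rightarrow> (b, block_pos Zs k i))
      (case y of (b, i) \<Rightarrow> (b, block_pos Zs k i))"
      if "x \<in> UNIV \<times> {..<dim_row (Zs ! k)}" "y \<in> UNIV \<times> {..<dim_row (Zs ! k)}" "bip_adj (Zs ! k) x
          y" for x y
      using that * by (auto split: if_splits)
  qed
  have disj: "k = k'" if "k < length Zs" "k' < length Zs" "x \<in> ?E Zs k" "x \<in> ?E Zs k'" for Zs k k' x
    using that block_pos_eq_iff[of k Zs _ k'] by auto
  have sep: "k = k'" if "\<forall>X\<in>set Zs. square_mat X" "k < length Zs" "k' < length Zs"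
    "x \<in> ?E Zs k" "y \<in> ?E Zs k'" "bip_adj (diag_block_mat Zs) x y" for Zs k k' x y
    using that diag_block_index[of Zs k _ k'] diag_block_index[of Zs k' _ k]
    by (auto split: if_splits)
  have \<pi>: "bij_betw \<pi> (UNIV \<times> {..<?N}) (UNIV \<times> {..<?N})"
  proof (rule bij_betwI')
    fix x y assume "x \<in> (UNIV :: bool set) \<times> {..<?N}" "y \<in> (UNIV :: bool set) \<times> {..<?N}"
    then show "(\<pi> x = \<pi> y) = (x = y)"
      using signed_perm_inj[OF p] signed_perm_inj[OF q] by (auto simp: \<pi>_def split: if_splits)
  next
    fix x assume "x \<in> (UNIV :: bool set) \<times> {..<?N}"
    then show "\<pi> x \<in> (UNIV :: bool set) \<times> {..<?N}"
      using signed_permD(1)[OF p] signed_permD(1)[OF q] by (auto simp: \<pi>_def)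
  next
    fix y assume "y \<in> (UNIV :: bool set) \<times> {..<?N}"
    then obtain b a where y: "y = (b, a)" "a < ?N" by auto
    show "\<exists>x\<in>(UNIV :: bool set) \<times> {..<?N}. y = \<pi> x"
    proof (cases b)
      case True
      obtain i where "i < ?N" "p i = a" using signed_perm_surj[OF p y(2)] .
      then show ?thesis using True y by (intro bexI[of _ "(b, i)"]) (auto simp: \<pi>_def)
    next
      case False
      obtain i where "i < ?N" "q i = a" using signed_perm_surj[OF q y(2)] .
      then show ?thesis using False y by (intro bexI[of _ "(b, i)"]) (auto simp: \<pi>_def)
    qed
  qed
  obtain \<sigma> where \<sigma>: "bij_betw \<sigma> ?K ?L" "\<And>k. k \<in> ?K \<Longrightarrow> \<pi> ` ?E Xs k = ?E Ys (\<sigma> k)"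
  proof (rule components_bij[of \<pi> "?E Xs" ?K "?E Ys" ?L "bip_adj (diag_block_mat Ys)" "bip_adj
      (diag_block_mat Xs)"])
    show "bij_betw \<pi> (\<Union>k<length Xs. ?E Xs k) (\<Union>l<length Ys. ?E Ys l)"
      unfolding U N by (rule \<pi>)
    show "bip_adj (diag_block_mat Ys) (\<pi> x) (\<pi> y) = bip_adj (diag_block_mat Xs) x y"
      if "x \<in> (\<Union>k<length Xs. ?E Xs k)" "y \<in> (\<Union>k<length Xs. ?E Xs k)" for x y
      using that eq signed_permD(4)[OF p] signed_permD(4)[OF q] unfolding U by (auto simp: \<pi>_def)
  qed (use conn[OF X] conn[OF Y] disj sep[OF sqX] sep[OF sqY] in \<open>simp_all only: lessThan_iff\<close>)
  have \<sigma>l: "\<sigma> k < length Ys" if "k < length Xs" for k using \<sigma> that by (auto simp: bij_betw_def)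
  have blk: "H_equiv (Xs ! k) (Ys ! \<sigma> k)" if k: "k < length Xs" for k
  proof -
    let ?n = "dim_row (Xs ! k)" and ?m = "dim_row (Ys ! \<sigma> k)"
    \<comment> \<open>\<open>r True\<close> is the permutation of rows inside the block and
      \<open>r False\<close> that of columns.\<close>
    define r where "r b i = snd (block_inv Ys (snd (\<pi> (b, block_pos Xs k i))))" for b i
    have r: "snd (\<pi> (b, block_pos Xs k i)) = block_pos Ys (\<sigma> k) (r b i)" "r b i < ?m"
      if "i < ?n" for b i
    proof -
      have "\<pi> (b, block_pos Xs k i) \<in> ?E Ys (\<sigma> k)"
      proof -
        have "(b, block_pos Xs k i) \<in> ?E Xs k" using that by auto
        then show ?thesis using \<sigma>(2)[of k] k by blast
      qed
      then obtain j where j: "j < ?m" "snd (\<pi> (b, block_pos Xs k i)) = block_pos Ys (\<sigma> k) j" by auto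
      then have "r b i = j" using block_inv_pos[OF \<sigma>l[OF k] j(1)] by (simp add: r_def)
      with j show "snd (\<pi> (b, block_pos Xs k i)) = block_pos Ys (\<sigma> k) (r b i)" "r b i < ?m" by auto
    qed
    have bij: "bij_betw (r b) {..<?n} {..<?m}" for b
    proof (rule bij_betwI')
      fix i j assume ij: "i \<in> {..<?n}" "j \<in> {..<?n}"
      have "snd (\<pi> (b, block_pos Xs k i)) = snd (\<pi> (b, block_pos Xs k j)) \<longleftrightarrow> i = j"
        using signed_perm_inj[OF p, of "block_pos Xs k i" "block_pos Xs k j"]
          signed_perm_inj[OF q, of "block_pos Xs k i" "block_pos Xs k j"] ij k
          block_pos_less[of k Xs i] block_pos_less[of k Xs j] block_pos_eq_iff[OF k _ k, of i j]
        by (auto simp: \<pi>_def)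
      then show "r b i = r b j \<longleftrightarrow> i = j" using r(1)[of i b] r(1)[of j b] ij by auto
    next
      fix i assume "i \<in> {..<?n}" then show "r b i \<in> {..<?m}" using r by auto
    next
      fix j assume j: "j \<in> {..<?m}"
      have "(b, block_pos Ys (\<sigma> k) j) \<in> ?E Ys (\<sigma> k)" using j by auto
      then have "(b, block_pos Ys (\<sigma> k) j) \<in> \<pi> ` ?E Xs k" using \<sigma>(2)[of k] k by blast
      then obtain i where i: "i < ?n" "(b, block_pos Ys (\<sigma> k) j) = \<pi> (b, block_pos Xs k i)"
        by (auto simp: \<pi>_def)
      then have "j = r b i"
        using r[OF i(1)] block_pos_eq_iff[of "\<sigma> k" Ys j "\<sigma> k" "r b i"] \<sigma>l[OF k] j
        by (metis lessThan_iff snd_conv)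
      then show "\<exists>i\<in>{..<?n}. j = r b i" using i by auto
    qed
    have dim: "?m = ?n" using bij_betw_same_card[OF bij] by simp
    have 1: "signed_perm ?n (r True) (\<lambda>i. s (block_pos Xs k i))"
      using bij dim signed_permD(2)[OF p] block_pos_less[OF k] by (auto simp: signed_perm_def)
    have 2: "signed_perm ?n (r False) (\<lambda>i. t (block_pos Xs k i))"
      using bij dim signed_permD(2)[OF q] block_pos_less[OF k] by (auto simp: signed_perm_def)
    have 3: "Ys ! \<sigma> k $$ (r True i, r False j) = s (block_pos Xs k i) * t (block_pos Xs k j) * Xs !
        k $$ (i, j)"
      if i: "i < ?n" and j: "j < ?n" for i j
      using eq[of "block_pos Xs k i" "block_pos Xs k j"] block_pos_less[OF k i] block_pos_less[OF k j]
        diag_block_index[OF sqX k i k j] r[OF i, of True] r[OF j, of False]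
        diag_block_index[OF sqY \<sigma>l[OF k] _ \<sigma>l[OF k], of "r True i" "r False j"]
      by (auto simp: \<pi>_def)
    have 4: "Xs ! k \<in> carrier_mat ?n ?n"
      using sqX k by (metis nth_mem square_mat_carrier)
    have 5: "Ys ! \<sigma> k \<in> carrier_mat ?n ?n"
      using sqY \<sigma>l[OF k] dim by (metis nth_mem square_mat_carrier)
    show ?thesis unfolding H_equiv_iff[OF 4]
      using 1 2 3 5 by (intro conjI exI[of _ "r True"] exI[of _ "r False"] exI allI impI)
  qed
  show ?thesis using that[OF \<sigma>(1) blk] .
qed

section \<open>Anti-symmetric weighing matrices\<close>

lemma sum_lessThan_add:
  fixes f :: "nat \<Rightarrow> 'a :: comm_monoid_add"
  shows "(\<Sum>j<n + m. f j) = (\<Sum>j<n. f j) + (\<Sum>j<m. f (n + j))"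
  by (induction m) (auto simp: add.assoc)

text \<open>The part of the weighing property on which the counting argument rests. It is invariant
  under H-equivalence and passes to diagonal blocks with the same \<open>k\<close>.\<close>

definition balanced :: "int \<Rightarrow> int mat \<Rightarrow> bool" where
  "balanced k A \<longleftrightarrow> square_mat A \<and> 0 < k \<and>
     (\<forall>i<dim_row A. (\<Sum>j<dim_row A. A $$ (i, j) * A $$ (i, j)) = k) \<and>
     (\<forall>j<dim_row A. (\<Sum>i<dim_row A. A $$ (i, j) * A $$ (i, j)) = k)"

text \<open>An inverse of \<open>A\<close> need not exist over the integers, so the passage to the
  other product uses the adjugate: multiply \<open>A (A^T A) = k A\<close> from the left by
  \<open>adj_mat A\<close> and cancel \<open>det A\<close>, which is nonzero because its square is
  \<open>k ^ n\<close>.\<close>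

lemma int_weighing_transpose:
  assumes A: "(A :: int mat) \<in> carrier_mat n n" and k: "k \<noteq> 0"
    and AA: "A * transpose_mat A = k \<cdot>\<^sub>m 1\<^sub>m n"
  shows "transpose_mat A * A = k \<cdot>\<^sub>m 1\<^sub>m n"
proof -
  note At [simp] = transpose_carrier_mat[THEN iffD2, OF A]
  note A [simp]
  have "det A * det (transpose_mat A) = k ^ n"
    using det_mult[OF A At] AA by (simp add: det_smult)
  then have d: "det A \<noteq> 0" using k by auto
  have adj [simp]: "adj_mat A \<in> carrier_mat n n" using adj_mat[OF A] by auto
  have "A * (transpose_mat A * A) = k \<cdot>\<^sub>m A"
    by (subst assoc_mult_mat[of _ n n _ n _ n, symmetric])
      (simp_all add: AA mult_smult_assoc_mat[of "1\<^sub>m n" n n A n] left_mult_one_mat[OF A])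
  then have "adj_mat A * (A * (transpose_mat A * A)) = k \<cdot>\<^sub>m (adj_mat A * A)"
    by (simp add: mult_smult_distrib[of _ n n _ n])
  then have "(adj_mat A * A) * (transpose_mat A * A) = k \<cdot>\<^sub>m (adj_mat A * A)"
    by (subst assoc_mult_mat[of _ n n _ n _ n]) simp_all
  then have "det A \<cdot>\<^sub>m (transpose_mat A * A) = k \<cdot>\<^sub>m (det A \<cdot>\<^sub>m 1\<^sub>m n)"
    by (simp add: adj_mat(3)[OF A] mult_smult_assoc_mat[of "1\<^sub>m n" n n _ n] left_mult_one_mat[of _ n n])
  then have *: "(det A \<cdot>\<^sub>m (transpose_mat A * A)) $$ (i, j) = (k \<cdot>\<^sub>m (det A \<cdot>\<^sub>m 1\<^sub>m n)) $$ (i, j)"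
      for i j
    by (rule arg_cong)
  have "(transpose_mat A * A) $$ (i, j) = (k \<cdot>\<^sub>m 1\<^sub>m n) $$ (i, j)" if ij: "i < n" "j < n" for i j
  proof -
    have c: "transpose_mat A * A \<in> carrier_mat n n" by simp
    have "det A * (transpose_mat A * A) $$ (i, j) = k * (det A * (1\<^sub>m n) $$ (i, j))"
      using *[of i j] ij carrier_matD[OF c] by (metis index_smult_mat(1,2,3) index_one_mat(2,3))
    then have "det A * (transpose_mat A * A) $$ (i, j) = det A * (k * (1\<^sub>m n) $$ (i, j))" by simp
    then have "(transpose_mat A * A) $$ (i, j) = k * (1\<^sub>m n) $$ (i, j)"
      using d mult_left_cancel by blast
    then show ?thesis using ij by simp
  qed
  note index = this
  show ?thesis
  proof (rule eq_matI)
    fix i j assume "i < dim_row (k \<cdot>\<^sub>m 1\<^sub>m n)" "j < dim_col (k \<cdot>\<^sub>m 1\<^sub>m n)"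
    then show "(transpose_mat A * A) $$ (i, j) = (k \<cdot>\<^sub>m 1\<^sub>m n) $$ (i, j)" by (intro index) auto
  qed (use carrier_matD[OF A] in auto)
qed

lemma int_weighing_imp_balanced:
  assumes "int_weighing A"
  obtains k where "balanced k A"
proof -
  let ?n = "dim_row A"
  from assms obtain k where k: "k > 0" "A * transpose_mat A = k \<cdot>\<^sub>m 1\<^sub>m ?n"
    and A: "A \<in> carrier_mat ?n ?n"
    unfolding int_weighing_def square_mat_carrier by blast
  have AtA: "transpose_mat A * A = k \<cdot>\<^sub>m 1\<^sub>m ?n"
    using int_weighing_transpose[OF A _ k(2)] k(1) by auto
  have c: "dim_col A = ?n" using carrier_matD(2)[OF A] .
  have "(\<Sum>j<?n. A $$ (i, j) * A $$ (i, j)) = k" if "i < ?n" for i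
  proof -
    have "(A * transpose_mat A) $$ (i, i) = k" using k that by simp
    then show ?thesis using that c by (simp add: scalar_prod_def lessThan_atLeast0)
  qed
  moreover have "(\<Sum>i<?n. A $$ (i, j) * A $$ (i, j)) = k" if "j < ?n" for j
  proof -
    have "(transpose_mat A * A) $$ (j, j) = k" using AtA that by simp
    then show ?thesis using that c by (simp add: scalar_prod_def lessThan_atLeast0)
  qed
  ultimately have "balanced k A" using k(1) c by (simp add: balanced_def)
  then show ?thesis by (rule that)
qed

lemma balanced_H_equiv:
  assumes "balanced k A" "H_equiv A B"
  shows "balanced k B"
proof -
  define n where "n = dim_row A"
  have A: "A \<in> carrier_mat n n" using assms(1) unfolding n_def balanced_def square_mat_carrier by blast
  from assms(2) obtain p s q t where p: "signed_perm n p s" and q: "signed_perm n q t"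
    and eq: "\<And>i j. i < n \<Longrightarrow> j < n \<Longrightarrow> B $$ (p i, q j) = s i * t j * A $$ (i, j)"
    and B: "B \<in> carrier_mat n n"
    unfolding H_equiv_iff[OF A] by blast
  have sq: "B $$ (p i, q j) * B $$ (p i, q j) = A $$ (i, j) * A $$ (i, j)" if "i < n" "j < n" for i j
  proof -
    have "B $$ (p i, q j) * B $$ (p i, q j) = (s i * s i) * (t j * t j) * (A $$ (i, j) * A $$ (i, j))"
      by (simp add: eq[OF that] mult_ac)
    then show ?thesis using signed_permD(3)[OF p that(1)] signed_permD(3)[OF q that(2)] by simp
  qed
  have bp: "bij_betw p {..<n} {..<n}" and bq: "bij_betw q {..<n} {..<n}"
    using p q by (auto simp: signed_perm_def)
  have "(\<Sum>b<n. B $$ (a, b) * B $$ (a, b)) = k" if a: "a < n" for a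
  proof -
    obtain i where i: "i < n" "p i = a" using signed_perm_surj[OF p a] .
    have "(\<Sum>b<n. B $$ (a, b) * B $$ (a, b)) = (\<Sum>j<n. B $$ (p i, q j) * B $$ (p i, q j))"
      unfolding i(2) by (rule sum.reindex_bij_betw[OF bq, symmetric])
    also have "\<dots> = (\<Sum>j<n. A $$ (i, j) * A $$ (i, j))" using sq i(1) by (intro sum.cong) auto
    also have "\<dots> = k" using i assms(1) by (simp add: balanced_def n_def)
    finally show ?thesis .
  qed
  moreover have "(\<Sum>a<n. B $$ (a, b) * B $$ (a, b)) = k" if b: "b < n" for b
  proof -
    obtain j where j: "j < n" "q j = b" using signed_perm_surj[OF q b] .
    have "(\<Sum>a<n. B $$ (a, b) * B $$ (a, b)) = (\<Sum>i<n. B $$ (p i, q j) * B $$ (p i, q j))"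
      unfolding j(2) by (rule sum.reindex_bij_betw[OF bp, symmetric])
    also have "\<dots> = (\<Sum>i<n. A $$ (i, j) * A $$ (i, j))" using sq j(1) by (intro sum.cong) auto
    also have "\<dots> = k" using j assms(1) by (simp add: balanced_def n_def)
    finally show ?thesis .
  qed
  ultimately show ?thesis using B assms(1) by (simp add: balanced_def)
qed

lemma balanced_four_block:
  assumes A: "A \<in> carrier_mat n n" and D: "D \<in> carrier_mat m m"
    and bal: "balanced k (four_block_mat A (0\<^sub>m n m) (0\<^sub>m m n) D)"
  shows "balanced k A" "balanced k D"
proof -
  let ?F = "four_block_mat A (0\<^sub>m n m) (0\<^sub>m m n) D"
  have d: "dim_row ?F = n + m" using A D by simp
  have r: "(\<Sum>j<n + m. ?F $$ (i, j) * ?F $$ (i, j)) = k" "(\<Sum>j<n + m. ?F $$ (j, i) * ?F $$ (j, i)) = k"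
    if "i < n + m" for i
    using bal that unfolding balanced_def d by auto
  have "(\<Sum>j<n. A $$ (i, j) * A $$ (i, j)) = k" "(\<Sum>j<n. A $$ (j, i) * A $$ (j, i)) = k" if "i < n" for i
    using r[of i] that A D by (simp_all add: sum_lessThan_add)
  then show "balanced k A" using bal A by (simp add: balanced_def)
  have "(\<Sum>j<m. D $$ (i, j) * D $$ (i, j)) = k" "(\<Sum>j<m. D $$ (j, i) * D $$ (j, i)) = k" if "i < m" for i
    using r[of "n + i"] that A D by (simp_all add: sum_lessThan_add)
  then show "balanced k D" using bal D by (simp add: balanced_def)
qed

lemma balanced_diag_block:
  assumes "\<forall>X\<in>set Xs. square_mat X" "balanced k (diag_block_mat Xs)" "X \<in> set Xs"
  shows "balanced k X"
  using assms
proof (induction Xs)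
  case (Cons Z Xs)
  have Z: "Z \<in> carrier_mat (dim_row Z) (dim_row Z)"
    using Cons.prems(1) unfolding square_mat_carrier by simp
  have D: "diag_block_mat Xs \<in> carrier_mat (sum_list (map dim_row Xs)) (sum_list (map dim_row Xs))"
    using Cons.prems(1) by (intro diag_block_carrier) auto
  have "balanced k (four_block_mat Z (0\<^sub>m (dim_row Z) (sum_list (map dim_row Xs)))
      (0\<^sub>m (sum_list (map dim_row Xs)) (dim_row Z)) (diag_block_mat Xs))"
    using Cons.prems(2) carrier_matD[OF D] carrier_matD(2)[OF Z] by (simp add: Let_def)
  note * = balanced_four_block[OF Z D this]
  show ?case using Cons.IH[OF _ *(2)] *(1) Cons.prems(1,3) by auto
qed simp

text \<open>Double counting of the squared entries in \<open>S \<times> T\<close>. By closedness a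
  row from \<open>S\<close> has its whole norm in the columns of \<open>T\<close> and conversely, so
  the sum equals both \<open>k * card S\<close> and \<open>k * card T\<close>, with
  \<open>k > 0\<close>.\<close>

lemma balanced_closed_card:
  assumes "balanced k A" and S: "S \<subseteq> {..<dim_row A}" and T: "T \<subseteq> {..<dim_row A}"
    and closed: "\<And>i j. i < dim_row A \<Longrightarrow> j < dim_row A \<Longrightarrow> A $$ (i, j) \<noteq> 0 \<Longrightarrow> i \<in> S \<longleftrightarrow> j \<in> T"
  shows "card S = card T"
proof -
  let ?n = "dim_row A" and ?f = "\<lambda>i j. A $$ (i, j) * A $$ (i, j)"
  have k: "k > 0" using assms(1) by (simp add: balanced_def)
  have "k * int (card S) = (\<Sum>i\<in>S. \<Sum>j<?n. ?f i j)"
    using assms(1) S by (subst sum.cong[OF refl, of S _ "\<lambda>_. k"]) (auto simp: balanced_def)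
  also have "\<dots> = (\<Sum>i\<in>S. \<Sum>j\<in>T. ?f i j)"
    using S T closed by (intro sum.cong refl sum.mono_neutral_right) auto
  also have "\<dots> = (\<Sum>j\<in>T. \<Sum>i\<in>S. ?f i j)" by (rule sum.swap)
  also have "\<dots> = (\<Sum>j\<in>T. \<Sum>i<?n. ?f i j)"
    using S T closed by (intro sum.cong refl sum.mono_neutral_left) auto
  also have "\<dots> = k * int (card T)"
    using assms(1) T by (subst sum.cong[OF refl, of T _ "\<lambda>_. k"]) (auto simp: balanced_def)
  finally show ?thesis using k by simp
qed

section \<open>Sorting closed sets to the front: primitive matrices and decompositions\<close>

lemma obtain_perm_onto:
  assumes "S \<subseteq> {..<n}"
  obtains e where "bij_betw e {..<n} {..<n}" "e ` {..<card S} = S" "e ` {card S..<n} = {..<n} - S"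
proof -
  let ?m = "card S"
  have fin: "finite S" using assms finite_subset by blast
  have le: "?m \<le> n" using card_mono[OF _ assms] by simp
  obtain f where f: "bij_betw f {..<?m} S"
    using ex_bij_betw_nat_finite[OF fin] by (auto simp: lessThan_atLeast0)
  have "card {?m..<n} = card ({..<n} - S)" using assms fin by (simp add: card_Diff_subset)
  then obtain g where g: "bij_betw g {?m..<n} ({..<n} - S)"
    using finite_same_card_bij by blast
  define e where "e i = (if i \<in> {..<?m} then f i else g i)" for i
  have e1: "bij_betw e {..<?m} S" using f by (rule bij_betw_cong[THEN iffD1, rotated]) (simp add: e_def)
  have e2: "bij_betw e {?m..<n} ({..<n} - S)" using g by (rule bij_betw_cong[THEN iffD1, rotated])
      (simp add: e_def)
  have "bij_betw e ({..<?m} \<union> {?m..<n}) (S \<union> ({..<n} - S))"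
    by (rule bij_betw_combine[OF e1 e2]) auto
  moreover have "{..<?m} \<union> {?m..<n} = {..<n}" using le by auto
  moreover have "S \<union> ({..<n} - S) = {..<n}" using assms by auto
  ultimately show ?thesis using that e1 e2 by (metis bij_betw_imp_surj_on)
qed

lemma signed_perm_1: "bij_betw e {..<n} {..<n} \<Longrightarrow> signed_perm n e (\<lambda>_. 1)"
  by (simp add: signed_perm_def)

lemma permuted_H_equiv:
  assumes "X \<in> carrier_mat n n" "bij_betw e {..<n} {..<n}" "bij_betw f {..<n} {..<n}"
  shows "H_equiv (mat n n (\<lambda>(i, j). X $$ (e i, f j))) X"
proof -
  have c: "mat n n (\<lambda>(i, j). X $$ (e i, f j)) \<in> carrier_mat n n" by simp
  show ?thesis
    unfolding H_equiv_iff[OF c] using assms(1) signed_perm_1[OF assms(2)] signed_perm_1[OF assms(3)]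
    by (intro conjI exI[of _ e] exI[of _ f] exI[of _ "\<lambda>_. 1"]) auto
qed

lemma permuted_SH_equiv:
  assumes "X \<in> carrier_mat n n" "bij_betw e {..<n} {..<n}"
  shows "SH_equiv (mat n n (\<lambda>(i, j). X $$ (e i, e j))) X"
proof -
  have c: "mat n n (\<lambda>(i, j). X $$ (e i, e j)) \<in> carrier_mat n n" by simp
  show ?thesis
    unfolding SH_equiv_iff[OF c] using assms(1) signed_perm_1[OF assms(2)]
    by (intro conjI exI[of _ e] exI[of _ "\<lambda>_. 1"]) auto
qed

lemma split_diag_block:
  assumes "B \<in> carrier_mat n n" "m \<le> n"
    and "\<And>i j. i < m \<Longrightarrow> m \<le> j \<Longrightarrow> j < n \<Longrightarrow> B $$ (i, j) = 0"
    and "\<And>i j. i < m \<Longrightarrow> m \<le> j \<Longrightarrow> j < n \<Longrightarrow> B $$ (j, i) = 0"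
  shows "B = diag_block_mat [mat m m (\<lambda>ij. B $$ ij), mat (n - m) (n - m) (\<lambda>(i, j). B $$ (m + i, m +
      j))]"
  using assms by (intro eq_matI) (auto simp: Let_def)

text \<open>A proper closed set, with rows \<open>S\<close> and columns \<open>T\<close>, would give
  a block diagonal form after sorting. Equal cardinalities make both blocks square and
  \<open>0 < card S < n\<close> makes both smaller than the matrix, against primitivity.\<close>

lemma primitive_imp_bip_connected:
  assumes "primitive A"
  shows "bip_connected A"
proof -
  define n where "n = dim_row A"
  have w: "int_weighing A" and n: "0 < n" using assms by (auto simp: primitive_def n_def)
  then have A: "A \<in> carrier_mat n n" unfolding int_weighing_def n_def square_mat_carrier by blast
  obtain k where bal: "balanced k A" using int_weighing_imp_balanced[OF w] .
  have "U = UNIV \<times> {..<n}" if U: "U \<subseteq> UNIV \<times> {..<n}" "U \<noteq> {}"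
    and cl: "\<forall>x\<in>U. \<forall>y\<in>UNIV \<times> {..<n}. bip_adj A x y \<longrightarrow> y \<in> U" for U
  proof -
    define S T where "S = {i. (True, i) \<in> U}" and "T = {j. (False, j) \<in> U}"
    have ST: "S \<subseteq> {..<n}" "T \<subseteq> {..<n}" using U by (auto simp: S_def T_def)
    have iff: "i \<in> S \<longleftrightarrow> j \<in> T" if "i < n" "j < n" "A $$ (i, j) \<noteq> 0" for i j
      using cl that by (force simp: S_def T_def)
    have card: "card S = card T"
      using balanced_closed_card[OF bal, of S T] ST iff by (simp add: n_def)
    have "S \<noteq> {} \<or> T \<noteq> {}"
    proof -
      obtain b i where "(b, i) \<in> U" using U(2) by auto
      then show ?thesis by (cases b) (auto simp: S_def T_def)
    qed
    \<comment> \<open>A closed set could a priori consist of columns only; equality of the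
      cardinalities excludes this.\<close>
    then have pos: "0 < card S" using card ST finite_subset[of S "{..<n}"] finite_subset[of T "{..<n}"]
      by (auto simp: card_gt_0_iff)
    have "card S = n"
    proof (rule ccontr)
      assume "card S \<noteq> n"
      then have lt: "card S < n" using card_mono[OF _ ST(1)] by simp
      define m where "m = card S"
      \<comment> \<open>Rows and columns are sorted independently, by \<open>e\<close> and
        \<open>f\<close>, as H-equivalence permits.\<close>
      obtain e where e: "bij_betw e {..<n} {..<n}" "e ` {..<m} = S" "e ` {m..<n} = {..<n} - S"
        using obtain_perm_onto[OF ST(1)] unfolding m_def .
      obtain f where f: "bij_betw f {..<n} {..<n}" "f ` {..<m} = T" "f ` {m..<n} = {..<n} - T"
        using obtain_perm_onto[OF ST(2)] unfolding m_def card .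
      define B where "B = mat n n (\<lambda>(i, j). A $$ (e i, f j))"
      have HB: "H_equiv B A" unfolding B_def by (rule permuted_H_equiv[OF A e(1) f(1)])
      have en: "e i < n" "f i < n" if "i < n" for i
        using that e(1) f(1) by (auto simp: bij_betw_def)
      have eS: "e i \<in> S" "f i \<in> T" if "i < m" for i using that e(2) f(2) by auto
      have eS': "e i \<notin> S" "f i \<notin> T" if "m \<le> i" "i < n" for i
      proof -
        have "e i \<in> e ` {m..<n}" "f i \<in> f ` {m..<n}" using that by auto
        then show "e i \<notin> S" "f i \<notin> T" unfolding e(3) f(3) by auto
      qed
      have "B = diag_block_mat [mat m m (\<lambda>ij. B $$ ij), mat (n - m) (n - m) (\<lambda>(i, j). B $$ (m + i, m
          + j))]"
      proof (rule split_diag_block)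
        fix i j assume ij: "i < m" "m \<le> j" "j < n"
        then have "i < n" using lt by (simp add: m_def)
        then show "B $$ (i, j) = 0" "B $$ (j, i) = 0"
          using iff[of "e i" "f j"] iff[of "e j" "f i"] en eS[OF ij(1)] eS'[OF ij(2,3)] ij by (auto
              simp: B_def)
      qed (use lt in \<open>auto simp: B_def m_def\<close>)
      with H_equiv_sym[OF HB] have "H_equiv A (diag_block_mat [mat m m (\<lambda>ij. B $$ ij),
          mat (n - m) (n - m) (\<lambda>(i, j). B $$ (m + i, m + j))])" by metis
      moreover have "m < n" "n - m < n" using lt pos by (auto simp: m_def)
      ultimately show False
        using assms unfolding primitive_def n_def[symmetric]
        by (auto dest!: spec[of _ "[mat m m (\<lambda>ij. B $$ ij), mat (n - m) (n - m) (\<lambda>(i, j). B $$ (m +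
            i, m + j))]"])
    qed
    then have "S = {..<n}" "T = {..<n}" using ST card by (simp_all add: card_subset_eq)
    then have "(b, i) \<in> U" if "i < n" for b i using that by (cases b) (auto simp: S_def T_def)
    then show ?thesis using U(1) by auto
  qed
  then show ?thesis
    using n A unfolding bip_connected_def connected_on_def n_def[symmetric] by auto
qed

lemma diag_block_mat_two:
  "diag_block_mat [P, Q] = four_block_mat P (0\<^sub>m (dim_row P) (dim_col Q)) (0\<^sub>m (dim_row Q) (dim_col
      P)) Q"
  by (metis diag_block_mat.simps(2) diag_block_mat_singleton)

text \<open>Induction on the size: a proper closed set of indices is sorted to the front by one
  permutation for rows and columns alike, and both off-diagonal blocks vanish because the index
  graph ignores the direction of an entry.\<close>

lemma index_connected_decomposition:
  assumes "square_mat X"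
  shows "\<exists>Zs. SH_equiv X (diag_block_mat Zs) \<and> (\<forall>Z\<in>set Zs. index_connected Z)"
  using assms
proof (induction "dim_row X" arbitrary: X rule: less_induct)
  case less
  define n where "n = dim_row X"
  have X: "X \<in> carrier_mat n n" using less.prems unfolding n_def square_mat_carrier .
  consider "n = 0" | "index_connected X" | "0 < n" "\<not> index_connected X" by auto
  then show ?case
  proof cases
    case 1
    \<comment> \<open>Connectedness includes nonemptiness, so the matrix of size zero is the empty
      sum and not a block.\<close>
    then have "X = diag_block_mat []" using X by auto
    then show ?thesis using SH_equiv_refl[OF X] by (intro exI[of _ "[]"]) auto
  next
    case 2
    then show ?thesis using SH_equiv_refl[OF X]
      by (intro exI[of _ "[X]"]) (simp del: diag_block_mat.simps)
  next
    case 3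
    then obtain S where S: "S \<subseteq> {..<n}" "S \<noteq> {}" "S \<noteq> {..<n}"
      and cl: "\<And>i j. i \<in> S \<Longrightarrow> j < n \<Longrightarrow> index_adj X i j \<Longrightarrow> j \<in> S"
      using less.prems unfolding index_connected_def connected_on_def n_def[symmetric] by auto
    define m where "m = card S"
    have fin: "finite S" using S(1) finite_subset by blast
    have m: "0 < m" "m < n"
      using S fin psubset_card_mono[of "{..<n}" S] by (auto simp: m_def card_gt_0_iff)
    obtain e where e: "bij_betw e {..<n} {..<n}" "e ` {..<m} = S" "e ` {m..<n} = {..<n} - S"
      using obtain_perm_onto[OF S(1)] unfolding m_def .
    define B where "B = mat n n (\<lambda>(i, j). X $$ (e i, e j))"
    have HB: "SH_equiv B X" unfolding B_def by (rule permuted_SH_equiv[OF X e(1)])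
    define B1 B2 where "B1 = mat m m (\<lambda>ij. B $$ ij)" and "B2 = mat (n - m) (n - m) (\<lambda>(i, j). B $$ (m
        + i, m + j))"
    have split: "B = diag_block_mat [B1, B2]"
      unfolding B1_def B2_def
    proof (rule split_diag_block)
      fix i j assume ij: "i < m" "m \<le> j" "j < n"
      have "e i \<in> S" using ij e(2) by auto
      moreover have "e j \<in> {..<n} - S" using ij unfolding e(3)[symmetric] by auto
      ultimately show "B $$ (i, j) = 0" "B $$ (j, i) = 0"
        using cl[of "e i" "e j"] ij m by (auto simp: B_def index_adj_def)
    qed (use m in \<open>auto simp: B_def\<close>)
    have sq: "square_mat B1" "square_mat B2" by (auto simp: B1_def B2_def)
    have dims: "dim_row B1 < dim_row X" "dim_row B2 < dim_row X" using m by (auto simp: B1_def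
        B2_def n_def)
    obtain Zs1 where Z1: "SH_equiv B1 (diag_block_mat Zs1)" "\<forall>Z\<in>set Zs1. index_connected Z"
      using less.hyps[OF dims(1) sq(1)] by blast
    obtain Zs2 where Z2: "SH_equiv B2 (diag_block_mat Zs2)" "\<forall>Z\<in>set Zs2. index_connected Z"
      using less.hyps[OF dims(2) sq(2)] by blast
    have "SH_equiv (diag_block_mat [B1, B2]) (diag_block_mat [diag_block_mat Zs1, diag_block_mat Zs2])"
      by (rule diag_block_SH_equiv[of id]) (use Z1 Z2 in \<open>auto simp: less_Suc_eq\<close>)
    also have "diag_block_mat [diag_block_mat Zs1, diag_block_mat Zs2] = diag_block_mat (Zs1 @ Zs2)"
      by (simp only: diag_block_mat_append diag_block_mat_two Let_def)
    finally have "SH_equiv X (diag_block_mat (Zs1 @ Zs2))"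
      using SH_equiv_trans[OF SH_equiv_sym[OF HB]] split by metis
    then show ?thesis using Z1 Z2 by (intro exI[of _ "Zs1 @ Zs2"]) auto
  qed
qed

section \<open>Anti-symmetric matrices and skew blocks\<close>

lemma antisymmetric_iff:
  assumes "X \<in> carrier_mat n n"
  shows "antisymmetric X \<longleftrightarrow> (\<forall>i<n. \<forall>j<n. X $$ (j, i) = - X $$ (i, j))"
proof
  assume "antisymmetric X"
  then have "transpose_mat X $$ (i, j) = (- X) $$ (i, j)" for i j by (simp add: antisymmetric_def)
  then show "\<forall>i<n. \<forall>j<n. X $$ (j, i) = - X $$ (i, j)"
    using assms by (metis carrier_matD(1,2) index_transpose_mat(1) index_uminus_mat(1))
next
  assume *: "\<forall>i<n. \<forall>j<n. X $$ (j, i) = - X $$ (i, j)"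
  have "transpose_mat X $$ (i, j) = (- X) $$ (i, j)" if "i < n" "j < n" for i j
  proof -
    have "X $$ (j, i) = - X $$ (i, j)" using * that by blast
    then show ?thesis using assms that by simp
  qed
  note index = this
  show "antisymmetric X"
    unfolding antisymmetric_def
  proof (rule eq_matI)
    fix i j assume "i < dim_row (- X)" "j < dim_col (- X)"
    then show "transpose_mat X $$ (i, j) = (- X) $$ (i, j)" using assms by (intro index) auto
  qed (use assms in auto)
qed

lemma antisymmetric_SH_equiv:
  assumes "SH_equiv X Y" "antisymmetric X"
  shows "antisymmetric Y"
proof -
  from assms(1) obtain n where X: "X \<in> carrier_mat n n" by (elim SH_equivE)
  with assms(1) obtain p s where Y: "Y \<in> carrier_mat n n" and p: "signed_perm n p s"
    and eq: "\<And>i j. i < n \<Longrightarrow> j < n \<Longrightarrow> Y $$ (p i, p j) = s i * s j * X $$ (i, j)"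
    unfolding SH_equiv_iff[OF X] by blast
  have "Y $$ (b, a) = - Y $$ (a, b)" if "a < n" "b < n" for a b
  proof -
    obtain i where i: "i < n" "p i = a" using signed_perm_surj[OF p \<open>a < n\<close>] .
    obtain j where j: "j < n" "p j = b" using signed_perm_surj[OF p \<open>b < n\<close>] .
    have "X $$ (j, i) = - X $$ (i, j)" using assms(2) i j antisymmetric_iff[OF X] by blast
    then show ?thesis using eq[OF i(1) j(1)] eq[OF j(1) i(1)] i j by simp
  qed
  then show ?thesis using antisymmetric_iff[OF Y] by blast
qed

lemma antisymmetric_diag_block:
  assumes "\<forall>X\<in>set Xs. square_mat X"
  shows "antisymmetric (diag_block_mat Xs) \<longleftrightarrow> (\<forall>X\<in>set Xs. antisymmetric X)"
proof -
  have c: "Xs ! k \<in> carrier_mat (dim_row (Xs ! k)) (dim_row (Xs ! k))" if "k < length Xs" for k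
    using assms that by (metis nth_mem square_mat_carrier)
  show ?thesis
  proof
    assume D: "antisymmetric (diag_block_mat Xs)"
    show "\<forall>X\<in>set Xs. antisymmetric X"
    proof
      fix X assume "X \<in> set Xs"
      then obtain k where k: "k < length Xs" "X = Xs ! k" by (auto simp: in_set_conv_nth)
      have "Xs ! k $$ (j, i) = - Xs ! k $$ (i, j)" if "i < dim_row (Xs ! k)" "j < dim_row (Xs ! k)"
          for i j
        using D[unfolded antisymmetric_iff[OF diag_block_carrier[OF assms]], rule_format,
            of "block_pos Xs k i" "block_pos Xs k j"]
          block_pos_less[OF k(1) that(1)] block_pos_less[OF k(1) that(2)]
          diag_block_index[OF assms k(1) that(1) k(1) that(2)] diag_block_index[OF assms k(1)
              that(2) k(1) that(1)]
        by simp
      then show "antisymmetric X" using antisymmetric_iff[OF c[OF k(1)]] k(2) by blast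
    qed
  next
    assume A: "\<forall>X\<in>set Xs. antisymmetric X"
    show "antisymmetric (diag_block_mat Xs)"
      unfolding antisymmetric_iff[OF diag_block_carrier[OF assms]]
    proof (intro allI impI)
      fix a b assume ab: "a < sum_list (map dim_row Xs)" "b < sum_list (map dim_row Xs)"
      obtain k i where k: "k < length Xs" "i < dim_row (Xs ! k)" "block_pos Xs k i = a"
        using block_pos_surj[OF ab(1)] .
      obtain l j where l: "l < length Xs" "j < dim_row (Xs ! l)" "block_pos Xs l j = b"
        using block_pos_surj[OF ab(2)] .
      have "Xs ! k $$ (j, i) = - Xs ! k $$ (i, j)" if "k = l"
        using A k l that antisymmetric_iff[OF c[OF k(1)]] by (metis nth_mem)
      then show "diag_block_mat Xs $$ (b, a) = - diag_block_mat Xs $$ (a, b)"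
        using diag_block_index[OF assms k(1,2) l(1,2)] diag_block_index[OF assms l(1,2) k(1,2)]
        unfolding k(3) l(3) by auto
    qed
  qed
qed

lemma skew_block_carrier: "Y \<in> carrier_mat n n \<Longrightarrow> skew_block Y \<in> carrier_mat (n + n) (n + n)"
  by (auto simp: skew_block_def)

lemma skew_block_eq:
  "Y \<in> carrier_mat n n \<Longrightarrow> skew_block Y = four_block_mat (0\<^sub>m n n) Y (- transpose_mat Y) (0\<^sub>m n n)"
  by (simp add: skew_block_def)

lemma skew_block_index:
  assumes "Y \<in> carrier_mat n n" "i < n" "j < n"
  shows "skew_block Y $$ (i, j) = 0" "skew_block Y $$ (i, n + j) = Y $$ (i, j)"
    "skew_block Y $$ (n + j, i) = - Y $$ (i, j)" "skew_block Y $$ (n + i, n + j) = 0"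
  using assms by (auto simp: skew_block_def)

lemma antisymmetric_skew_block:
  assumes Y: "Y \<in> carrier_mat n n"
  shows "antisymmetric (skew_block Y)"
  unfolding antisymmetric_iff[OF skew_block_carrier[OF Y]] using Y by (auto simp: skew_block_def)

lemma uminus_zero_mat [simp]: "- 0\<^sub>m n m = (0\<^sub>m n m :: int mat)"
  by (rule eq_matI) auto

lemma skew_block_congruence:
  assumes "L \<in> carrier_mat n n" "R \<in> carrier_mat n n" "Y \<in> carrier_mat n n"
  shows "four_block_mat L (0\<^sub>m n n) (0\<^sub>m n n) R * skew_block Y *
      transpose_mat (four_block_mat L (0\<^sub>m n n) (0\<^sub>m n n) R) = skew_block (L * Y * transpose_mat R)"
proof -
  have "transpose_mat (L * Y * transpose_mat R) = R * transpose_mat Y * transpose_mat L"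
    using assms by (simp add: transpose_mult[of _ n n _ n] assoc_mult_mat[of _ n n _ n _ n])
  then show ?thesis
    using assms
    by (simp add: skew_block_eq[of _ n] transpose_four_block_mat[of _ n n _ n _ n]
        mult_four_block_mat[of _ n n _ n _ n _ _ n _ n])
qed

text \<open>Exchanging the two halves brings the lower left block, which carries a minus sign, to
  the upper right; the sign of \<open>- R\<close> compensates it.\<close>

lemma skew_block_congruence_antidiag:
  assumes "L \<in> carrier_mat n n" "R \<in> carrier_mat n n" "Y \<in> carrier_mat n n"
  shows "four_block_mat (0\<^sub>m n n) L (- R) (0\<^sub>m n n) * skew_block Y *
      transpose_mat (four_block_mat (0\<^sub>m n n) L (- R) (0\<^sub>m n n)) =
      skew_block (L * transpose_mat Y * transpose_mat R)"
proof -
  have "transpose_mat (L * transpose_mat Y * transpose_mat R) = R * Y * transpose_mat L"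
    using assms by (simp add: transpose_mult[of _ n n _ n] assoc_mult_mat[of _ n n _ n _ n])
  then show ?thesis
    using assms
    by (simp add: skew_block_eq[of _ n] transpose_four_block_mat[of _ n n _ n _ n]
        mult_four_block_mat[of _ n n _ n _ n _ _ n _ n] transpose_uminus)
qed

lemma skew_block_SH_equiv:
  assumes "H_equiv Y Y'"
  shows "SH_equiv (skew_block Y) (skew_block Y')"
  using assms
proof (elim H_equivE)
  fix n L R assume *: "Y \<in> carrier_mat n n" "L \<in> Mon n" "R \<in> Mon n" "Y' = L * Y * transpose_mat R"
  show ?thesis
    using skew_block_congruence[OF *(2,3)[THEN Mon_carrier] *(1)] *(4)
    by (intro SH_equivI[OF skew_block_carrier[OF *(1)] Mon_four_block_diag[OF *(2,3)]]) simp
qed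

lemma skew_block_transpose_SH_equiv:
  assumes Y: "Y \<in> carrier_mat n n"
  shows "SH_equiv (skew_block Y) (skew_block (transpose_mat Y))"
  using skew_block_congruence_antidiag[OF one_carrier_mat one_carrier_mat Y] Y
  by (intro SH_equivI[OF skew_block_carrier[OF Y]
        Mon_four_block_antidiag[OF one_in_Mon uminus_in_Mon[OF one_in_Mon]]]) simp

lemma skew_block_H_equiv:
  assumes Y: "Y \<in> carrier_mat n n"
  shows "H_equiv (skew_block Y) (diag_block_mat [Y, transpose_mat Y])"
proof -
  \<comment> \<open>Negate the lower half of the rows and exchange the two halves of the
    columns.\<close>
  have "diag_block_mat [Y, transpose_mat Y] =
      four_block_mat (1\<^sub>m n) (0\<^sub>m n n) (0\<^sub>m n n) (- 1\<^sub>m n) * skew_block Y *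
      transpose_mat (four_block_mat (0\<^sub>m n n) (1\<^sub>m n) (1\<^sub>m n) (0\<^sub>m n n))"
    using Y
    by (simp add: skew_block_eq[of _ n] transpose_four_block_mat[of _ n n _ n _ n]
        mult_four_block_mat[of _ n n _ n _ n _ _ n _ n] diag_block_mat_two
        del: diag_block_mat.simps)
  then show ?thesis
    by (intro H_equivI[OF skew_block_carrier[OF Y] Mon_four_block_diag[OF one_in_Mon
        uminus_in_Mon[OF one_in_Mon]]
          Mon_four_block_antidiag[OF one_in_Mon one_in_Mon]])
qed

lemma bip_connected_carrier: "bip_connected Y \<Longrightarrow> Y \<in> carrier_mat (dim_row Y) (dim_row Y)"
  unfolding bip_connected_def square_mat_carrier by blast

lemma bip_connected_dim:
  assumes "bip_connected Y"
  shows "0 < dim_row Y"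
proof -
  have "(UNIV :: bool set) \<times> {..<dim_row Y} \<noteq> {}"
    using assms unfolding bip_connected_def connected_on_def by blast
  then show ?thesis by auto
qed

text \<open>Forgetting the side of a vertex merges row \<open>i\<close> with column \<open>i\<close>
  and sends edges to edges.\<close>

lemma bip_connected_imp_index_connected:
  assumes "bip_connected X"
  shows "index_connected X"
proof -
  have "connected_on (index_adj X) (snd ` ((UNIV :: bool set) \<times> {..<dim_row X}))"
    using assms unfolding bip_connected_def
    by (intro connected_on_image[of "bip_adj X"]) (auto simp: index_adj_def split: if_splits)
  moreover have "snd ` ((UNIV :: bool set) \<times> {..<dim_row X}) = {..<dim_row X}" by force
  ultimately show ?thesis using assms by (simp add: index_connected_def bip_connected_def)
qed

text \<open>The index graph of \<open>skew_block Y\<close> is the bipartite graph of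
  \<open>Y\<close>: rows of \<open>Y\<close> sit at positions \<open>i\<close> and columns at
  \<open>n + i\<close>.\<close>

lemma index_connected_skew_block:
  assumes "bip_connected Y"
  shows "index_connected (skew_block Y)"
proof -
  define n where "n = dim_row Y"
  have Y: "Y \<in> carrier_mat n n" unfolding n_def by (rule bip_connected_carrier[OF assms])
  define e where "e = (\<lambda>(b, i). if b then i else n + i)"
  have "connected_on (index_adj (skew_block Y)) (e ` (UNIV \<times> {..<n}))"
  proof (rule connected_on_image[of "bip_adj Y"])
    show "connected_on (bip_adj Y) (UNIV \<times> {..<n})" using assms by (simp add: bip_connected_def n_def)
    show "index_adj (skew_block Y) (e x) (e y)"
      if "x \<in> UNIV \<times> {..<n}" "y \<in> UNIV \<times> {..<n}" "bip_adj Y x y" for x y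
      using that skew_block_index[OF Y] by (auto simp: index_adj_def e_def split: if_splits)
  qed
  moreover have "e ` (UNIV \<times> {..<n}) = {..<n + n}"
  proof -
    have "a \<in> e ` (UNIV \<times> {..<n})" if "a < n + n" for a
    proof (cases "a < n")
      case True
      then have "a = e (True, a)" "(True, a) \<in> UNIV \<times> {..<n}" by (auto simp: e_def)
      then show ?thesis by (rule image_eqI)
    next
      case False
      then have "a = e (False, a - n)" "(False, a - n) \<in> UNIV \<times> {..<n}" using that by (auto simp: e_def)
      then show ?thesis by (rule image_eqI)
    qed
    then show ?thesis by (auto simp: e_def)
  qed
  ultimately show ?thesis using skew_block_carrier[OF Y] by (auto simp: index_connected_def)
qed

text \<open>The bipartite graph of \<open>skew_block Y\<close> falls into two parts: the upper rows
  together with the right columns are closed, and so is the rest. This is the invariant that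
  separates blocks of type I from those of types II and III.\<close>

lemma not_bip_connected_skew_block:
  assumes Y: "Y \<in> carrier_mat n n" and n: "0 < n"
  shows "\<not> bip_connected (skew_block Y)"
proof
  assume "bip_connected (skew_block Y)"
  then have c: "connected_on (bip_adj (skew_block Y)) (UNIV \<times> {..<n + n})"
    using carrier_matD(1)[OF skew_block_carrier[OF Y]] by (simp add: bip_connected_def)
  have "{True} \<times> {..<n} \<union> {False} \<times> {n..<n + n} = UNIV \<times> {..<n + n}"
  proof (rule connected_onD[OF c])
    show "y \<in> {True} \<times> {..<n} \<union> {False} \<times> {n..<n + n}"
      if "x \<in> {True} \<times> {..<n} \<union> {False} \<times> {n..<n + n}" "y \<in> UNIV \<times> {..<n + n}"
        "bip_adj (skew_block Y) x y" for x y
      using that Y by (auto simp: skew_block_def split: if_splits)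
  qed (use n in auto)
  moreover have "(False, 0) \<in> UNIV \<times> {..<n + n}" using n by simp
  ultimately have "(False, 0) \<in> {True} \<times> {..<n} \<union> {False} \<times> {n..<n + n}" by blast
  then show False using n by simp
qed

lemma bip_connected_H_equiv:
  assumes "H_equiv X Y" "bip_connected X"
  shows "bip_connected Y"
proof -
  define n where "n = dim_row X"
  have X: "X \<in> carrier_mat n n" unfolding n_def by (rule bip_connected_carrier[OF assms(2)])
  from assms(1) obtain p s q t where Y: "Y \<in> carrier_mat n n" and p: "signed_perm n p s" and q:
      "signed_perm n q t"
    and eq: "\<And>i j. i < n \<Longrightarrow> j < n \<Longrightarrow> Y $$ (p i, q j) = s i * t j * X $$ (i, j)"
    unfolding H_equiv_iff[OF X] by blast
  define \<pi> where "\<pi> = (\<lambda>(b, i). (b :: bool, if b then p i else q i))"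
  have "connected_on (bip_adj Y) (\<pi> ` (UNIV \<times> {..<n}))"
  proof (rule connected_on_image[of "bip_adj X"])
    show "connected_on (bip_adj X) (UNIV \<times> {..<n})" using assms by (simp add: bip_connected_def n_def)
    show "bip_adj Y (\<pi> x) (\<pi> y)"
      if "x \<in> UNIV \<times> {..<n}" "y \<in> UNIV \<times> {..<n}" "bip_adj X x y" for x y
      using that eq signed_permD(4)[OF p] signed_permD(4)[OF q] by (auto simp: \<pi>_def split: if_splits)
  qed
  moreover have "\<pi> ` (UNIV \<times> {..<n}) = UNIV \<times> {..<n}"
  proof -
    have "(b, a) \<in> \<pi> ` (UNIV \<times> {..<n})" if a: "a < n" for a b
    proof -
      obtain i where i: "i < n" "p i = a" using signed_perm_surj[OF p a] .
      obtain j where j: "j < n" "q j = a" using signed_perm_surj[OF q a] .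
      have "(b, a) = \<pi> (b, if b then i else j)" using i j by (auto simp: \<pi>_def)
      then show ?thesis by (rule image_eqI) (use i j in auto)
    qed
    then show ?thesis using signed_permD(1)[OF p] signed_permD(1)[OF q] by (auto simp: \<pi>_def)
  qed
  ultimately show ?thesis using Y by (auto simp: bip_connected_def)
qed

lemma bip_connected_transpose:
  assumes "bip_connected X"
  shows "bip_connected (transpose_mat X)"
proof -
  define n where "n = dim_row X"
  have X: "X \<in> carrier_mat n n" unfolding n_def by (rule bip_connected_carrier[OF assms])
  have "connected_on (bip_adj (transpose_mat X)) ((\<lambda>(b, i). (\<not> b, i)) ` (UNIV \<times> {..<n}))"
  proof (rule connected_on_image[of "bip_adj X"])
    show "connected_on (bip_adj X) (UNIV \<times> {..<n})" using assms by (simp add: bip_connected_def n_def)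
    show "bip_adj (transpose_mat X) (case x of (b, i) \<Rightarrow> (\<not> b, i)) (case y of (b, i) \<Rightarrow> (\<not> b, i))"
      if "x \<in> UNIV \<times> {..<n}" "y \<in> UNIV \<times> {..<n}" "bip_adj X x y" for x y
      using that X by (auto split: if_splits)
  qed
  moreover have "(\<lambda>(b, i). (\<not> b, i)) ` (UNIV \<times> {..<n}) = UNIV \<times> {..<n}"
  proof -
    have "(b, i) \<in> (\<lambda>(b, i). (\<not> b, i)) ` (UNIV \<times> {..<n})" if "i < n" for b i
      by (rule image_eqI[of _ _ "(\<not> b, i)"]) (use that in auto)
    then show ?thesis by auto
  qed
  ultimately show ?thesis using X by (auto simp: bip_connected_def)
qed

text \<open>Let \<open>S\<close> be the rows and \<open>T\<close> the columns of a proper closed set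
  of the bipartite graph. The case distinction \<open>dich\<close> leaves only complementary
  \<open>S\<close> and \<open>T\<close>, of equal size by balance. Nonzero entries then lie in
  \<open>S \<times> T\<close> or \<open>T \<times> S\<close>, so sorting \<open>S\<close> to the
  front produces \<open>skew_block Y\<close>. A closed set of \<open>Y\<close> lifts to
  \<open>X\<close> and falls under \<open>dich\<close> again, which makes \<open>Y\<close>
  connected.\<close>

lemma antisymmetric_index_connected_cases:
  assumes bal: "balanced k X" and conn: "index_connected X" and anti: "antisymmetric X"
    and nb: "\<not> bip_connected X"
  shows "\<exists>Y. bip_connected Y \<and> SH_equiv X (skew_block Y)"
proof -
  define n where "n = dim_row X"
  have X: "X \<in> carrier_mat n n" and ic: "connected_on (index_adj X) {..<n}"
    using conn unfolding index_connected_def n_def square_mat_carrier by blast+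
  have n: "0 < n" using ic by (auto simp: connected_on_def)
  have neg: "X $$ (j, i) = - X $$ (i, j)" if "i < n" "j < n" for i j
    using anti that antisymmetric_iff[OF X] by blast
  \<comment> \<open>By anti-symmetry \<open>(T, S)\<close> is closed along with \<open>(S, T)\<close>, so \<open>S \<inter> T\<close> and \<open>S \<union> T\<close> are unions of
    components of the index graph.\<close>
  have dich: "S = {} \<and> T = {} \<or> S = {..<n} \<and> T = {..<n} \<or> S \<inter> T = {} \<and> S \<union> T = {..<n}"
    if ST: "S \<subseteq> {..<n}" "T \<subseteq> {..<n}"
      and iff: "\<And>i j. i < n \<Longrightarrow> j < n \<Longrightarrow> X $$ (i, j) \<noteq> 0 \<Longrightarrow> i \<in> S \<longleftrightarrow> j \<in> T" for S T
  proof -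
    have iff2: "(i \<in> S \<longleftrightarrow> j \<in> T) \<and> (j \<in> S \<longleftrightarrow> i \<in> T)" if "i < n" "j < n" "index_adj X i j" for i j
      using that iff[of i j] iff[of j i] neg[of i j] by (auto simp: index_adj_def)
    have "S \<inter> T = {} \<or> S \<inter> T = {..<n}"
      using connected_onD[OF ic, of "S \<inter> T"] ST iff2 by blast
    moreover have "S \<union> T = {} \<or> S \<union> T = {..<n}"
      using connected_onD[OF ic, of "S \<union> T"] ST iff2 by blast
    ultimately show ?thesis using ST by blast
  qed
  have "square_mat X" using conn by (simp add: index_connected_def)
  then have "\<not> connected_on (bip_adj X) (UNIV \<times> {..<n})" using nb by (simp add: bip_connected_def n_def)
  moreover have "(UNIV :: bool set) \<times> {..<n} \<noteq> {}" using n by auto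
  ultimately obtain U where U: "U \<subseteq> UNIV \<times> {..<n}" "U \<noteq> {}" "U \<noteq> UNIV \<times> {..<n}"
    and cl: "\<And>x y. x \<in> U \<Longrightarrow> y \<in> UNIV \<times> {..<n} \<Longrightarrow> bip_adj X x y \<Longrightarrow> y \<in> U"
    unfolding connected_on_def by blast
  define S T where "S = {i. (True, i) \<in> U}" and "T = {j. (False, j) \<in> U}"
  have U_eq: "(b, i) \<in> U \<longleftrightarrow> (if b then i \<in> S else i \<in> T)" for b i by (auto simp: S_def T_def)
  have ST: "S \<subseteq> {..<n}" "T \<subseteq> {..<n}" using U by (auto simp: S_def T_def)
  have iff: "i \<in> S \<longleftrightarrow> j \<in> T" if "i < n" "j < n" "X $$ (i, j) \<noteq> 0" for i j
    using cl[of "(True, i)" "(False, j)"] cl[of "(False, j)" "(True, i)"] that by (auto simp: S_def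
        T_def)
  have "\<not> (S = {} \<and> T = {})"
    using U(2) U_eq by (metis empty_iff ex_in_conv surj_pair)
  moreover have "\<not> (S = {..<n} \<and> T = {..<n})"
  proof
    assume "S = {..<n} \<and> T = {..<n}"
    then have "U = UNIV \<times> {..<n}" using U(1) U_eq by auto
    then show False using U(3) by simp
  qed
  ultimately have disj: "S \<inter> T = {}" and un: "S \<union> T = {..<n}" using dich[OF ST iff] by auto
  have card: "card S = card T" using balanced_closed_card[OF bal, of S T] ST iff by (simp add: n_def)
  define m where "m = card S"
  have "card (S \<union> T) = card S + card T"
    using finite_subset[OF ST(1)] finite_subset[OF ST(2)] disj by (intro card_Un_disjoint) simp_all
  then have nm: "n = m + m" unfolding un m_def card[symmetric] by simp
  have m: "0 < m" using n nm by simp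
  obtain e where e: "bij_betw e {..<n} {..<n}" "e ` {..<m} = S" "e ` {m..<n} = {..<n} - S"
    using obtain_perm_onto[OF ST(1)] unfolding m_def .
  have eS: "e i \<in> S" "e i \<notin> T" "e i < n" if "i < m" for i using that e(2) disj ST by auto
  have eT: "e (m + i) \<in> T" "e (m + i) \<notin> S" "e (m + i) < n" if "i < m" for i
  proof -
    have "e (m + i) \<in> {..<n} - S" unfolding e(3)[symmetric] using that nm by auto
    then show "e (m + i) \<in> T" "e (m + i) \<notin> S" "e (m + i) < n" using un by auto
  qed
  define Y where "Y = mat m m (\<lambda>(i, j). X $$ (e i, e (m + j)))"
  have Y: "Y \<in> carrier_mat m m" by (simp add: Y_def)
  have "mat n n (\<lambda>(i, j). X $$ (e i, e j)) = skew_block Y"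
  proof (rule eq_matI)
    fix a b assume "a < dim_row (skew_block Y)" "b < dim_col (skew_block Y)"
    then have ab: "a < m + m" "b < m + m" using skew_block_carrier[OF Y] by auto
    have split: "c < m \<or> (\<exists>i<m. c = m + i)" if "c < m + m" for c
      using that by (metis add_diff_inverse_nat nat_add_left_cancel_less)
    show "mat n n (\<lambda>(i, j). X $$ (e i, e j)) $$ (a, b) = skew_block Y $$ (a, b)"
      using split[OF ab(1)] split[OF ab(2)]
    proof (elim disjE exE conjE)
      assume "a < m" "b < m"
      then show ?thesis
        using skew_block_index(1)[OF Y, of a b] iff[of "e a" "e b"] eS[of a] eS[of b] nm by auto
    next
      fix j assume "a < m" "j < m" "b = m + j"
      then show ?thesis using skew_block_index(2)[OF Y, of a j] nm by (auto simp: Y_def)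
    next
      fix i assume "i < m" "a = m + i" "b < m"
      then show ?thesis
        using skew_block_index(3)[OF Y, of b i] nm neg[of "e b" "e (m + i)"] eS eT by (auto simp: Y_def)
    next
      fix i j assume "i < m" "a = m + i" "j < m" "b = m + j"
      then show ?thesis
        using skew_block_index(4)[OF Y, of i j] iff[of "e a" "e b"] eT[of i] eT[of j] nm by auto
    qed
  qed (use nm skew_block_carrier[OF Y] in auto)
  then have SH: "SH_equiv X (skew_block Y)"
    using SH_equiv_sym[OF permuted_SH_equiv[OF X e(1)]] by simp
  have inj: "e i = e j \<longleftrightarrow> i = j" if "i < n" "j < n" for i j
    using e(1) that by (auto simp: bij_betw_def inj_on_def)
  have "W = UNIV \<times> {..<m}" if W: "W \<subseteq> UNIV \<times> {..<m}" "W \<noteq> {}"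
    and Wcl: "\<forall>x\<in>W. \<forall>y\<in>UNIV \<times> {..<m}. bip_adj Y x y \<longrightarrow> y \<in> W" for W
  proof -
    \<comment> \<open>A closed set \<open>W\<close> for \<open>Y\<close> is carried back to rows
      \<open>S1\<close> inside \<open>S\<close> and columns \<open>T1\<close> inside
      \<open>T\<close>.\<close>
    define S1 T1 where "S1 = {e i | i. i < m \<and> (True, i) \<in> W}" and "T1 = {e (m + j) | j. j < m \<and>
        (False, j) \<in> W}"
    have S1: "S1 \<subseteq> S" "T1 \<subseteq> T" using eS eT by (auto simp: S1_def T1_def)
    have obtS: "\<exists>i<m. a = e i" if "a \<in> S" for a using that e(2) by auto
    have obtT: "\<exists>j<m. b = e (m + j)" if "b \<in> T" for b
    proof -
      have "b \<in> e ` {m..<n}" unfolding e(3) using that disj ST by auto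
      then obtain c where "c \<in> {m..<n}" "b = e c" by auto
      then show ?thesis using nm by (intro exI[of _ "c - m"]) auto
    qed
    have inj': "i = j" if "e i = e j \<or> e (m + i) = e (m + j)" "i < m" "j < m" for i j
      using inj[of i j] inj[of "m + i" "m + j"] that nm by auto
    have memS: "e i \<in> S1 \<longleftrightarrow> (True, i) \<in> W" if "i < m" for i
      unfolding S1_def using that inj' by blast
    have memT: "e (m + j) \<in> T1 \<longleftrightarrow> (False, j) \<in> W" if "j < m" for j
      unfolding T1_def using that inj' by blast
    have iff1: "a \<in> S1 \<longleftrightarrow> b \<in> T1" if ab: "a < n" "b < n" "X $$ (a, b) \<noteq> 0" for a b
    proof (cases "a \<in> S")
      case True
      then have "b \<in> T" using iff[OF ab] by simp
      obtain i where i: "i < m" "a = e i" using obtS[OF True] by blast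
      obtain j where j: "j < m" "b = e (m + j)" using obtT[OF \<open>b \<in> T\<close>] by blast
      have nz: "Y $$ (i, j) \<noteq> 0" using i j ab by (simp add: Y_def)
      have "(True, i) \<in> W \<longleftrightarrow> (False, j) \<in> W"
      proof
        assume "(True, i) \<in> W"
        then show "(False, j) \<in> W" using Wcl[rule_format, of "(True, i)" "(False, j)"] nz j by simp
      next
        assume "(False, j) \<in> W"
        then show "(True, i) \<in> W" using Wcl[rule_format, of "(False, j)" "(True, i)"] nz i by simp
      qed
      then show ?thesis using memS[OF i(1)] memT[OF j(1)] i j by simp
    next
      case False
      then show ?thesis using iff[OF ab] S1 by auto
    qed
    have "S1 \<noteq> {} \<or> T1 \<noteq> {}"
    proof -
      obtain b i where "(b, i) \<in> W" "i < m" using W by auto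
      then show ?thesis by (cases b) (auto simp: S1_def T1_def)
    qed
    moreover have "\<not> (S1 = {..<n} \<and> T1 = {..<n})"
      using S1 disj n by auto
    \<comment> \<open>Of the three cases of \<open>dich\<close> the empty one is excluded because
      \<open>W\<close> is nonempty and the full one because \<open>S\<close> and \<open>T\<close>
      are disjoint; complementary subsets of \<open>S\<close> and \<open>T\<close> must fill
      them.\<close>
    ultimately have "S1 \<union> T1 = {..<n}" using dich[OF _ _ iff1] S1 ST by blast
    then have "S1 = S" "T1 = T" using S1 disj un by blast+
    then have "(b, i) \<in> W" if "i < m" for b i
      using memS[OF that] memT[OF that] eS(1)[OF that] eT(1)[OF that] by (cases b) auto
    then show ?thesis using W(1) by auto
  qed
  then have "bip_connected Y"
    using m Y unfolding bip_connected_def connected_on_def by auto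
  with SH show ?thesis by blast
qed

text \<open>Components of the index graph inherit anti-symmetry and the common norm, so each one is
  of type I or a skew block up to congruence; reordering collects the two kinds.\<close>

lemma antisymmetric_decomposition:
  assumes bal: "balanced k B" and anti: "antisymmetric B"
  obtains Xs Ys where "SH_equiv B (diag_block_mat (Xs @ map skew_block Ys))"
    "\<forall>X\<in>set Xs. bip_connected X \<and> antisymmetric X" "\<forall>Y\<in>set Ys. bip_connected Y"
proof -
  have "square_mat B" using bal by (simp add: balanced_def)
  then obtain Zs where Zs: "SH_equiv B (diag_block_mat Zs)" "\<forall>Z\<in>set Zs. index_connected Z"
    using index_connected_decomposition by blast
  have sq: "\<forall>Z\<in>set Zs. square_mat Z" using Zs by (auto simp: index_connected_def)
  have balD: "balanced k (diag_block_mat Zs)" using balanced_H_equiv[OF bal SH_imp_H_equiv[OF Zs(1)]] .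
  have antiD: "antisymmetric (diag_block_mat Zs)" using antisymmetric_SH_equiv[OF Zs(1) anti] .
  have Z: "balanced k Z" "antisymmetric Z" if "Z \<in> set Zs" for Z
    using balanced_diag_block[OF sq balD that] antiD that by (auto simp: antisymmetric_diag_block[OF
        sq])
  have "\<forall>Z\<in>set Zs. \<exists>Y. \<not> bip_connected Z \<longrightarrow> bip_connected Y \<and> SH_equiv Z (skew_block Y)"
    using antisymmetric_index_connected_cases[OF Z(1) _ Z(2)] Zs(2) by blast
  then obtain f where f: "\<And>Z. Z \<in> set Zs \<Longrightarrow> \<not> bip_connected Z \<Longrightarrow> bip_connected (f Z) \<and> SH_equiv Z
      (skew_block (f Z))"
    by metis
  define g where "g Z = (if bip_connected Z then Z else skew_block (f Z))" for Z
  define Xs where "Xs = filter bip_connected Zs"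
  define Ys where "Ys = map f (filter (\<lambda>Z. \<not> bip_connected Z) Zs)"
  have "SH_equiv (diag_block_mat (map (\<lambda>Z. Z) Zs)) (diag_block_mat (map g Zs))"
  proof (rule diag_block_map_SH_equiv)
    fix Z assume Z: "Z \<in> set Zs"
    then have "SH_equiv Z Z" using sq by (metis SH_equiv_refl square_mat_carrier)
    then show "SH_equiv Z (g Z)" using f[OF Z] by (simp add: g_def)
  qed
  then have 1: "SH_equiv (diag_block_mat Zs) (diag_block_mat (map g Zs))" by simp
  have ms: "mset (map g Zs) = mset (Xs @ map skew_block Ys)"
    unfolding Xs_def Ys_def by (induction Zs) (auto simp: g_def)
  have "\<forall>X\<in>set (map g Zs). square_mat X"
  proof
    fix X assume "X \<in> set (map g Zs)"
    then obtain Z where Z: "Z \<in> set Zs" "X = g Z" by auto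
    show "square_mat X"
    proof (cases "bip_connected Z")
      case False
      then show ?thesis
        using Z f[OF Z(1)] index_connected_skew_block[of "f Z"] by (simp add: g_def index_connected_def)
    qed (use Z sq in \<open>simp add: g_def\<close>)
  qed
  from diag_block_mset_SH_equiv[OF ms this] 1 Zs(1)
  have "SH_equiv B (diag_block_mat (Xs @ map skew_block Ys))" by (metis SH_equiv_trans)
  moreover have "\<forall>X\<in>set Xs. bip_connected X \<and> antisymmetric X" "\<forall>Y\<in>set Ys. bip_connected Y"
    using Z f by (auto simp: Xs_def Ys_def)
  ultimately show ?thesis using that by blast
qed

section \<open>Classification\<close>

lemma mset_eq_of_bij:
  assumes "bij_betw \<sigma> {..<length xs} {..<length ys}"
    and "\<And>k. k < length xs \<Longrightarrow> f (xs ! k) = ys ! \<sigma> k"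
  shows "mset (map f xs) = mset ys"
proof -
  have nth: "mset zs = image_mset ((!) zs) (mset_set {..<length zs})" for zs :: "'c list"
    by (metis map_nth mset_map mset_upt lessThan_atLeast0)
  have "mset_set {..<length ys} = image_mset \<sigma> (mset_set {..<length xs})"
    using image_mset_mset_set[of \<sigma> "{..<length xs}"] assms(1) by (simp add: bij_betw_def)
  then have "mset ys = image_mset (\<lambda>k. ys ! \<sigma> k) (mset_set {..<length xs})"
    by (simp add: nth[of ys] multiset.map_comp comp_def)
  also have "\<dots> = image_mset (\<lambda>k. f (xs ! k)) (mset_set {..<length xs})"
    using assms(2) by (intro image_mset_cong) auto
  also have "\<dots> = mset (map f xs)" by (simp add: nth[of xs] multiset.map_comp comp_def)
  finally show ?thesis by simp
qed

lemma count_image_mset_inj_on: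
  assumes "inj_on f A" "set_mset M \<subseteq> A" "x \<in> A"
  shows "count (image_mset f M) (f x) = count M x"
  using assms(2) by (induction M) (use assms(1,3) in \<open>auto simp: inj_on_def\<close>)

lemma mset_concat_replicate:
  assumes "distinct L" "set_mset M \<subseteq> set L"
  shows "mset (concat (map (\<lambda>X. replicate (count M X) X) L)) = M"
proof -
  have "count (mset (concat (map (\<lambda>X. replicate (c X) X) L))) z = (if z \<in> set L then c z else 0)"
    if "distinct L" for c :: "'a \<Rightarrow> nat" and z and L
    using that by (induction L) auto
  from this[OF assms(1)] show ?thesis
    using assms(2) by (intro multiset_eqI) (auto simp: count_eq_zero_iff)
qed

lemma mset_repeat_blocks:
  assumes "length rs = length Xs"
  shows "mset (repeat_blocks Xs rs) = (\<Sum>i<length Xs. replicate_mset (rs ! i) (Xs ! i))"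
  using assms
  by (induction rs Xs rule: list_induct2)
    (simp_all add: repeat_blocks_def sum.lessThan_Suc_shift del: sum.lessThan_Suc)

lemma map_repeat_blocks: "map f (repeat_blocks Xs rs) = repeat_blocks (map f Xs) rs"
  by (simp add: repeat_blocks_def map_concat zip_map1 comp_def case_prod_unfold)

lemma set_repeat_blocks: "set (repeat_blocks Xs rs) \<subseteq> set Xs"
  by (auto simp: repeat_blocks_def dest: set_zip_leftD)

lemma count_repeat_blocks:
  assumes "length rs = length Xs" "distinct Xs" "i < length Xs"
  shows "count (mset (repeat_blocks Xs rs)) (Xs ! i) = rs ! i"
proof -
  have "count (mset (repeat_blocks Xs rs)) (Xs ! i) = (\<Sum>j<length Xs. if j = i then rs ! i else 0)"
    unfolding mset_repeat_blocks[OF assms(1)] count_sum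
    using assms(2,3) by (intro sum.cong) (auto simp: nth_eq_iff_index_eq)
  also have "\<dots> = rs ! i" using assms(3) by simp
  finally show ?thesis .
qed

lemma count_repeat_blocks_0:
  "x \<notin> set Xs \<Longrightarrow> count (mset (repeat_blocks Xs rs)) x = 0"
  using set_repeat_blocks[of Xs rs] by (auto simp: count_eq_zero_iff)

lemma mset_concat_pair_blocks:
  assumes "length rs = length Xs"
  shows "mset (concat (repeat_blocks (map (\<lambda>X. [X, f X]) Xs) rs)) =
    mset (repeat_blocks Xs rs) + mset (repeat_blocks (map f Xs) rs)"
proof -
  have rep: "mset (concat (replicate r [x, y])) = replicate_mset r x + replicate_mset r y" for r and
      x y :: 'a
    by (induction r) auto
  show ?thesis
    using assms by (induction rs Xs rule: list_induct2) (simp_all add: repeat_blocks_def rep)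
qed

lemma mset_type1_blocks:
  assumes "length Ls = length \<Lambda>"
    and "\<And>i. i < length Ls \<Longrightarrow> distinct (Ls ! i) \<and> set_mset (\<Lambda> ! i) \<subseteq> set (Ls ! i)"
  shows "mset (type1_blocks Ls (as, bs, \<Lambda>)) = (\<Sum>i<length Ls. \<Lambda> ! i)"
  using assms
proof (induction Ls \<Lambda> rule: list_induct2)
  case (Cons L Ls M \<Lambda>)
  have "mset (type1_blocks Ls (as, bs, \<Lambda>)) = (\<Sum>i<length Ls. \<Lambda> ! i)"
    using Cons.prems[of "Suc i" for i] by (intro Cons.IH) auto
  moreover have "mset (concat (map (\<lambda>X. replicate (count M X) X) L)) = M"
    using Cons.prems[of 0] by (intro mset_concat_replicate) auto
  ultimately show ?case
    by (simp add: sum.lessThan_Suc_shift del: sum.lessThan_Suc)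
qed simp

lemma diag_block_concat: "diag_block_mat (map diag_block_mat Lss) = diag_block_mat (concat Lss)"
  by (induction Lss) (simp_all add: diag_block_mat_append Let_def)

lemma finite_multisets_bounded:
  assumes "finite F"
  shows "finite {M. set_mset M \<subseteq> F \<and> size M \<le> K}"
proof (rule finite_subset)
  show "{M. set_mset M \<subseteq> F \<and> size M \<le> K} \<subseteq> mset ` {xs. set xs \<subseteq> F \<and> length xs \<le> K}"
  proof
    fix M assume "M \<in> {M. set_mset M \<subseteq> F \<and> size M \<le> K}"
    moreover obtain xs where "M = mset xs" by (metis ex_mset)
    ultimately show "M \<in> mset ` {xs. set xs \<subseteq> F \<and> length xs \<le> K}" by auto
  qed
  show "finite (mset ` {xs. set xs \<subseteq> F \<and> length xs \<le> K})"
    using finite_lists_length_le[OF assms] by simp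
qed

text \<open>Splitting every skew block makes the uniqueness theorem for H-equivalence applicable,
  which asks for blocks with connected bipartite graph.\<close>

lemma skew_blocks_H_equiv:
  assumes "\<And>X. X \<in> set Xs \<Longrightarrow> square_mat X" "\<And>Y. Y \<in> set Ys \<Longrightarrow> square_mat Y"
  shows "H_equiv (diag_block_mat (Xs @ map skew_block Ys)) (diag_block_mat (Xs @ Ys @ map
      transpose_mat Ys))"
proof -
  \<comment> \<open>The tags tell plain blocks from blocks to be split, so that a single map over
    one list treats both kinds, even if the same matrix occurs in \<open>Xs\<close> and in
    \<open>Ys\<close>.\<close>
  let ?L = "map Inl Xs @ map Inr Ys"
  let ?f = "\<lambda>z. case z of Inl X \<Rightarrow> X | Inr Y \<Rightarrow> skew_block Y"
  let ?g = "\<lambda>z. case z of Inl X \<Rightarrow> [X] | Inr Y \<Rightarrow> [Y, transpose_mat Y]"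
  have sq: "X \<in> carrier_mat (dim_row X) (dim_row X)" if "X \<in> set Xs \<union> set Ys" for X
    using assms that unfolding square_mat_carrier by blast
  have "H_equiv (?f z) (diag_block_mat (?g z))" if "z \<in> set ?L" for z
  proof (cases z)
    case (Inl X)
    then have "X \<in> set Xs" using that by auto
    then show ?thesis using Inl H_equiv_refl[OF sq[of X]] by (simp del: diag_block_mat.simps)
  next
    case (Inr Y)
    then have "Y \<in> set Ys" using that by auto
    then show ?thesis using Inr skew_block_H_equiv[OF sq[of Y]] by (simp del: diag_block_mat.simps)
  qed
  then have "H_equiv (diag_block_mat (map ?f ?L)) (diag_block_mat (map (\<lambda>z. diag_block_mat (?g z)) ?L))"
    by (rule diag_block_map_H_equiv)
  also have "map (\<lambda>z. diag_block_mat (?g z)) ?L = map diag_block_mat (map ?g ?L)" by simp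
  also have "map ?f ?L = Xs @ map skew_block Ys" by (simp add: comp_def)
  finally have 1: "H_equiv (diag_block_mat (Xs @ map skew_block Ys)) (diag_block_mat (concat (map ?g
      ?L)))"
    unfolding diag_block_concat .
  have ms: "mset (concat (map ?g ?L)) = mset (Xs @ Ys @ map transpose_mat Ys)"
  proof -
    have "mset (concat (map (\<lambda>Y. [Y, transpose_mat Y]) Ys)) = mset Ys + mset (map transpose_mat Ys)"
      by (induction Ys) auto
    then show ?thesis by (simp add: comp_def)
  qed
  have "\<forall>X\<in>set (concat (map ?g ?L)). square_mat X"
    using assms by (auto simp: comp_def)
  from SH_imp_H_equiv[OF diag_block_mset_SH_equiv[OF ms this]] 1 show ?thesis
    by (rule H_equiv_trans[rotated])
qed

lemma classification_listD:
  assumes "classification_list R S I f"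
  shows "i \<in> I \<Longrightarrow> f i \<in> S" "x \<in> S \<Longrightarrow> \<exists>i\<in>I. R x (f i)"
    "x \<in> S \<Longrightarrow> i \<in> I \<Longrightarrow> j \<in> I \<Longrightarrow> R x (f i) \<Longrightarrow> R x (f j) \<Longrightarrow> i = j"
  using assms unfolding classification_list_def by blast+

text \<open>The matrix \<open>A\<close> itself is not fixed here; it enters the final comparison
  only through its weighing property and its H-class.\<close>

locale antisym_decomposition =
  fixes As Bs Cs :: "int mat list" and ms ns os :: "nat list" and Ls :: "int mat list list"
  assumes length_ms: "length ms = length As" and length_ns: "length ns = length Bs"
    and length_os: "length os = length Cs" and length_Ls: "length Ls = length As"
    and prim: "\<forall>X\<in>set (block_types As Bs Cs). primitive X"
    and As_anti: "\<forall>X\<in>set As. antisymmetric X"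
    and Bs_class: "\<forall>X\<in>set Bs. symmetric_class X \<and> (\<forall>Y\<in>H_class X. \<not> antisymmetric Y)"
    and Cs_class: "\<forall>X\<in>set Cs. \<not> symmetric_class X"
    and nonequiv: "\<forall>i<length (block_types As Bs Cs). \<forall>j<length (block_types As Bs Cs). i \<noteq> j \<longrightarrow>
           \<not> H_equiv (block_types As Bs Cs ! i) (block_types As Bs Cs ! j)"
    and Ls_class: "\<forall>i<length As. classification_list SH_equiv (antisym_members (As ! i))
           {..<length (Ls ! i)} (\<lambda>j. Ls ! i ! j)"
begin

section \<open>Types, their duals and the choices\<close>

abbreviation "CTs \<equiv> map transpose_mat Cs"

abbreviation "types \<equiv> set As \<union> set Bs \<union> set Cs \<union> set CTs"

lemma set_types: "set (block_types As Bs Cs) = types"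
  by (auto simp: block_types_def)

lemma types_bip: "P \<in> types \<Longrightarrow> bip_connected P"
  using prim primitive_imp_bip_connected unfolding set_types by blast

lemma types_carrier: "P \<in> types \<Longrightarrow> P \<in> carrier_mat (dim_row P) (dim_row P)"
  using types_bip bip_connected_carrier by blast

text \<open>Types are pairwise inequivalent, so each can stand for its H-class, and multiplicities
  of classes become counts in multisets of types.\<close>

lemma types_rigid:
  assumes "P \<in> types" "Q \<in> types" "H_equiv P Q"
  shows "P = Q"
  using assms nonequiv unfolding set_types[symmetric] by (metis in_set_conv_nth)

lemma distinct_types: "distinct (block_types As Bs Cs)"
  unfolding distinct_conv_nth
proof (intro allI impI)
  fix i j assume ij: "i < length (block_types As Bs Cs)" "j < length (block_types As Bs Cs)" "i \<noteq> j"
  have "H_equiv (block_types As Bs Cs ! i) (block_types As Bs Cs ! i)"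
    using H_equiv_refl types_carrier ij unfolding set_types[symmetric] by (metis nth_mem)
  then show "block_types As Bs Cs ! i \<noteq> block_types As Bs Cs ! j" using nonequiv ij by metis
qed

lemma distinct_parts:
  "distinct As" "distinct Bs" "distinct Cs" "distinct CTs"
  "set As \<inter> set Bs = {}" "set As \<inter> set Cs = {}" "set As \<inter> set CTs = {}"
  "set Bs \<inter> set Cs = {}" "set Bs \<inter> set CTs = {}" "set Cs \<inter> set CTs = {}"
  using distinct_types unfolding block_types_def distinct_append set_append by blast+

lemma self_transpose:
  assumes "P \<in> set As \<union> set Bs"
  shows "H_equiv P (transpose_mat P)"
proof (cases "P \<in> set As")
  case True
  then show ?thesis using As_anti types_carrier antisymmetric_imp_symmetric_class by blast
next
  case False
  then show ?thesis using Bs_class assms by (simp add: symmetric_class_def H_class_def)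
qed

lemma not_self_transpose:
  assumes "P \<in> set Cs \<union> set CTs"
  shows "\<not> H_equiv P (transpose_mat P)"
proof -
  have "\<not> H_equiv C (transpose_mat C)" if "C \<in> set Cs" for C
    using Cs_class that by (simp add: symmetric_class_def H_class_def)
  then show ?thesis using assms H_equiv_sym by fastforce
qed

text \<open>Unspecified unless \<open>Q\<close> is H-equivalent to some type, which is then
  unique.\<close>

definition type_of :: "int mat \<Rightarrow> int mat" where
  "type_of Q = (SOME P. P \<in> types \<and> H_equiv Q P)"

lemma type_of_eqI:
  assumes "P \<in> types" "H_equiv Q P"
  shows "type_of Q = P"
proof -
  have "type_of Q \<in> types \<and> H_equiv Q (type_of Q)"
    unfolding type_of_def by (rule someI[of _ P]) (use assms in auto)
  then show ?thesis using types_rigid[of "type_of Q" P] assms H_equiv_sym H_equiv_trans by blast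
qed

lemma type_of_self: "P \<in> types \<Longrightarrow> type_of P = P"
  by (rule type_of_eqI) (use types_carrier H_equiv_refl in blast)+

text \<open>Transposition of H-classes, expressed by their representatives: the transpose of a type
  in \<open>As\<close> or \<open>Bs\<close> is H-equivalent to that type but in general a different
  matrix.\<close>

definition dual :: "int mat \<Rightarrow> int mat" where
  "dual P = (if P \<in> set Cs \<union> set CTs then transpose_mat P else P)"

lemma dual_types: "P \<in> types \<Longrightarrow> dual P \<in> types"
  by (auto simp: dual_def)

lemma dual_dual: "P \<in> types \<Longrightarrow> dual (dual P) = P"
  by (auto simp: dual_def)

lemma inj_dual: "inj_on dual types"
  by (rule inj_on_inverseI[of _ dual]) (rule dual_dual)

lemma dual_H_equiv:
  assumes "P \<in> types"
  shows "H_equiv (transpose_mat P) (dual P)"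
proof (cases "P \<in> set Cs \<union> set CTs")
  case True
  then show ?thesis
    using H_equiv_refl[OF types_carrier[of "dual P"]] dual_types[OF assms] by (simp add: dual_def)
next
  case False
  then have "P \<in> set As \<union> set Bs" using assms by auto
  then show ?thesis using False H_equiv_sym[OF self_transpose] by (simp add: dual_def)
qed

lemma type_of_transpose:
  assumes "P \<in> types" "H_equiv Q P"
  shows "type_of (transpose_mat Q) = dual P"
  using assms dual_types dual_H_equiv H_equiv_transpose H_equiv_trans by (intro type_of_eqI) blast+

text \<open>\<open>A\<^sub>C\<close> and \<open>A\<^sub>C\<close> of the transpose are SH-equivalent, so for type III blocks only the class of
  \<open>C\<close> up to transposition matters.\<close>

definition fold_type :: "int mat \<Rightarrow> int mat" where
  "fold_type P = (if P \<in> set CTs then transpose_mat P else P)"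

lemma fold_type_in: "P \<in> types \<Longrightarrow> fold_type P \<in> set As \<union> set Bs \<union> set Cs"
  by (auto simp: fold_type_def)

lemma skew_block_fold_type:
  assumes "P \<in> types"
  shows "SH_equiv (skew_block P) (skew_block (fold_type P))"
  using SH_equiv_refl[OF skew_block_carrier[OF types_carrier[OF assms]]]
    skew_block_transpose_SH_equiv[OF types_carrier[OF assms]] by (simp add: fold_type_def)

text \<open>Only \<open>C\<close> and its transpose fold to \<open>C\<close>. They are different
  matrices, being inequivalent types, so their counts add.\<close>

lemma count_fold_type:
  assumes "set_mset M \<subseteq> types"
  shows "P \<in> set As \<union> set Bs \<Longrightarrow> count (image_mset fold_type M) P = count M P"
    "P \<in> set Cs \<Longrightarrow> count (image_mset fold_type M) P = count M P + count M (transpose_mat P)"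
proof -
  have 1: "fold_type Q = P \<longleftrightarrow> Q = P" if "Q \<in> types" "P \<in> set As \<union> set Bs" for P Q
    using that distinct_parts by (auto simp: fold_type_def)
  have 2: "P \<noteq> transpose_mat P" if "P \<in> set Cs" for P
    using that distinct_parts(10) by (metis IntI empty_iff image_eqI set_map)
  have 3: "fold_type Q = P \<longleftrightarrow> Q = P \<or> Q = transpose_mat P" if "Q \<in> types" "P \<in> set Cs" for P Q
    using that distinct_parts by (auto simp: fold_type_def)
  show "count (image_mset fold_type M) P = count M P" if "P \<in> set As \<union> set Bs"
    using assms by (induction M) (use 1[OF _ that] in auto)
  show "count (image_mset fold_type M) P = count M P + count M (transpose_mat P)" if "P \<in> set Cs"
    using assms by (induction M) (use 2[OF that] 3[OF _ that] in auto)
qed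

lemma Ls_mem:
  assumes "i < length As" "Z \<in> set (Ls ! i)"
  shows "H_equiv (As ! i) Z" "antisymmetric Z"
proof -
  obtain j where "j < length (Ls ! i)" "Z = Ls ! i ! j" using assms(2) by (auto simp: in_set_conv_nth)
  then have "Z \<in> antisym_members (As ! i)"
    using classification_listD(1)[OF Ls_class[rule_format, OF assms(1)]] by auto
  then show "H_equiv (As ! i) Z" "antisymmetric Z" by (auto simp: antisym_members_def H_class_def)
qed

lemma Ls_type_of: "i < length As \<Longrightarrow> Z \<in> set (Ls ! i) \<Longrightarrow> type_of Z = As ! i"
  using Ls_mem H_equiv_sym by (intro type_of_eqI) auto

lemma Ls_disjoint:
  assumes "i < length As" "j < length As" "Z \<in> set (Ls ! i)" "Z \<in> set (Ls ! j)"
  shows "i = j"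
  using assms Ls_type_of distinct_parts(1) by (metis nth_eq_iff_index_eq)

lemma Ls_bip: "i < length As \<Longrightarrow> Z \<in> set (Ls ! i) \<Longrightarrow> bip_connected Z"
  using Ls_mem(1) bip_connected_H_equiv types_bip by (metis UnCI nth_mem)

text \<open>SH-equivalent entries belong to H-equivalent members of \<open>As\<close>, hence to the
  same list, and there uniqueness of the index leaves only equality.\<close>

lemma Ls_rigid:
  assumes "i < length As" "j < length As" "Z \<in> set (Ls ! i)" "Z' \<in> set (Ls ! j)" "SH_equiv Z Z'"
  shows "i = j \<and> Z = Z'"
proof -
  have "H_equiv (As ! i) (As ! j)"
    using Ls_mem(1)[OF assms(1,3)] Ls_mem(1)[OF assms(2,4)] SH_imp_H_equiv[OF assms(5)]
    by (meson H_equiv_sym H_equiv_trans)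
  then have "As ! i = As ! j" using types_rigid[of "As ! i" "As ! j"] assms(1,2) by auto
  then have ij: "i = j" using distinct_parts(1) assms(1,2) by (simp add: nth_eq_iff_index_eq)
  obtain a where a: "a < length (Ls ! i)" "Z = Ls ! i ! a" using assms(3) by (auto simp:
      in_set_conv_nth)
  obtain b where b: "b < length (Ls ! i)" "Z' = Ls ! i ! b" using assms(4) ij by (auto simp:
      in_set_conv_nth)
  have "Z \<in> antisym_members (As ! i)" using Ls_mem[OF assms(1,3)] by (simp add: antisym_members_def
      H_class_def)
  moreover have "SH_equiv Z Z" using assms(5) SH_equiv_sym SH_equiv_trans by blast
  ultimately have "a = b"
    using classification_listD(3)[OF Ls_class[rule_format, OF assms(1)], of Z a b] a b assms(5) by simp
  then show ?thesis using ij a b by simp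
qed

text \<open>A repeated entry would be equivalent to itself at two indices. Distinctness matters for
  \<open>type1_blocks\<close>, which writes \<open>count M X\<close> copies for every occurrence of
  \<open>X\<close> in the list.\<close>

lemma Ls_distinct:
  assumes "i < length As"
  shows "distinct (Ls ! i)"
  unfolding distinct_conv_nth
proof (intro allI impI notI)
  fix a b assume ab: "a < length (Ls ! i)" "b < length (Ls ! i)" "a \<noteq> b" "Ls ! i ! a = Ls ! i ! b"
  have mem: "Ls ! i ! a \<in> antisym_members (As ! i)"
    using classification_listD(1)[OF Ls_class[rule_format, OF assms]] ab by simp
  have "H_equiv (As ! i) (Ls ! i ! a)" using Ls_mem(1)[OF assms] ab by simp
  then have "SH_equiv (Ls ! i ! a) (Ls ! i ! a)" using SH_equiv_refl H_equiv_dim(2) by blast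
  then show False
    using classification_listD(3)[OF Ls_class[rule_format, OF assms] mem, of a b] ab by simp
qed

lemma obtain_Ls_representative:
  assumes "i < length As" "H_equiv X (As ! i)" "antisymmetric X"
  shows "\<exists>Z\<in>set (Ls ! i). SH_equiv X Z"
proof -
  have "X \<in> antisym_members (As ! i)"
    using assms H_equiv_sym by (simp add: antisym_members_def H_class_def)
  then show ?thesis using classification_listD(2)[OF Ls_class[rule_format, OF assms(1)]] by fastforce
qed

lemma choicesD:
  assumes "(as, bs, \<Lambda>) \<in> choices ms Ls"
  shows "length as = length As" "length bs = length As" "length \<Lambda> = length As"
    "\<And>i. i < length As \<Longrightarrow> as ! i + 2 * bs ! i = ms ! i"
    "\<And>i. i < length As \<Longrightarrow> size (\<Lambda> ! i) = as ! i"
    "\<And>i. i < length As \<Longrightarrow> set_mset (\<Lambda> ! i) \<subseteq> set (Ls ! i)"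
  using assms length_ms by (auto simp: choices_def)

lemma choices_type1:
  assumes "(as, bs, \<Lambda>) \<in> choices ms Ls"
  shows "mset (type1_blocks Ls (as, bs, \<Lambda>)) = (\<Sum>i<length As. \<Lambda> ! i)"
  using mset_type1_blocks[of Ls \<Lambda>] choicesD[OF assms] Ls_distinct length_Ls by simp

lemma choices_type1_mem:
  assumes "c \<in> choices ms Ls" "Z \<in> set (type1_blocks Ls c)"
  obtains i where "i < length As" "Z \<in> set (Ls ! i)"
proof -
  obtain as bs \<Lambda> where c: "c = (as, bs, \<Lambda>)" by (cases c)
  have "Z \<in># (\<Sum>i<length As. \<Lambda> ! i)" using assms choices_type1[of as bs \<Lambda>] c by (metis set_mset_mset)
  then obtain i where "i < length As" "Z \<in># \<Lambda> ! i" by (auto simp: set_mset_sum)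
  then show ?thesis using that choicesD(6) assms(1) c by blast
qed

text \<open>The lists for different \<open>i\<close> are disjoint, so \<open>\<Lambda> ! i\<close>
  can be recovered from the multiset of type I blocks alone.\<close>

lemma choices_filter:
  assumes "(as, bs, \<Lambda>) \<in> choices ms Ls" "i < length As"
  shows "filter_mset (\<lambda>Z. Z \<in> set (Ls ! i)) (mset (type1_blocks Ls (as, bs, \<Lambda>))) = \<Lambda> ! i"
proof (rule multiset_eqI)
  fix z
  have "count (\<Lambda> ! j) z = 0" if "z \<in> set (Ls ! i)" "j < length As" "j \<noteq> i" for j
    using that Ls_disjoint[OF assms(2), of j z] choicesD(6)[OF assms(1), of j] by (auto simp:
        count_eq_zero_iff)
  then have "(\<Sum>j<length As. count (\<Lambda> ! j) z) = count (\<Lambda> ! i) z" if "z \<in> set (Ls ! i)"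
    using that assms(2) sum.remove[of "{..<length As}" i "\<lambda>j. count (\<Lambda> ! j) z"] by simp
  moreover have "count (\<Lambda> ! i) z = 0" if "z \<notin> set (Ls ! i)"
    using that choicesD(6)[OF assms] by (auto simp: count_eq_zero_iff)
  ultimately show "count (filter_mset (\<lambda>Z. Z \<in> set (Ls ! i)) (mset (type1_blocks Ls (as, bs, \<Lambda>)))) z
      = count (\<Lambda> ! i) z"
    by (simp add: choices_type1[OF assms(1)] count_sum del: type1_blocks.simps)
qed

lemma finite_choices: "finite (choices ms Ls)"
proof (rule finite_subset)
  \<comment> \<open>All \<open>a_i\<close>, all \<open>b_i\<close> and the sizes of all multisets
    are bounded by the sum of the \<open>m_i\<close>.\<close>
  let ?K = "sum_list ms" and ?F = "\<Union>L\<in>set Ls. set L"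
  let ?N = "{xs. set xs \<subseteq> {..?K} \<and> length xs = length ms}"
  let ?M = "{\<Lambda>. set \<Lambda> \<subseteq> {M. set_mset M \<subseteq> ?F \<and> size M \<le> ?K} \<and> length \<Lambda> = length ms}"
  show "choices ms Ls \<subseteq> ?N \<times> ?N \<times> ?M"
  proof
    fix c assume c: "c \<in> choices ms Ls"
    obtain as bs \<Lambda> where eq: "c = (as, bs, \<Lambda>)" by (cases c)
    note D = choicesD[OF c[unfolded eq]]
    have le: "as ! i \<le> ?K \<and> bs ! i \<le> ?K" if "i < length As" for i
      using D(4)[OF that] elem_le_sum_list[of i ms] that length_ms by linarith
    have "set as \<subseteq> {..?K}" "set bs \<subseteq> {..?K}" using le D(1,2) by (auto simp: in_set_conv_nth)
    moreover have "set \<Lambda> \<subseteq> {M. set_mset M \<subseteq> ?F \<and> size M \<le> ?K}"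
    proof
      fix M assume "M \<in> set \<Lambda>"
      then obtain i where i: "i < length As" "M = \<Lambda> ! i" using D(3) by (auto simp: in_set_conv_nth)
      then have "set_mset M \<subseteq> set (Ls ! i)" "Ls ! i \<in> set Ls" using D(6) length_Ls by auto
      then show "M \<in> {M. set_mset M \<subseteq> ?F \<and> size M \<le> ?K}" using D(5)[OF i(1)] le[OF i(1)] i by auto
    qed
    ultimately show "c \<in> ?N \<times> ?N \<times> ?M" using D(1-3) length_ms eq by auto
  qed
  have "finite ?F" by auto
  then show "finite (?N \<times> ?N \<times> ?M)"
    by (intro finite_cartesian_product finite_lists_length_eq finite_multisets_bounded) auto
qed

section \<open>Inequivalence of different choices\<close>

definition blocks :: "choice \<Rightarrow> int mat list" where
  "blocks c = type1_blocks Ls c @ map skew_block (type2_blocks As Bs ns c @ type3_blocks Cs os)"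

lemma Sigma_mat_blocks: "Sigma_mat As Bs ns Cs os Ls c = diag_block_mat (blocks c)"
  by (simp add: Sigma_mat_def blocks_def)

lemma type2_mem: "Y \<in> set (type2_blocks As Bs ns c) \<Longrightarrow> Y \<in> set As \<union> set Bs"
  using set_repeat_blocks by (cases c) fastforce

lemma type3_mem: "Z \<in> set (type3_blocks Cs os) \<Longrightarrow> Z \<in> set Cs"
  using set_repeat_blocks[of Cs os] by (auto simp: type3_blocks_def)

lemma type23_mem:
  "Y \<in> set (type2_blocks As Bs ns c @ type3_blocks Cs os) \<Longrightarrow> Y \<in> set As \<union> set Bs \<union> set Cs"
  unfolding set_append using type2_mem type3_mem by blast

lemma blocks_connected:
  assumes "c \<in> choices ms Ls"
  shows "\<forall>X\<in>set (blocks c). index_connected X"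
proof
  fix X assume "X \<in> set (blocks c)"
  then consider "X \<in> set (type1_blocks Ls c)"
    | Y where "Y \<in> set (type2_blocks As Bs ns c @ type3_blocks Cs os)" "X = skew_block Y"
    by (auto simp: blocks_def)
  then show "index_connected X"
  proof cases
    case 1
    then show ?thesis
      using choices_type1_mem[OF assms] Ls_bip bip_connected_imp_index_connected by metis
  next
    case 2
    then show ?thesis using type23_mem types_bip index_connected_skew_block by blast
  qed
qed

lemma skew_block_rigid:
  assumes "P \<in> set As \<union> set Bs \<union> set Cs" "Q \<in> set As \<union> set Bs \<union> set Cs"
    and "SH_equiv (skew_block P) (skew_block Q)"
  shows "P = Q"
proof -
  have P: "P \<in> types" and Q: "Q \<in> types" using assms by auto
  have "H_equiv (diag_block_mat [P, transpose_mat P]) (diag_block_mat [Q, transpose_mat Q])"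
    using skew_block_H_equiv[OF types_carrier[OF P]] skew_block_H_equiv[OF types_carrier[OF Q]]
      SH_imp_H_equiv[OF assms(3)] by (meson H_equiv_sym H_equiv_trans)
  moreover have "\<forall>X\<in>set [P, transpose_mat P]. bip_connected X" "\<forall>X\<in>set [Q, transpose_mat Q].
      bip_connected X"
    using types_bip[OF P] types_bip[OF Q] bip_connected_transpose by auto
  ultimately obtain \<sigma> where \<sigma>: "bij_betw \<sigma> {..<length [P, transpose_mat P]} {..<length [Q,
      transpose_mat Q]}"
    "\<And>k. k < length [P, transpose_mat P] \<Longrightarrow> H_equiv ([P, transpose_mat P] ! k) ([Q, transpose_mat Q]
        ! \<sigma> k)"
    using diag_block_H_equiv_blocks by blast
  have "\<sigma> 0 < 2" using bij_betwE[OF \<sigma>(1), rule_format, of 0] by simp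
  then have "\<sigma> 0 = 0 \<or> \<sigma> 0 = 1" by linarith
  then have "H_equiv P Q \<or> H_equiv P (transpose_mat Q)" using \<sigma>(2)[of 0] by auto
  then have "H_equiv P Q \<or> H_equiv P (dual Q)" using dual_H_equiv[OF Q] H_equiv_trans by blast
  then have "P = Q \<or> P = dual Q" using types_rigid P Q dual_types by blast
  moreover have "P = Q" if "P = dual Q"
  proof (cases "Q \<in> set Cs")
    case True
    then have "P \<in> set CTs" using that by (auto simp: dual_def)
    then show ?thesis using assms(1) distinct_parts by blast
  next
    case False
    then have "Q \<notin> set CTs" using assms(2) distinct_parts by blast
    then show ?thesis using that False by (simp add: dual_def)
  qed
  ultimately show ?thesis by blast
qed

lemma not_SH_equiv_type1_skew:
  assumes "c \<in> choices ms Ls" "X \<in> set (type1_blocks Ls c)" "P \<in> types"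
  shows "\<not> SH_equiv X (skew_block P)" "\<not> SH_equiv (skew_block P) X"
proof -
  have "bip_connected X" using choices_type1_mem[OF assms(1,2)] Ls_bip by metis
  moreover have "\<not> bip_connected (skew_block P)"
    using not_bip_connected_skew_block[OF types_carrier bip_connected_dim] types_bip assms(3) by blast
  ultimately show "\<not> SH_equiv X (skew_block P)" using bip_connected_H_equiv SH_imp_H_equiv by blast
  then show "\<not> SH_equiv (skew_block P) X" using SH_equiv_sym by blast
qed

text \<open>The two choices may differ: the blocks of all matrices of the list together are pairwise
  inequivalent, so equivalent sums have equal multisets of blocks.\<close>

lemma blocks_rigid:
  assumes "c \<in> choices ms Ls" "c' \<in> choices ms Ls" "X \<in> set (blocks c)" "X' \<in> set (blocks c')"
      "SH_equiv X X'"
  shows "X = X'"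
proof -
  have cas: "X \<in> set (type1_blocks Ls c) \<or> (\<exists>P\<in>set As \<union> set Bs \<union> set Cs. X = skew_block P)"
    if "X \<in> set (blocks c)" for X c
    using that type23_mem[of _ c] by (auto simp: blocks_def)
  from cas[OF assms(3)] cas[OF assms(4)] show ?thesis
  proof (elim disjE bexE)
    assume "X \<in> set (type1_blocks Ls c)" "X' \<in> set (type1_blocks Ls c')"
    then show ?thesis using Ls_rigid assms choices_type1_mem by metis
  next
    fix P assume "X \<in> set (type1_blocks Ls c)" "P \<in> set As \<union> set Bs \<union> set Cs" "X' = skew_block P"
    then show ?thesis using not_SH_equiv_type1_skew[OF assms(1), of X P] assms(5) by auto
  next
    fix P assume "X' \<in> set (type1_blocks Ls c')" "P \<in> set As \<union> set Bs \<union> set Cs" "X = skew_block P"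
    then show ?thesis using not_SH_equiv_type1_skew[OF assms(2), of X' P] assms(5) by auto
  next
    fix P Q assume "P \<in> set As \<union> set Bs \<union> set Cs" "X = skew_block P" "Q \<in> set As \<union> set Bs \<union> set Cs"
        "X' = skew_block Q"
    then show ?thesis using skew_block_rigid assms(5) by auto
  qed
qed

lemma filter_blocks:
  assumes "c \<in> choices ms Ls"
  shows "filter_mset bip_connected (mset (blocks c)) = mset (type1_blocks Ls c)"
proof -
  have "filter bip_connected (type1_blocks Ls c) = type1_blocks Ls c"
    using choices_type1_mem[OF assms] Ls_bip by (intro filter_True ballI) metis
  moreover have "filter bip_connected (map skew_block (type2_blocks As Bs ns c @ type3_blocks Cs
      os)) = []"
  proof (rule filter_False, rule ballI)
    fix X assume "X \<in> set (map skew_block (type2_blocks As Bs ns c @ type3_blocks Cs os))"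
    then obtain Y where Y: "Y \<in> set (type2_blocks As Bs ns c @ type3_blocks Cs os)" "X = skew_block
        Y" by auto
    then have "Y \<in> types" using type23_mem by blast
    then show "\<not> bip_connected X"
      using not_bip_connected_skew_block[OF types_carrier bip_connected_dim] types_bip Y(2) by blast
  qed
  ultimately have "filter bip_connected (blocks c) = type1_blocks Ls c"
    unfolding blocks_def filter_append by simp
  then show ?thesis by (metis mset_filter)
qed

text \<open>Rigidity turns the matching of blocks into an equality of multisets. Its type I part
  determines every \<open>\<Lambda> ! i\<close>, the sizes of these give the \<open>a_i\<close>, and
  \<open>a_i + 2 * b_i = m_i\<close> gives the \<open>b_i\<close>.\<close>

lemma Sigma_mat_unique:
  assumes c: "c \<in> choices ms Ls" "c' \<in> choices ms Ls"
    and "SH_equiv (Sigma_mat As Bs ns Cs os Ls c) (Sigma_mat As Bs ns Cs os Ls c')"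
  shows "c = c'"
proof -
  obtain \<sigma> where \<sigma>: "bij_betw \<sigma> {..<length (blocks c)} {..<length (blocks c')}"
    "\<And>k. k < length (blocks c) \<Longrightarrow> SH_equiv (blocks c ! k) (blocks c' ! \<sigma> k)"
    using diag_block_SH_equiv_blocks[OF blocks_connected[OF c(1)] blocks_connected[OF c(2)]]
      assms(3) unfolding Sigma_mat_blocks by blast
  have "id (blocks c ! k) = blocks c' ! \<sigma> k" if k: "k < length (blocks c)" for k
  proof -
    have "\<sigma> k < length (blocks c')" using \<sigma>(1) k by (auto simp: bij_betw_def)
    then show ?thesis using blocks_rigid[OF c _ _ \<sigma>(2)[OF k]] k by simp
  qed
  then have "mset (map id (blocks c)) = mset (blocks c')" by (rule mset_eq_of_bij[OF \<sigma>(1)])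
  then have m: "mset (type1_blocks Ls c) = mset (type1_blocks Ls c')"
    using filter_blocks[OF c(1)] filter_blocks[OF c(2)] by simp
  obtain as bs \<Lambda> where eq: "c = (as, bs, \<Lambda>)" by (cases c)
  obtain as' bs' \<Lambda>' where eq': "c' = (as', bs', \<Lambda>')" by (cases c')
  note D = choicesD[OF c(1)[unfolded eq]] and D' = choicesD[OF c(2)[unfolded eq']]
  have \<Lambda>: "\<Lambda> ! i = \<Lambda>' ! i" if "i < length As" for i
    using choices_filter[OF c(1)[unfolded eq] that] choices_filter[OF c(2)[unfolded eq'] that] m
    unfolding eq eq' by metis
  then have as: "as ! i = as' ! i" if "i < length As" for i using D(5) D'(5) that by metis
  have bs: "bs ! i = bs' ! i" if "i < length As" for i using D(4)[OF that] D'(4)[OF that] as[OF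
      that] by linarith
  show ?thesis using \<Lambda> as bs D(1-3) D'(1-3) by (auto simp: eq eq' intro!: nth_equalityI)
qed

section \<open>The H-class of the representatives and their completeness\<close>

abbreviation "decomp \<equiv> decomposition_blocks As ms Bs ns Cs os"

lemma mset_decomp: "mset decomp =
    mset (repeat_blocks As ms) + mset (repeat_blocks Bs (map (\<lambda>n. 2 * n) ns)) +
    mset (repeat_blocks Cs os) + mset (repeat_blocks CTs os)"
  using mset_concat_pair_blocks[OF length_os, of transpose_mat] by (simp add:
      decomposition_blocks_def add.assoc)

lemma set_decomp: "set decomp \<subseteq> types"
proof -
  have "set_mset (mset decomp) \<subseteq> types"
    unfolding mset_decomp using set_repeat_blocks[of As ms] set_repeat_blocks[of Bs "map (\<lambda>n. 2 * n)
        ns"]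
      set_repeat_blocks[of Cs os] set_repeat_blocks[of CTs os] by auto
  then show ?thesis by simp
qed

text \<open>After splitting the skew blocks every block can be replaced by its type, and it remains
  to compare two multisets of types.\<close>

lemma Sigma_mat_H_equiv:
  assumes c: "c \<in> choices ms Ls"
  shows "H_equiv (Sigma_mat As Bs ns Cs os Ls c) (diag_block_mat decomp)"
proof -
  obtain as bs \<Lambda> where eq: "c = (as, bs, \<Lambda>)" by (cases c)
  note D = choicesD[OF c[unfolded eq]]
  let ?Y = "type2_blocks As Bs ns c @ type3_blocks Cs os"
  let ?L = "type1_blocks Ls c @ ?Y @ map transpose_mat ?Y"
  have sqT1: "square_mat X" if "X \<in> set (type1_blocks Ls c)" for X
    using choices_type1_mem[OF c that] Ls_bip by (metis bip_connected_def)
  have sqY: "square_mat X" if "X \<in> set ?Y" for X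
    using type23_mem[OF that] types_bip[of X] unfolding bip_connected_def by blast
  have 1: "H_equiv (Sigma_mat As Bs ns Cs os Ls c) (diag_block_mat (map (\<lambda>X. X) ?L))"
    unfolding Sigma_mat_blocks blocks_def map_ident
    by (rule skew_blocks_H_equiv[OF sqT1 sqY])
  have eqv: "H_equiv X (type_of X)" if X: "X \<in> set ?L" for X
  proof -
    have "\<exists>P\<in>types. H_equiv X P"
    proof -
      consider "X \<in> set (type1_blocks Ls c)" | "X \<in> set ?Y" | Y where "Y \<in> set ?Y" "X = transpose_mat Y"
        using X by auto
      then show ?thesis
      proof cases
        case 1
        then obtain i where "i < length As" "X \<in> set (Ls ! i)" using choices_type1_mem[OF c] by blast
        then show ?thesis using Ls_mem(1) H_equiv_sym by (intro bexI[of _ "As ! i"]) auto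
      next
        case 2
        then have X: "X \<in> types" using type23_mem by blast
        then show ?thesis using H_equiv_refl[OF types_carrier[OF X]] by blast
      next
        case 3
        then have Y: "Y \<in> types" using type23_mem by blast
        then show ?thesis using dual_H_equiv[OF Y] dual_types[OF Y] 3(2) by blast
      qed
    qed
    then show ?thesis using type_of_eqI by metis
  qed
  have 2: "H_equiv (diag_block_mat (map (\<lambda>X. X) ?L)) (diag_block_mat (map type_of ?L))"
    by (rule diag_block_map_H_equiv[OF eqv])
  have t1: "mset (map type_of (type1_blocks Ls c)) = (\<Sum>i<length As. replicate_mset (as ! i) (As ! i))"
  proof -
    have "image_mset type_of (\<Lambda> ! i) = replicate_mset (as ! i) (As ! i)" if i: "i < length As" for i
    proof -
      have "image_mset type_of (\<Lambda> ! i) = image_mset (\<lambda>_. As ! i) (\<Lambda> ! i)"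
        using D(6)[OF i] Ls_type_of[OF i] by (intro image_mset_cong) auto
      then show ?thesis using D(5)[OF i] by (simp add: image_mset_const_eq)
    qed
    moreover have "image_mset type_of (\<Sum>i<m. \<Lambda> ! i) = (\<Sum>i<m. image_mset type_of (\<Lambda> ! i))" for m
      by (induction m) simp_all
    ultimately show ?thesis
      using choices_type1[OF c[unfolded eq]] unfolding eq by (simp del: type1_blocks.simps)
  qed
  have tY: "map type_of ?Y = ?Y"
    using type_of_self type23_mem by (intro map_idI) blast
  have tYt: "map type_of (map transpose_mat ?Y) = map dual ?Y"
  proof -
    have "type_of (transpose_mat Y) = dual Y" if "Y \<in> set ?Y" for Y
      using type_of_transpose[of Y Y] type23_mem[OF that] H_equiv_refl[OF types_carrier[of Y]] by auto
    then show ?thesis by (simp add: comp_def)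
  qed
  have dY: "map dual ?Y = repeat_blocks As bs @ repeat_blocks Bs ns @ repeat_blocks CTs os"
  proof -
    have "map dual As = As" using distinct_parts by (intro map_idI) (auto simp: dual_def)
    moreover have "map dual Bs = Bs" using distinct_parts by (intro map_idI) (auto simp: dual_def)
    moreover have "map dual Cs = CTs" by (simp add: dual_def)
    ultimately show ?thesis
      unfolding eq type2_blocks.simps type3_blocks_def map_append map_repeat_blocks
      by (simp only: append_assoc)
  qed
  \<comment> \<open>The \<open>b_i\<close> skew blocks over \<open>A_i\<close> contribute
    \<open>A_i\<close> once directly and, as \<open>dual\<close> fixes it, once more through the
    transpose: in total \<open>a_i + 2 * b_i = m_i\<close> copies.\<close>
  have A: "(\<Sum>i<length As. replicate_mset (as ! i) (As ! i)) + mset (repeat_blocks As bs) + mset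
      (repeat_blocks As bs) =
      mset (repeat_blocks As ms)"
  proof -
    have "(\<Sum>i<length As. replicate_mset (as ! i) (As ! i)) + mset (repeat_blocks As bs) + mset
        (repeat_blocks As bs) =
      (\<Sum>i<length As. replicate_mset (as ! i) (As ! i) + replicate_mset (bs ! i) (As ! i) +
          replicate_mset (bs ! i) (As ! i))"
      unfolding mset_repeat_blocks[OF D(2)] by (simp add: sum.distrib)
    also have "\<dots> = (\<Sum>i<length As. replicate_mset (ms ! i) (As ! i))"
      using D(4) by (intro sum.cong) (auto simp flip: D(4) simp: mult_2 multiset_eq_iff)
    finally show ?thesis unfolding mset_repeat_blocks[OF length_ms] .
  qed
  have B: "mset (repeat_blocks Bs ns) + mset (repeat_blocks Bs ns) = mset (repeat_blocks Bs (map
      (\<lambda>n. 2 * n) ns))"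
  proof -
    have "mset (repeat_blocks Bs ns) + mset (repeat_blocks Bs ns) =
        (\<Sum>i<length Bs. replicate_mset (ns ! i) (Bs ! i) + replicate_mset (ns ! i) (Bs ! i))"
      unfolding mset_repeat_blocks[OF length_ns] by (simp add: sum.distrib)
    also have "\<dots> = (\<Sum>i<length Bs. replicate_mset (map (\<lambda>n. 2 * n) ns ! i) (Bs ! i))"
      using length_ns by (intro sum.cong) (auto simp: mult_2 multiset_eq_iff)
    also have "\<dots> = mset (repeat_blocks Bs (map (\<lambda>n. 2 * n) ns))"
      using length_ns by (subst mset_repeat_blocks) auto
    finally show ?thesis .
  qed
  have "mset (map type_of ?L) = mset decomp"
  proof -
    have "mset (map type_of ?L) = mset (map type_of (type1_blocks Ls c)) + mset ?Y + mset (map dual ?Y)"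
      unfolding map_append[of type_of "type1_blocks Ls c"] map_append[of type_of ?Y] tY tYt by simp
    also have "\<dots> = (\<Sum>i<length As. replicate_mset (as ! i) (As ! i)) +
        (mset (repeat_blocks As bs) + mset (repeat_blocks Bs ns) + mset (repeat_blocks Cs os)) +
        (mset (repeat_blocks As bs) + mset (repeat_blocks Bs ns) + mset (repeat_blocks CTs os))"
      unfolding t1 dY by (simp add: eq type3_blocks_def)
    also have "\<dots> = mset decomp"
      unfolding mset_decomp A[symmetric] B[symmetric] by (simp add: ac_simps)
    finally show ?thesis .
  qed
  moreover have "\<forall>X\<in>set (map type_of ?L). square_mat X"
  proof
    fix X assume "X \<in> set (map type_of ?L)"
    then obtain Q where "Q \<in> set ?L" "X = type_of Q" by auto
    then show "square_mat X" using eqv[of Q] H_equiv_dim unfolding square_mat_carrier by metis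
  qed
  ultimately have "H_equiv (diag_block_mat (map type_of ?L)) (diag_block_mat decomp)"
    using SH_imp_H_equiv diag_block_mset_SH_equiv by blast
  with 1 2 show ?thesis by (meson H_equiv_trans)
qed

lemma Sigma_mat_antisymmetric:
  assumes c: "c \<in> choices ms Ls"
  shows "antisymmetric (Sigma_mat As Bs ns Cs os Ls c)"
proof -
  have "\<forall>X\<in>set (blocks c). square_mat X"
    using blocks_connected[OF c] by (auto simp: index_connected_def)
  moreover have "antisymmetric X" if X: "X \<in> set (blocks c)" for X
  proof -
    consider "X \<in> set (type1_blocks Ls c)"
      | Y where "Y \<in> set (type2_blocks As Bs ns c @ type3_blocks Cs os)" "X = skew_block Y"
      using X by (auto simp: blocks_def)
    then show ?thesis
    proof cases
      case 1
      then show ?thesis using choices_type1_mem[OF c] Ls_mem(2) by metis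
    next
      case 2
      then show ?thesis using type23_mem types_carrier antisymmetric_skew_block by blast
    qed
  qed
  ultimately show ?thesis unfolding Sigma_mat_blocks using antisymmetric_diag_block by blast
qed

text \<open>The types found in \<open>B\<close> are counted against the given decomposition. A
  component of type I contributes its type, a skew block a type and its dual. The resulting
  equations hand over \<open>a_i\<close> and \<open>b_i\<close> with
  \<open>a_i + 2 * b_i = m_i\<close> and force the multiplicities over \<open>Bs\<close> and
  \<open>Cs\<close>.\<close>

lemma Sigma_mat_exists:
  assumes bal: "balanced k B" and anti: "antisymmetric B" and eqB: "H_equiv B (diag_block_mat decomp)"
  shows "\<exists>c\<in>choices ms Ls. SH_equiv B (Sigma_mat As Bs ns Cs os Ls c)"
proof -
  obtain Xs Ys where B: "SH_equiv B (diag_block_mat (Xs @ map skew_block Ys))"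
    and Xs: "\<forall>X\<in>set Xs. bip_connected X \<and> antisymmetric X" and Ys: "\<forall>Y\<in>set Ys. bip_connected Y"
    using antisymmetric_decomposition[OF bal anti] .
  let ?L = "Xs @ Ys @ map transpose_mat Ys"
  have "H_equiv (diag_block_mat (Xs @ map skew_block Ys)) (diag_block_mat ?L)"
    using Xs Ys by (intro skew_blocks_H_equiv) (auto simp: bip_connected_def)
  then have "H_equiv (diag_block_mat ?L) (diag_block_mat decomp)"
    using SH_imp_H_equiv[OF B] eqB by (meson H_equiv_sym H_equiv_trans)
  moreover have "\<forall>X\<in>set ?L. bip_connected X" using Xs Ys bip_connected_transpose by auto
  moreover have "\<forall>X\<in>set decomp. bip_connected X" using set_decomp types_bip by blast
  ultimately obtain \<sigma> where \<sigma>: "bij_betw \<sigma> {..<length ?L} {..<length decomp}"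
    "\<And>k. k < length ?L \<Longrightarrow> H_equiv (?L ! k) (decomp ! \<sigma> k)"
    using diag_block_H_equiv_blocks by metis
  have \<sigma>_mem: "decomp ! \<sigma> k \<in> types" if "k < length ?L" for k
  proof -
    have "\<sigma> k < length decomp" using \<sigma>(1) that by (auto simp: bij_betw_def)
    then show ?thesis using set_decomp nth_mem by blast
  qed
  have to: "type_of Q \<in> types" "H_equiv Q (type_of Q)" if Q: "Q \<in> set ?L" for Q
  proof -
    obtain k where k: "k < length ?L" "Q = ?L ! k" using Q by (metis in_set_conv_nth)
    have "type_of Q = decomp ! \<sigma> k" using type_of_eqI[OF \<sigma>_mem[OF k(1)]] \<sigma>(2)[OF k(1)] k(2) by simp
    then show "type_of Q \<in> types" "H_equiv Q (type_of Q)" using \<sigma>_mem[OF k(1)] \<sigma>(2)[OF k(1)] k(2) by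
        auto
  qed
  have "mset (map type_of ?L) = mset decomp"
    using type_of_eqI[OF \<sigma>_mem \<sigma>(2)] by (intro mset_eq_of_bij[OF \<sigma>(1)])
  define MX MY where "MX = mset (map type_of Xs)" and "MY = mset (map type_of Ys)"
  have tr: "map type_of (map transpose_mat Ys) = map dual (map type_of Ys)"
    using type_of_transpose[OF to] by simp
  have M: "mset decomp = MX + MY + image_mset dual MY"
    unfolding \<open>mset (map type_of ?L) = mset decomp\<close>[symmetric] MX_def MY_def map_append mset_append tr
    by (simp add: add.assoc multiset.map_comp)
  have MY: "set_mset MY \<subseteq> types" using to by (auto simp: MY_def)
  \<comment> \<open>An anti-symmetric block is H-equivalent to its transpose, which excludes
    \<open>Cs\<close> and the transposes, and no class of \<open>Bs\<close> has an anti-symmetric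
    member.\<close>
  have XA: "type_of X \<in> set As" if X: "X \<in> set Xs" for X
  proof -
    have XP: "H_equiv X (type_of X)" and P: "type_of X \<in> types" using to[of X] X by auto
    have XX: "H_equiv X (transpose_mat X)"
      using Xs X bip_connected_carrier antisymmetric_imp_symmetric_class by blast
    have "H_equiv (type_of X) (transpose_mat (type_of X))"
      using XP XX H_equiv_transpose[OF XP] by (meson H_equiv_sym H_equiv_trans)
    then have "type_of X \<notin> set Cs \<union> set CTs" using not_self_transpose by blast
    moreover have "type_of X \<notin> set Bs"
      using Bs_class H_equiv_sym[OF XP] Xs X by (auto simp: H_class_def)
    ultimately show ?thesis using P by auto
  qed
  have MX: "set_mset MX \<subseteq> set As" using XA by (auto simp: MX_def)
  have dualMY: "count (image_mset dual MY) (dual P) = count MY P" if "P \<in> types" for P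
    by (rule count_image_mset_inj_on[OF inj_dual MY that])
  have dualAB: "dual P = P" if "P \<in> set As \<union> set Bs" for P
    using that distinct_parts by (auto simp: dual_def)
  have cnt: "count (mset decomp) P = count MX P + count MY P + count (image_mset dual MY) P" for P
    unfolding M by simp
  have cA: "ms ! i = count MX (As ! i) + 2 * count MY (As ! i)" if i: "i < length As" for i
  proof -
    have P: "As ! i \<in> set As" using i by simp
    have "count (mset decomp) (As ! i) = ms ! i"
      using count_repeat_blocks[OF length_ms distinct_parts(1) i] P distinct_parts
      unfolding mset_decomp by (simp add: disjoint_iff count_repeat_blocks_0 del: set_map)
    then show ?thesis using cnt[of "As ! i"] dualMY[of "As ! i"] dualAB[of "As ! i"] P by simp
  qed
  have cB: "ns ! i = count MY (Bs ! i)" if i: "i < length Bs" for i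
  proof -
    have P: "Bs ! i \<in> set Bs" using i by simp
    then have 0: "Bs ! i \<notin> set As" "Bs ! i \<notin> set Cs" "Bs ! i \<notin> set CTs" using distinct_parts by blast+
    have "count (mset (repeat_blocks Bs (map (\<lambda>n. 2 * n) ns))) (Bs ! i) = 2 * ns ! i"
      using count_repeat_blocks[of "map (\<lambda>n. 2 * n) ns" Bs i] distinct_parts(2) i length_ns by simp
    then have "count (mset decomp) (Bs ! i) = 2 * ns ! i"
      using 0 unfolding mset_decomp by (simp add: count_repeat_blocks_0 del: set_map)
    moreover have "count MX (Bs ! i) = 0" using MX 0 by (auto simp: count_eq_zero_iff)
    ultimately show ?thesis using cnt[of "Bs ! i"] dualMY[of "Bs ! i"] dualAB[of "Bs ! i"] P by simp
  qed
  \<comment> \<open>A skew block over \<open>C\<close> or over its transpose contributes exactly one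
    copy of \<open>C\<close>, in the second case as the dual.\<close>
  have cC: "os ! i = count MY (Cs ! i) + count MY (transpose_mat (Cs ! i))" if i: "i < length Cs" for i
  proof -
    have P: "Cs ! i \<in> set Cs" using i by simp
    then have 0: "Cs ! i \<notin> set As" "Cs ! i \<notin> set Bs" "Cs ! i \<notin> set CTs" using distinct_parts by blast+
    have Pt: "transpose_mat (Cs ! i) \<in> set CTs" using P by auto
    have "count (mset decomp) (Cs ! i) = os ! i"
      using 0 count_repeat_blocks[OF length_os distinct_parts(3) i]
      unfolding mset_decomp by (simp add: count_repeat_blocks_0 del: set_map)
    moreover have "count MX (Cs ! i) = 0" using MX 0 by (auto simp: count_eq_zero_iff)
    moreover have "dual (transpose_mat (Cs ! i)) = Cs ! i" using Pt by (simp add: dual_def)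
    ultimately show ?thesis using cnt[of "Cs ! i"] dualMY[of "transpose_mat (Cs ! i)"] Pt by auto
  qed
  \<comment> \<open>The choice is read off \<open>B\<close>: \<open>a_i\<close> counts the type I
    components and \<open>b_i\<close> the skew blocks that belong to \<open>A_i\<close>.\<close>
  define as where "as = map (\<lambda>i. count MX (As ! i)) [0..<length As]"
  define bs where "bs = map (\<lambda>i. count MY (As ! i)) [0..<length As]"
  have "\<forall>X\<in>set Xs. \<exists>Z. \<exists>i<length As. type_of X = As ! i \<and> Z \<in> set (Ls ! i) \<and> SH_equiv X Z"
  proof
    fix X assume X: "X \<in> set Xs"
    obtain i where i: "i < length As" "type_of X = As ! i" using XA[OF X] by (metis in_set_conv_nth)
    then show "\<exists>Z. \<exists>i<length As. type_of X = As ! i \<and> Z \<in> set (Ls ! i) \<and> SH_equiv X Z"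
      using obtain_Ls_representative[OF i(1), of X] to(2)[of X] X Xs by auto
  qed
  then obtain rep where rep: "\<And>X. X \<in> set Xs \<Longrightarrow>
      \<exists>i<length As. type_of X = As ! i \<and> rep X \<in> set (Ls ! i) \<and> SH_equiv X (rep X)" by metis
  define N where "N = mset (map rep Xs)"
  define \<Lambda> where "\<Lambda> = map (\<lambda>i. filter_mset (\<lambda>Z. Z \<in> set (Ls ! i)) N) [0..<length As]"
  have rep_iff: "rep X \<in> set (Ls ! i) \<longleftrightarrow> type_of X = As ! i" if X: "X \<in> set Xs" and i: "i < length
      As" for X i
  proof -
    obtain j where j: "j < length As" "type_of X = As ! j" "rep X \<in> set (Ls ! j)" using rep[OF X] by
        blast
    show ?thesis
      using j Ls_disjoint[OF i j(1)] distinct_parts(1) i by (auto simp: nth_eq_iff_index_eq)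
  qed
  have size: "size (\<Lambda> ! i) = as ! i" if i: "i < length As" for i
  proof -
    have "size (filter_mset (\<lambda>Z. Z \<in> set (Ls ! i)) (mset (map rep Us))) = count (mset (map type_of
        Us)) (As ! i)"
      if "set Us \<subseteq> set Xs" for Us
      using that rep_iff[OF _ i] by (induction Us) auto
    then show ?thesis using i by (simp add: \<Lambda>_def as_def N_def MX_def)
  qed
  let ?c = "(as, bs, \<Lambda>)"
  have c: "?c \<in> choices ms Ls"
    using cA size by (auto simp: choices_def length_ms as_def bs_def \<Lambda>_def)
  have t1: "mset (type1_blocks Ls ?c) = N"
  proof (rule multiset_eqI)
    fix z
    have *: "count (mset (type1_blocks Ls ?c)) z = (\<Sum>i<length As. if z \<in> set (Ls ! i) then count N z
        else 0)"
      unfolding choices_type1[OF c] count_sum by (rule sum.cong) (auto simp: \<Lambda>_def)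
    show "count (mset (type1_blocks Ls ?c)) z = count N z"
    proof (cases "z \<in># N")
      case True
      then obtain j where j: "j < length As" "z \<in> set (Ls ! j)" using rep by (auto simp: N_def)
      have "(\<Sum>i<length As. if z \<in> set (Ls ! i) then count N z else 0) = (\<Sum>i<length As. if i = j then
          count N z else 0)"
        using j Ls_disjoint by (intro sum.cong) auto
      then show ?thesis using * j by simp
    next
      case False
      then have "count N z = 0" by (simp add: count_eq_zero_iff)
      then show ?thesis using * by (simp del: type1_blocks.simps)
    qed
  qed
  \<comment> \<open>Both \<open>C\<close> and its transpose may occur among the types of
    \<open>Ys\<close>; only after folding do the multiplicities agree with
    \<open>os\<close>.\<close>
  have t2: "mset (map fold_type (map type_of Ys)) = mset (type2_blocks As Bs ns ?c @ type3_blocks Cs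
      os)"
  proof (rule multiset_eqI)
    fix P
    have lb: "length bs = length As" by (simp add: bs_def)
    have R: "count (mset (type2_blocks As Bs ns ?c @ type3_blocks Cs os)) P = count (mset
        (repeat_blocks As bs)) P +
        count (mset (repeat_blocks Bs ns)) P + count (mset (repeat_blocks Cs os)) P"
      by (simp add: type3_blocks_def)
    have L: "mset (map fold_type (map type_of Ys)) = image_mset fold_type MY"
      by (simp add: MY_def multiset.map_comp)
    consider "P \<in> set As" | "P \<in> set Bs" | "P \<in> set Cs" | "P \<notin> set As \<union> set Bs \<union> set Cs" by auto
    then show "count (mset (map fold_type (map type_of Ys))) P =
        count (mset (type2_blocks As Bs ns ?c @ type3_blocks Cs os)) P"
    proof cases
      case 1
      then obtain i where i: "i < length As" "P = As ! i" by (metis in_set_conv_nth)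
      have "P \<notin> set Bs" "P \<notin> set Cs" using 1 distinct_parts by blast+
      then show ?thesis
        unfolding L R using count_fold_type(1)[OF MY, of P] 1 count_repeat_blocks[OF lb
            distinct_parts(1) i(1)] i
        by (simp add: count_repeat_blocks_0 bs_def)
    next
      case 2
      then obtain i where i: "i < length Bs" "P = Bs ! i" by (metis in_set_conv_nth)
      have "P \<notin> set As" "P \<notin> set Cs" using 2 distinct_parts by blast+
      then show ?thesis
        unfolding L R using count_fold_type(1)[OF MY, of P] 2 count_repeat_blocks[OF length_ns
            distinct_parts(2) i(1)] i cB[OF i(1)]
        by (simp add: count_repeat_blocks_0)
    next
      case 3
      then obtain i where i: "i < length Cs" "P = Cs ! i" by (metis in_set_conv_nth)
      have "P \<notin> set As" "P \<notin> set Bs" using 3 distinct_parts by blast+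
      then show ?thesis
        unfolding L R using count_fold_type(2)[OF MY, of P] 3 count_repeat_blocks[OF length_os
            distinct_parts(3) i(1)] i cC[OF i(1)]
        by (simp add: count_repeat_blocks_0)
    next
      case 4
      then have "P \<notin># image_mset fold_type MY" using fold_type_in MY unfolding set_image_mset by blast
      then show ?thesis unfolding L R using 4 by (simp add: count_repeat_blocks_0 count_eq_zero_iff)
    qed
  qed
  define L2 where "L2 = map rep Xs @ map skew_block (map fold_type (map type_of Ys))"
  have "SH_equiv (diag_block_mat (Xs @ map skew_block Ys)) (diag_block_mat L2)"
  proof -
    \<comment> \<open>Tags again let one map act on both kinds of blocks: a type I block goes to its
      list representative, a skew block to the one over its folded type.\<close>
    let ?S = "map Inl Xs @ map Inr Ys"
    let ?f = "\<lambda>z. case z of Inl X \<Rightarrow> X | Inr Y \<Rightarrow> skew_block Y"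
    let ?g = "\<lambda>z. case z of Inl X \<Rightarrow> rep X | Inr Y \<Rightarrow> skew_block (fold_type (type_of Y))"
    have "SH_equiv (?f z) (?g z)" if z: "z \<in> set ?S" for z
    proof (cases z)
      case (Inl X)
      then show ?thesis using z rep[of X] by auto
    next
      case (Inr Y)
      then have "Y \<in> set Ys" using z by auto
      then have "H_equiv Y (type_of Y)" "type_of Y \<in> types" using to[of Y] by auto
      then have "SH_equiv (skew_block Y) (skew_block (fold_type (type_of Y)))"
        using skew_block_SH_equiv skew_block_fold_type SH_equiv_trans by blast
      then show ?thesis using Inr by simp
    qed
    then have "SH_equiv (diag_block_mat (map ?f ?S)) (diag_block_mat (map ?g ?S))"
      by (rule diag_block_map_SH_equiv)
    then show ?thesis by (simp add: comp_def L2_def)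
  qed
  moreover have "SH_equiv (diag_block_mat L2) (Sigma_mat As Bs ns Cs os Ls ?c)"
    unfolding Sigma_mat_blocks
  proof (rule SH_equiv_sym, rule diag_block_mset_SH_equiv)
    show "mset (blocks ?c) = mset L2"
      unfolding blocks_def L2_def mset_append t1 mset_map[of skew_block] t2 by (simp add: N_def)
    show "\<forall>X\<in>set (blocks ?c). square_mat X"
      using blocks_connected[OF c] by (auto simp: index_connected_def)
  qed
  ultimately have "SH_equiv B (Sigma_mat As Bs ns Cs os Ls ?c)" using B by (meson SH_equiv_trans)
  with c show ?thesis by blast
qed

theorem Sigma_mat_classification:
  assumes A: "int_weighing A" "H_equiv A (diag_block_mat decomp)"
  shows "classification_list SH_equiv (antisym_members A) (choices ms Ls) (Sigma_mat As Bs ns Cs os Ls)"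
proof -
  obtain k where k: "balanced k A" using int_weighing_imp_balanced[OF A(1)] .
  have "Sigma_mat As Bs ns Cs os Ls c \<in> antisym_members A" if "c \<in> choices ms Ls" for c
    using Sigma_mat_antisymmetric[OF that] Sigma_mat_H_equiv[OF that] A(2) H_equiv_sym H_equiv_trans
    unfolding antisym_members_def H_class_def by blast
  moreover have "\<exists>!c. c \<in> choices ms Ls \<and> SH_equiv B (Sigma_mat As Bs ns Cs os Ls c)"
    if "B \<in> antisym_members A" for B
  proof -
    have AB: "H_equiv A B" "antisymmetric B" using that by (auto simp: antisym_members_def H_class_def)
    have "balanced k B" using balanced_H_equiv[OF k AB(1)] .
    moreover have "H_equiv B (diag_block_mat decomp)" using AB(1) A(2) H_equiv_sym H_equiv_trans by
        blast
    ultimately obtain c where c: "c \<in> choices ms Ls" "SH_equiv B (Sigma_mat As Bs ns Cs os Ls c)"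
      using Sigma_mat_exists AB(2) by blast
    then show ?thesis
      using Sigma_mat_unique SH_equiv_sym SH_equiv_trans by (intro ex1I[of _ c]) blast+
  qed
  ultimately show ?thesis unfolding classification_list_def using finite_choices by blast
qed

end

section \<open>Automorphism groups\<close>

text \<open>The inverse of a bijective homomorphism is multiplicative as soon as products stay in
  the carrier, where injectivity applies. Isomorphisms can thus be reversed without verifying group
  laws for the automorphism records and wreath products.\<close>

lemma iso_sym_closed:
  assumes "h \<in> iso G H" "\<And>x y. x \<in> carrier G \<Longrightarrow> y \<in> carrier G \<Longrightarrow> x \<otimes>\<^bsub>G\<^esub> y \<in> carrier G"
  shows "H \<cong> G"
proof -
  let ?k = "inv_into (carrier G) h"
  have h: "h \<in> hom G H" "inj_on h (carrier G)" "h ` carrier G = carrier H"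
    using assms(1) by (auto simp: iso_iff)
  have k: "?k x \<in> carrier G" "h (?k x) = x" if "x \<in> carrier H" for x
    using that h(3) by (auto intro: inv_into_into f_inv_into_f)
  have "?k (x \<otimes>\<^bsub>H\<^esub> y) = ?k x \<otimes>\<^bsub>G\<^esub> ?k y" if "x \<in> carrier H" "y \<in> carrier H" for x y
    using k that h(1,2) assms(2) by (intro inv_into_f_eq) (auto simp: hom_def)
  then have "?k \<in> hom H G" using k by (auto simp: hom_def)
  moreover have "bij_betw ?k (carrier H) (carrier G)"
    using assms(1) by (simp add: iso_def bij_betw_inv_into)
  ultimately show ?thesis by (auto simp: is_iso_def iso_def)
qed

lemma hom_bij_imp_iso:
  assumes "h \<in> hom G H" "inj_on h (carrier G)" "carrier H \<subseteq> h ` carrier G"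
  shows "h \<in> iso G H"
  using assms hom_carrier[OF assms(1)] by (simp add: iso_iff subset_antisym)

lemma DirProd_cong_iso:
  assumes "G \<cong> G'" "H \<cong> H'"
  shows "G \<times>\<times> H \<cong> G' \<times>\<times> H'"
proof -
  obtain f g where f: "f \<in> iso G G'" and g: "g \<in> iso H H'" using assms by (auto simp: is_iso_def)
  have "bij_betw (map_prod f g) (carrier G \<times> carrier H) (carrier G' \<times> carrier H')"
    using f g by (intro bij_betw_map_prod) (auto simp: iso_def)
  moreover have "map_prod f g \<in> hom (G \<times>\<times> H) (G' \<times>\<times> H')"
    using f g by (auto simp: iso_def hom_def)
  ultimately show ?thesis by (auto simp: is_iso_def iso_def)
qed

text \<open>Elements of a product group are extensional functions, so a coordinate is added by an
  update at \<open>x\<close>, where a function on \<open>S\<close> is \<open>undefined\<close>, and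
  removed by restriction.\<close>

lemma product_group_insert_iso:
  assumes "x \<notin> S"
  shows "G x \<times>\<times> product_group S G \<cong> product_group (insert x S) G"
proof -
  let ?h = "\<lambda>(a, f). f(x := a)"
  have "?h \<in> hom (G x \<times>\<times> product_group S G) (product_group (insert x S) G)"
  proof (rule homI)
    fix p assume "p \<in> carrier (G x \<times>\<times> product_group S G)"
    then show "?h p \<in> carrier (product_group (insert x S) G)"
      by (auto simp: PiE_iff extensional_def)
  next
    fix p q assume "p \<in> carrier (G x \<times>\<times> product_group S G)" "q \<in> carrier (G x \<times>\<times> product_group S G)"
    then show "?h (p \<otimes>\<^bsub>G x \<times>\<times> product_group S G\<^esub> q) = ?h p \<otimes>\<^bsub>product_group (insert x S) G\<^esub> ?h q"
      using assms by (auto simp: fun_eq_iff restrict_def)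
  qed
  moreover have "bij_betw ?h (carrier (G x) \<times> (\<Pi>\<^sub>E i\<in>S. carrier (G i))) (\<Pi>\<^sub>E i\<in>insert x S. carrier
      (G i))"
  proof (rule bij_betw_byWitness[of _ "\<lambda>f. (f x, restrict f S)"])
    show "\<forall>p\<in>carrier (G x) \<times> (\<Pi>\<^sub>E i\<in>S. carrier (G i)). (?h p x, restrict (?h p) S) = p"
      using assms by (auto simp: fun_eq_iff PiE_iff extensional_def)
    show "\<forall>f\<in>\<Pi>\<^sub>E i\<in>insert x S. carrier (G i). ?h (f x, restrict f S) = f"
      by (auto simp: fun_eq_iff PiE_iff extensional_def)
    show "?h ` (carrier (G x) \<times> (\<Pi>\<^sub>E i\<in>S. carrier (G i))) \<subseteq> (\<Pi>\<^sub>E i\<in>insert x S. carrier (G i))"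
      by (auto simp: PiE_iff extensional_def split: if_splits)
    show "(\<lambda>f. (f x, restrict f S)) ` (\<Pi>\<^sub>E i\<in>insert x S. carrier (G i)) \<subseteq> carrier (G x) \<times> (\<Pi>\<^sub>E i\<in>S.
        carrier (G i))"
      by (auto simp: PiE_iff)
  qed
  ultimately show ?thesis by (auto simp: is_iso_def iso_def)
qed

section \<open>Automorphisms of congruent and of block diagonal matrices\<close>

lemma SAut_carrier: "B \<in> carrier_mat n n \<Longrightarrow> carrier (SAut B) = {M \<in> Mon n. M * B * transpose_mat M = B}"
  by (simp add: SAut_def)

lemma SAut_mult [simp]: "M \<otimes>\<^bsub>SAut B\<^esub> N = M * N"
  by (simp add: SAut_def)

lemma SAut_closed:
  assumes B: "B \<in> carrier_mat n n" and "M \<in> carrier (SAut B)" "N \<in> carrier (SAut B)"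
  shows "M * N \<in> carrier (SAut B)"
proof -
  have M: "M \<in> Mon n" "M * B * transpose_mat M = B" and N: "N \<in> Mon n" "N * B * transpose_mat N = B"
    using assms by (auto simp: SAut_carrier[OF B])
  have "M * N * B * transpose_mat (M * N) = B"
    using Mon_equivalence_comp[OF N(1) N(1) M(1) M(1) B] M(2) N(2) by simp
  then show ?thesis using Mon_mult_closed[OF M(1) N(1)] by (simp add: SAut_carrier[OF B])
qed

lemma SAut_index_iff:
  assumes B: "B \<in> carrier_mat n n" and M: "M \<in> Mon n"
  shows "M \<in> carrier (SAut B) \<longleftrightarrow> (\<forall>i<n. \<forall>j<n.
    B $$ (mon_perm M i, mon_perm M j) = mon_sign M i * mon_sign M j * B $$ (i, j))"
  using monomial_equivalence_iff[OF Mon_signed_perm[OF M] Mon_signed_perm[OF M] B B] M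
  by (simp add: SAut_carrier[OF B] Mon_eq_monomial[OF M, symmetric])

text \<open>The isomorphism is conjugation by the monomial matrix \<open>P\<close>, whose inverse is
  its transpose.\<close>

lemma SAut_SH_equiv_iso:
  assumes "SH_equiv B C"
  shows "SAut B \<cong> SAut C"
proof -
  from assms obtain n P where B: "B \<in> carrier_mat n n" and C: "C \<in> carrier_mat n n" and P: "P \<in> Mon n"
    and eq: "C = P * B * transpose_mat P" by (elim SH_equivE)
  let ?h = "\<lambda>M. P * M * transpose_mat P" and ?k = "\<lambda>M. transpose_mat P * M * P"
  have Pt: "transpose_mat P \<in> Mon n" using Mon_transpose[OF P] .
  note c = Mon_carrier[OF P] Mon_carrier[OF Pt]
  \<comment> \<open>Stated for an arbitrary \<open>Q\<close>, so as to serve for \<open>P\<close>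
    and for its transpose.\<close>
  have conj: "Q * M * transpose_mat Q \<in> carrier (SAut C')"
    if Q: "Q \<in> Mon n" and B': "B' \<in> carrier_mat n n" and M: "M \<in> carrier (SAut B')"
      and C': "C' = Q * B' * transpose_mat Q" for Q M B' C'
  proof -
    have Qt: "transpose_mat Q \<in> Mon n" using Mon_transpose[OF Q] .
    have M': "M \<in> Mon n" "M * B' * transpose_mat M = B'" using M by (auto simp: SAut_carrier[OF B'])
    have m: "Q * M * transpose_mat Q \<in> Mon n" by (intro Mon_mult_closed Q Qt M')
    have C'c: "C' \<in> carrier_mat n n" using C' Mon_carrier[OF Q] B' by simp
    have QM: "Q * M \<in> Mon n" by (intro Mon_mult_closed Q M')
    have "transpose_mat Q * C' * transpose_mat (transpose_mat Q) = B'"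
      using Mon_equivalence_cancel[OF Q Q B'] C' by simp
    then have "(Q * M * transpose_mat Q) * C' * transpose_mat (Q * M * transpose_mat Q) =
        (Q * M) * B' * transpose_mat (Q * M)"
      using Mon_equivalence_comp[OF Qt Qt QM QM C'c] by simp
    also have "\<dots> = C'"
      using Mon_equivalence_comp[OF M'(1) M'(1) Q Q B'] M'(2) C' by simp
    finally show ?thesis using m by (simp add: SAut_carrier[OF C'c])
  qed
  have Bk: "B = transpose_mat P * C * transpose_mat (transpose_mat P)"
    using Mon_equivalence_cancel[OF P P B] eq by simp
  have inv1: "?k (?h M) = M" if "M \<in> carrier_mat n n" for M
    using Mon_equivalence_cancel[OF P P that] by simp
  have inv2: "?h (?k M) = M" if "M \<in> carrier_mat n n" for M
    using Mon_equivalence_cancel[OF Pt Pt that] by simp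
  have car: "M \<in> carrier_mat n n" if "M \<in> carrier (SAut D)" "D \<in> carrier_mat n n" for M D
    using that Mon_carrier by (auto simp: SAut_carrier)
  have "bij_betw ?h (carrier (SAut B)) (carrier (SAut C))"
  proof (rule bij_betw_byWitness[of _ ?k])
    show "\<forall>M\<in>carrier (SAut B). ?k (?h M) = M" using inv1 car[OF _ B] by blast
    show "\<forall>M\<in>carrier (SAut C). ?h (?k M) = M" using inv2 car[OF _ C] by blast
    show "?h ` carrier (SAut B) \<subseteq> carrier (SAut C)" using conj[OF P B _ eq] by blast
    show "?k ` carrier (SAut C) \<subseteq> carrier (SAut B)" using conj[OF Pt C _ Bk] by auto
  qed
  moreover have "?h (M * N) = ?h M * ?h N" if "M \<in> carrier_mat n n" "N \<in> carrier_mat n n" for M N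
  proof -
    have "?h M * ?h N = P * M * (transpose_mat P * (P * N * transpose_mat P))"
      using c that by (simp add: assoc_mult_mat[of _ n n _ n _ n])
    also have "transpose_mat P * (P * N * transpose_mat P) = (transpose_mat P * P) * N *
        transpose_mat P"
      using c that by (simp add: assoc_mult_mat[of _ n n _ n _ n])
    also have "\<dots> = N * transpose_mat P" using Mon_orthogonal(2)[OF P] that by simp
    finally show ?thesis using c that by (simp add: assoc_mult_mat[of _ n n _ n _ n])
  qed
  ultimately have "?h \<in> iso (SAut B) (SAut C)"
    using conj[OF P B _ eq] car[OF _ B] by (auto simp: iso_def hom_def)
  then show ?thesis by (rule is_isoI)
qed

text \<open>By counting, the images of the first \<open>n\<close> positions fill \<open>T\<close>;
  injectivity keeps all other images out of it.\<close>

lemma signed_perm_complement: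
  assumes p: "signed_perm (n + m) p s" and T: "T \<subseteq> {..<n + m}" "card T = n"
    and "\<And>a. a < n \<Longrightarrow> p a \<in> T" and a: "n \<le> a" "a < n + m"
  shows "p a \<notin> T"
proof -
  have inj: "inj_on p {..<n}" using signed_perm_inj[OF p] by (auto simp: inj_on_def)
  have "p ` {..<n} \<subseteq> T" using assms by auto
  moreover have "card (p ` {..<n}) = card T" using card_image[OF inj] T by simp
  moreover have "finite T" using T(1) finite_subset by blast
  ultimately have "p ` {..<n} = T" using card_subset_eq by blast
  moreover have "p a \<noteq> p b" if "b < n" for b using signed_perm_inj[OF p, of a b] a that by simp
  ultimately show ?thesis by auto
qed

text \<open>If the first \<open>n\<close> positions are preserved, then so are the remaining ones,
  hence both off-diagonal blocks vanish.\<close>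

lemma Mon_block_diag_cases:
  assumes M: "M \<in> Mon (n + m)" and pres: "\<And>a. a < n \<Longrightarrow> mon_perm M a < n"
  obtains M1 M2 where "M1 \<in> Mon n" "M2 \<in> Mon m" "M = four_block_mat M1 (0\<^sub>m n m) (0\<^sub>m m n) M2"
proof -
  note p = Mon_signed_perm[OF M]
  have ge: "mon_perm M a \<notin> {..<n}" if "n \<le> a" "a < n + m" for a
    by (rule signed_perm_complement[OF p _ _ _ that]) (use pres in auto)
  have "M = diag_block_mat [mat n n (\<lambda>ij. M $$ ij), mat (n + m - n) (n + m - n) (\<lambda>(i, j). M $$ (n +
      i, n + j))]"
  proof (rule split_diag_block[OF Mon_carrier[OF M]])
    fix i j assume ij: "i < n" "n \<le> j" "j < n + m"
    show "M $$ (i, j) = 0" using mon_perm_eqI[OF M, of i j] ge[OF ij(2,3)] ij by (metis lessThan_iff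
        trans_less_add1)
    show "M $$ (j, i) = 0" using mon_perm_eqI[OF M, of j i] pres[OF ij(1)] ij by (metis not_le
        trans_less_add1)
  qed simp
  then have eq: "M = four_block_mat (mat n n (\<lambda>ij. M $$ ij)) (0\<^sub>m n m) (0\<^sub>m m n) (mat m m (\<lambda>(i, j).
      M $$ (n + i, n + j)))"
    by (simp add: diag_block_mat_two del: diag_block_mat.simps)
  with M have "four_block_mat (mat n n (\<lambda>ij. M $$ ij)) (0\<^sub>m n m) (0\<^sub>m m n) (mat m m (\<lambda>(i, j). M $$
      (n + i, n + j))) \<in> Mon (n + m)"
    by simp
  from Mon_four_block_diagD[OF this] eq show ?thesis by (intro that) auto
qed

lemma Mon_block_antidiag_cases:
  assumes M: "M \<in> Mon (n + n)" and pres: "\<And>a. a < n \<Longrightarrow> n \<le> mon_perm M a"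
  obtains L R where "L \<in> Mon n" "R \<in> Mon n" "M = four_block_mat (0\<^sub>m n n) L R (0\<^sub>m n n)"
proof -
  note p = Mon_signed_perm[OF M]
  have lt: "mon_perm M a < n" if "n \<le> a" "a < n + n" for a
  proof -
    have "mon_perm M a \<notin> {n..<n + n}"
    proof (rule signed_perm_complement[OF p _ _ _ that])
      show "mon_perm M b \<in> {n..<n + n}" if "b < n" for b
        using pres[OF that] signed_permD(1)[OF p, of b] that by simp
    qed auto
    then show ?thesis using signed_permD(1)[OF p that(2)] by auto
  qed
  let ?L = "mat n n (\<lambda>(i, j). M $$ (i, n + j))" and ?R = "mat n n (\<lambda>(i, j). M $$ (n + i, j))"
  have eq: "M = four_block_mat (0\<^sub>m n n) ?L ?R (0\<^sub>m n n)"
  proof (rule eq_matI)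
    fix i j assume "i < dim_row (four_block_mat (0\<^sub>m n n) ?L ?R (0\<^sub>m n n))"
      "j < dim_col (four_block_mat (0\<^sub>m n n) ?L ?R (0\<^sub>m n n))"
    then have ij: "i < n + n" "j < n + n" by auto
    have "M $$ (i, j) = 0" if "i < n \<longleftrightarrow> j < n"
      using mon_perm_eqI[OF M ij] pres[of j] lt[of j] ij that by (metis not_le)
    then show "M $$ (i, j) = four_block_mat (0\<^sub>m n n) ?L ?R (0\<^sub>m n n) $$ (i, j)"
      using ij by auto
  qed (use Mon_carrier[OF M] in auto)
  with M have "four_block_mat (0\<^sub>m n n) ?L ?R (0\<^sub>m n n) \<in> Mon (n + n)" by simp
  from Mon_four_block_antidiagD[OF this] eq show ?thesis by (intro that) auto
qed

lemma four_block_diag_congruence: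
  assumes "M1 \<in> carrier_mat n n" "M2 \<in> carrier_mat m m" "D1 \<in> carrier_mat n n" "D2 \<in> carrier_mat m m"
  shows "four_block_mat M1 (0\<^sub>m n m) (0\<^sub>m m n) M2 * four_block_mat D1 (0\<^sub>m n m) (0\<^sub>m m n) D2 *
      transpose_mat (four_block_mat M1 (0\<^sub>m n m) (0\<^sub>m m n) M2) =
    four_block_mat (M1 * D1 * transpose_mat M1) (0\<^sub>m n m) (0\<^sub>m m n) (M2 * D2 * transpose_mat M2)"
  using assms
  by (simp add: transpose_four_block_mat[of _ n n _ m _ m] mult_four_block_mat[of _ n n _ m _ m _ _
      n _ m])

lemma SAut_block_diag_iso:
  assumes D1: "D1 \<in> carrier_mat n n" and D2: "D2 \<in> carrier_mat m m"
    and pres: "\<And>M a. M \<in> carrier (SAut (four_block_mat D1 (0\<^sub>m n m) (0\<^sub>m m n) D2)) \<Longrightarrow> a < n \<Longrightarrow>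
        mon_perm M a < n"
  shows "SAut (four_block_mat D1 (0\<^sub>m n m) (0\<^sub>m m n) D2) \<cong> SAut D1 \<times>\<times> SAut D2"
proof -
  let ?F = "four_block_mat D1 (0\<^sub>m n m) (0\<^sub>m m n) D2"
  have F: "?F \<in> carrier_mat (n + m) (n + m)" using D1 D2 by simp
  let ?h = "\<lambda>(M1, M2). four_block_mat M1 (0\<^sub>m n m) (0\<^sub>m m n) M2"
  have car1: "M1 \<in> Mon n" "M1 \<in> carrier_mat n n" "M1 * D1 * transpose_mat M1 = D1" if "M1 \<in> carrier
      (SAut D1)" for M1
    using that Mon_carrier by (auto simp: SAut_carrier[OF D1])
  have car2: "M2 \<in> Mon m" "M2 \<in> carrier_mat m m" "M2 * D2 * transpose_mat M2 = D2" if "M2 \<in> carrier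
      (SAut D2)" for M2
    using that Mon_carrier by (auto simp: SAut_carrier[OF D2])
  have "?h \<in> hom (SAut D1 \<times>\<times> SAut D2) (SAut ?F)"
  proof (rule homI)
    fix x assume "x \<in> carrier (SAut D1 \<times>\<times> SAut D2)"
    then obtain M1 M2 where x: "x = (M1, M2)" "M1 \<in> carrier (SAut D1)" "M2 \<in> carrier (SAut D2)" by auto
    then show "?h x \<in> carrier (SAut ?F)"
      using four_block_diag_congruence[OF car1(2) car2(2) D1 D2] car1 car2
      by (simp add: SAut_carrier[OF F] Mon_four_block_diag)
  next
    fix x y assume xy: "x \<in> carrier (SAut D1 \<times>\<times> SAut D2)" "y \<in> carrier (SAut D1 \<times>\<times> SAut D2)"
    show "?h (x \<otimes>\<^bsub>SAut D1 \<times>\<times> SAut D2\<^esub> y) = ?h x \<otimes>\<^bsub>SAut ?F\<^esub> ?h y"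
    proof -
      obtain M1 M2 N1 N2 where eq: "x = (M1, M2)" "y = (N1, N2)" by fastforce
      have c: "M1 \<in> carrier_mat n n" "M2 \<in> carrier_mat m m" "N1 \<in> carrier_mat n n" "N2 \<in> carrier_mat
          m m"
        using car1(2) car2(2) xy by (auto simp: eq)
      show ?thesis using c by (simp add: eq mult_four_block_mat[of _ n n _ m _ m _ _ n _ m])
    qed
  qed
  moreover have "inj_on ?h (carrier (SAut D1 \<times>\<times> SAut D2))"
  proof (rule inj_onI)
    fix x y assume x: "x \<in> carrier (SAut D1 \<times>\<times> SAut D2)" and y: "y \<in> carrier (SAut D1 \<times>\<times> SAut D2)"
        and eq: "?h x = ?h y"
    obtain M1 M2 where x': "x = (M1, M2)" "M1 \<in> carrier_mat n n" "M2 \<in> carrier_mat m m"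
      using x car1(2) car2(2) by auto
    obtain N1 N2 where y': "y = (N1, N2)" "N1 \<in> carrier_mat n n" "N2 \<in> carrier_mat m m"
      using y car1(2) car2(2) by auto
    have "four_block_mat M1 (0\<^sub>m n m) (0\<^sub>m m n) M2 = four_block_mat N1 (0\<^sub>m n m) (0\<^sub>m m n) N2"
      using eq x'(1) y'(1) by simp
    from four_block_mat_eqD(1,4)[OF this x'(2) _ _ x'(3) y'(2) _ _ y'(3)] show "x = y"
      using x'(1) y'(1) by simp
  qed
  moreover have "carrier (SAut ?F) \<subseteq> ?h ` carrier (SAut D1 \<times>\<times> SAut D2)"
  proof
    fix M assume M: "M \<in> carrier (SAut ?F)"
    then have MM: "M \<in> Mon (n + m)" "M * ?F * transpose_mat M = ?F" by (auto simp: SAut_carrier[OF F])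
    obtain M1 M2 where M12: "M1 \<in> Mon n" "M2 \<in> Mon m" "M = four_block_mat M1 (0\<^sub>m n m) (0\<^sub>m m n) M2"
      using Mon_block_diag_cases[OF MM(1) pres[OF M]] .
    have c: "M1 \<in> carrier_mat n n" "M2 \<in> carrier_mat m m" using M12 Mon_carrier by auto
    have "four_block_mat (M1 * D1 * transpose_mat M1) (0\<^sub>m n m) (0\<^sub>m m n) (M2 * D2 * transpose_mat
        M2) = ?F"
      using MM(2) M12(3) four_block_diag_congruence[OF c D1 D2] by simp
    from four_block_mat_eqD(1,4)[OF this, of n n m m] c D1 D2
    have "M1 \<in> carrier (SAut D1)" "M2 \<in> carrier (SAut D2)"
      using M12 by (simp_all add: SAut_carrier[OF D1] SAut_carrier[OF D2])
    then show "M \<in> ?h ` carrier (SAut D1 \<times>\<times> SAut D2)" using M12(3) by (intro image_eqI[of _ _ "(M1,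
        M2)"]) auto
  qed
  ultimately have "?h \<in> iso (SAut D1 \<times>\<times> SAut D2) (SAut ?F)"
    by (rule hom_bij_imp_iso)
  then show ?thesis
    by (rule iso_sym_closed) (use SAut_closed[OF D1] SAut_closed[OF D2] in auto)
qed

text \<open>An automorphism maps each block to an SH-equivalent one, so a block of \<open>Xs\<close>
  cannot land among those of \<open>Ys\<close> and the positions occupied by \<open>Xs\<close> are
  preserved.\<close>

lemma SAut_diag_append_iso:
  assumes X: "\<forall>X\<in>set Xs. index_connected X" and Y: "\<forall>Y\<in>set Ys. index_connected Y"
    and cross: "\<And>X Y. X \<in> set Xs \<Longrightarrow> Y \<in> set Ys \<Longrightarrow> \<not> SH_equiv X Y"
  shows "SAut (diag_block_mat (Xs @ Ys)) \<cong> SAut (diag_block_mat Xs) \<times>\<times> SAut (diag_block_mat Ys)"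
proof -
  let ?n = "sum_list (map dim_row Xs)" and ?m = "sum_list (map dim_row Ys)"
  let ?Z = "Xs @ Ys"
  have sqX: "\<forall>X\<in>set Xs. square_mat X" and sqY: "\<forall>Y\<in>set Ys. square_mat Y"
    using X Y by (auto simp: index_connected_def)
  then have sqZ: "\<forall>X\<in>set ?Z. square_mat X" and Z: "\<forall>X\<in>set ?Z. index_connected X" using X Y by auto
  have D1: "diag_block_mat Xs \<in> carrier_mat ?n ?n" and D2: "diag_block_mat Ys \<in> carrier_mat ?m ?m"
    using diag_block_carrier sqX sqY by auto
  have eq: "diag_block_mat ?Z = four_block_mat (diag_block_mat Xs) (0\<^sub>m ?n ?m) (0\<^sub>m ?m ?n)
      (diag_block_mat Ys)"
    using carrier_matD[OF D1] carrier_matD[OF D2] by (simp add: diag_block_mat_append Let_def)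
  have N: "sum_list (map dim_row ?Z) = ?n + ?m" by simp
  have DZ: "diag_block_mat ?Z \<in> carrier_mat (?n + ?m) (?n + ?m)" using diag_block_carrier[OF sqZ] N
      by simp
  show ?thesis
    unfolding eq
  proof (rule SAut_block_diag_iso[OF D1 D2], fold eq)
    fix M a assume M: "M \<in> carrier (SAut (diag_block_mat ?Z))" and a: "a < ?n"
    have MM: "M \<in> Mon (?n + ?m)" using M by (simp add: SAut_carrier[OF DZ])
    note p = Mon_signed_perm[OF MM]
    have inv: "\<And>i j. i < ?n + ?m \<Longrightarrow> j < ?n + ?m \<Longrightarrow> diag_block_mat ?Z $$ (mon_perm M i, mon_perm M j) =
        mon_sign M i * mon_sign M j * diag_block_mat ?Z $$ (i, j)"
      using M unfolding SAut_index_iff[OF DZ MM] by blast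
    obtain \<sigma> q where \<sigma>: "bij_betw \<sigma> {..<length ?Z} {..<length ?Z}"
      "\<And>k. k < length ?Z \<Longrightarrow> dim_row (?Z ! \<sigma> k) = dim_row (?Z ! k)"
      "\<And>k. k < length ?Z \<Longrightarrow> signed_perm (dim_row (?Z ! k)) (q k) (\<lambda>i. mon_sign M (block_pos ?Z k i))"
      "\<And>k i j. k < length ?Z \<Longrightarrow> i < dim_row (?Z ! k) \<Longrightarrow> j < dim_row (?Z ! k) \<Longrightarrow>
         ?Z ! \<sigma> k $$ (q k i, q k j) = mon_sign M (block_pos ?Z k i) * mon_sign M (block_pos ?Z k j)
             * ?Z ! k $$ (i, j)"
      "\<And>k i. k < length ?Z \<Longrightarrow> i < dim_row (?Z ! k) \<Longrightarrow> mon_perm M (block_pos ?Z k i) = block_pos ?Z (\<sigma>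
          k) (q k i)"
      by (rule diag_block_congruence_blocks[OF Z Z N N p inv]; (assumption | rule that))
    obtain k i where k: "k < length Xs" "i < dim_row (Xs ! k)" "block_pos Xs k i = a" using
        block_pos_surj[OF a] .
    then have kZ: "k < length ?Z" "i < dim_row (?Z ! k)" "block_pos ?Z k i = a"
      by (auto simp: nth_append block_pos_def)
    have \<sigma>k: "\<sigma> k < length ?Z" using bij_betwE[OF \<sigma>(1)] kZ by auto
    have c: "?Z ! k \<in> carrier_mat (dim_row (?Z ! k)) (dim_row (?Z ! k))"
      using sqZ kZ(1) nth_mem unfolding square_mat_carrier by blast
    have c': "?Z ! \<sigma> k \<in> carrier_mat (dim_row (?Z ! k)) (dim_row (?Z ! k))"
      using sqZ \<sigma>k nth_mem \<sigma>(2)[OF kZ(1)] unfolding square_mat_carrier by metis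
    have "SH_equiv (?Z ! k) (?Z ! \<sigma> k)"
      unfolding SH_equiv_iff[OF c] using c' \<sigma>(3,4)[OF kZ(1)] by blast
    moreover have "?Z ! k \<in> set Xs" using k by (simp add: nth_append)
    ultimately have "?Z ! \<sigma> k \<notin> set Ys" using cross by blast
    then have \<sigma>k': "\<sigma> k < length Xs" using \<sigma>k by (auto simp: nth_append split: if_splits)
    have "mon_perm M a = block_pos ?Z (\<sigma> k) (q k i)" using \<sigma>(5)[OF kZ(1,2)] kZ(3) by simp
    also have "\<dots> = block_pos Xs (\<sigma> k) (q k i)" using \<sigma>k' by (simp add: block_pos_def)
    also have "\<dots> < ?n"
    proof (rule block_pos_less[OF \<sigma>k'])
      show "q k i < dim_row (Xs ! \<sigma> k)"
        using signed_permD(1)[OF \<sigma>(3)[OF kZ(1)] kZ(2)] \<sigma>(2)[OF kZ(1)] \<sigma>k' by (simp add: nth_append)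
    qed
    finally show "mon_perm M a < ?n" .
  qed
qed

section \<open>Repeated blocks and wreath products\<close>

lemma wreath_sym_carrier:
  "carrier (wreath_sym H r) = (\<Pi>\<^sub>E i\<in>{1..r}. carrier H) \<times> {s. s permutes {1..r}}"
  by (simp add: wreath_sym_def Let_def sym_group_def)

lemma wreath_sym_mult:
  "(h, s) \<otimes>\<^bsub>wreath_sym H r\<^esub> (h', s') = ((\<lambda>i\<in>{1..r}. h i \<otimes>\<^bsub>H\<^esub> h' (inv_into UNIV s i)), s \<circ> s')"
  by (simp add: wreath_sym_def Let_def sym_group_def cong: restrict_cong)

lemma wreath_sym_closed:
  assumes "\<And>x y. x \<in> carrier H \<Longrightarrow> y \<in> carrier H \<Longrightarrow> x \<otimes>\<^bsub>H\<^esub> y \<in> carrier H"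
    and "x \<in> carrier (wreath_sym H r)" "y \<in> carrier (wreath_sym H r)"
  shows "x \<otimes>\<^bsub>wreath_sym H r\<^esub> y \<in> carrier (wreath_sym H r)"
proof -
  obtain h s h' s' where eq: "x = (h, s)" "y = (h', s')" by fastforce
  have *: "h \<in> (\<Pi>\<^sub>E i\<in>{1..r}. carrier H)" "s permutes {1..r}" "h' \<in> (\<Pi>\<^sub>E i\<in>{1..r}. carrier H)" "s'
      permutes {1..r}"
    using assms(2,3) unfolding wreath_sym_carrier eq by auto
  have "inv_into UNIV s i \<in> {1..r}" if "i \<in> {1..r}" for i
    using permutes_in_image[OF permutes_inv[OF *(2)]] that by blast
  then have "h i \<otimes>\<^bsub>H\<^esub> h' (inv_into UNIV s i) \<in> carrier H" if "i \<in> {1..r}" for i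
    using *(1,3) that assms(1) by (meson PiE_mem)
  then show ?thesis
    using permutes_compose[OF *(4,2)] unfolding eq wreath_sym_mult wreath_sym_carrier by auto
qed

definition block_shift :: "(nat \<Rightarrow> nat) \<Rightarrow> nat \<Rightarrow> nat" where
  "block_shift s k = s (Suc k) - 1"

text \<open>The element \<open>(h, s)\<close> of the wreath product sends block \<open>k\<close> to block \<open>s k\<close>, applying the entry of
  \<open>h\<close> at the target; blocks are counted from \<open>0\<close> and the indices of the wreath product from \<open>1\<close>.\<close>

definition wreath_mat :: "int mat \<Rightarrow> nat \<Rightarrow> ('a \<Rightarrow> int mat) \<Rightarrow> (nat \<Rightarrow> 'a) \<times> (nat \<Rightarrow> nat) \<Rightarrow> int mat" where
  "wreath_mat X r \<phi> = (\<lambda>(h, s). let Xs = replicate r X in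
     monomial (sum_list (map dim_row Xs))
       (block_perm Xs Xs (block_shift s) (\<lambda>k. mon_perm (\<phi> (h (s (Suc k))))))
       (block_sign Xs (\<lambda>k. mon_sign (\<phi> (h (s (Suc k)))))))"

text \<open>An automorphism permutes the copies of the connected block \<open>X\<close> and acts
  between them by automorphisms of \<open>X\<close>; any such data occur. The isomorphism
  \<open>\<phi>\<close> is a parameter so that \<open>SAut\<close>, \<open>TAut\<close> and
  \<open>Aut\<close> can all serve as base group.\<close>

lemma SAut_replicate_iso:
  assumes conn: "index_connected X" and \<phi>: "\<phi> \<in> iso G (SAut X)"
    and closed: "\<And>x y. x \<in> carrier G \<Longrightarrow> y \<in> carrier G \<Longrightarrow> x \<otimes>\<^bsub>G\<^esub> y \<in> carrier G"
  shows "SAut (diag_block_mat (replicate r X)) \<cong> wreath_sym G r"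
proof -
  define n where "n = dim_row X"
  define Xs where "Xs = replicate r X"
  define N where "N = sum_list (map dim_row Xs)"
  have X: "X \<in> carrier_mat n n" using conn unfolding index_connected_def square_mat_carrier n_def by
      blast
  \<comment> \<open>On blocks of size zero a permutation of the copies would leave no trace, so
    injectivity depends on this.\<close>
  have n: "0 < n"
  proof -
    have "{..<n} \<noteq> {}" using conn unfolding index_connected_def connected_on_def n_def by blast
    then show ?thesis by auto
  qed
  have len: "length Xs = r" and nth: "\<And>k. k < r \<Longrightarrow> Xs ! k = X" by (auto simp: Xs_def)
  have dim: "dim_row (Xs ! k) = n" if "k < r" for k using nth[OF that] by (simp add: n_def)
  have sq: "\<forall>X\<in>set Xs. square_mat X" and connXs: "\<forall>X\<in>set Xs. index_connected X"
    using conn by (auto simp: Xs_def index_connected_def)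
  have D: "diag_block_mat Xs \<in> carrier_mat N N" unfolding N_def by (rule diag_block_carrier[OF sq])
  have hom: "\<phi> \<in> hom G (SAut X)" and inj: "inj_on \<phi> (carrier G)" and surj: "\<phi> ` carrier G = carrier
      (SAut X)"
    using \<phi> by (auto simp: iso_iff)
  have \<phi>M: "\<phi> x \<in> Mon n" if "x \<in> carrier G" for x
    using hom_in_carrier[OF hom that] by (simp add: SAut_carrier[OF X])
  let ?\<Psi> = "wreath_mat X r \<phi>"
  have bs: "block_shift s k < r" "s (Suc k) \<in> {1..r}" "Suc (block_shift s k) = s (Suc k)"
    if "s permutes {1..r}" "k < r" for s k
  proof -
    show "s (Suc k) \<in> {1..r}" using permutes_in_image[OF that(1), of "Suc k"] that(2) by simp
    then show "block_shift s k < r" "Suc (block_shift s k) = s (Suc k)" by (auto simp: block_shift_def)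
  qed
  have bij: "bij_betw (block_shift s) {..<length Xs} {..<length Xs}" if s: "s permutes {1..r}" for s
  proof -
    have "inj_on (block_shift s) {..<r}"
    proof (rule inj_onI)
      fix k l assume kl: "k \<in> {..<r}" "l \<in> {..<r}" "block_shift s k = block_shift s l"
      then have "s (Suc k) = s (Suc l)" using bs(3)[OF s, of k] bs(3)[OF s, of l] by simp
      then show "k = l" using injD[OF permutes_inj[OF s]] by blast
    qed
    moreover have "block_shift s ` {..<r} \<subseteq> {..<r}" using bs(1)[OF s] by auto
    ultimately show ?thesis unfolding len bij_betw_def by (simp add: endo_inj_surj)
  qed
  have h: "h (s (Suc k)) \<in> carrier G"
    if "h \<in> (\<Pi>\<^sub>E i\<in>{1..r}. carrier G)" "s permutes {1..r}" "k < r" for h s k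
    using that bs(2) by (meson PiE_mem)
  have \<Psi>_eq: "?\<Psi> (h, s) = monomial N (block_perm Xs Xs (block_shift s) (\<lambda>k. mon_perm (\<phi> (h (s (Suc
      k))))))
      (block_sign Xs (\<lambda>k. mon_sign (\<phi> (h (s (Suc k))))))" for h s
    by (simp add: wreath_mat_def Let_def Xs_def N_def)
  have sp: "signed_perm N (block_perm Xs Xs (block_shift s) (\<lambda>k. mon_perm (\<phi> (h (s (Suc k))))))
      (block_sign Xs (\<lambda>k. mon_sign (\<phi> (h (s (Suc k))))))"
    if "h \<in> (\<Pi>\<^sub>E i\<in>{1..r}. carrier G)" "s permutes {1..r}" for h s
    unfolding N_def
    using Mon_signed_perm[OF \<phi>M[OF h[OF that]]] bs(1)[OF that(2)] dim len
    by (intro signed_perm_block[OF bij[OF that(2)]]) simp_all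
  have perm: "mon_perm (?\<Psi> (h, s)) (block_pos Xs k i) = block_pos Xs (block_shift s k) (mon_perm (\<phi>
      (h (s (Suc k)))) i)"
    "mon_sign (?\<Psi> (h, s)) (block_pos Xs k i) = mon_sign (\<phi> (h (s (Suc k)))) i"
    if "h \<in> (\<Pi>\<^sub>E i\<in>{1..r}. carrier G)" "s permutes {1..r}" "k < r" "i < n" for h s k i
  proof -
    have "block_pos Xs k i < N" unfolding N_def using that dim len by (intro block_pos_less) auto
    from mon_perm_monomial[OF sp[OF that(1,2)] this]
    show "mon_perm (?\<Psi> (h, s)) (block_pos Xs k i) = block_pos Xs (block_shift s k) (mon_perm (\<phi> (h
        (s (Suc k)))) i)"
      "mon_sign (?\<Psi> (h, s)) (block_pos Xs k i) = mon_sign (\<phi> (h (s (Suc k)))) i"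
      unfolding \<Psi>_eq using block_perm_pos[of k Xs i] that dim len by auto
  qed
  have pos: "\<exists>k i. k < r \<and> i < n \<and> a = block_pos Xs k i" if "a < N" for a
    using block_pos_surj[OF that[unfolded N_def]] dim len by metis
  have \<Psi>Mon: "?\<Psi> (h, s) \<in> Mon N" if "h \<in> (\<Pi>\<^sub>E i\<in>{1..r}. carrier G)" "s permutes {1..r}" for h s
    unfolding \<Psi>_eq by (rule monomial_in_Mon[OF sp[OF that]])
  have \<Psi>car: "?\<Psi> (h, s) \<in> carrier (SAut (diag_block_mat Xs))"
    if hs: "h \<in> (\<Pi>\<^sub>E i\<in>{1..r}. carrier G)" "s permutes {1..r}" for h s
  proof -
    let ?p = "\<lambda>k. mon_perm (\<phi> (h (s (Suc k))))" and ?t = "\<lambda>k. mon_sign (\<phi> (h (s (Suc k))))"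
    have "diag_block_mat Xs $$ (block_perm Xs Xs (block_shift s) ?p a, block_perm Xs Xs (block_shift
        s) ?p b) =
      block_sign Xs ?t a * block_sign Xs ?t b * diag_block_mat Xs $$ (a, b)" if "a < N" "b < N" for a b
    proof (rule diag_block_equivalence[OF bij[OF hs(2)] sq sq])
      show "signed_perm (dim_row (Xs ! k)) (?p k) (?t k)" "signed_perm (dim_row (Xs ! k)) (?p k) (?t k)"
        if "k < length Xs" for k
        using Mon_signed_perm[OF \<phi>M[OF h[OF hs]]] that dim len by simp_all
      show "dim_row (Xs ! block_shift s k) = dim_row (Xs ! k)" if "k < length Xs" for k
        using that dim len bs(1)[OF hs(2)] by simp
      show "Xs ! block_shift s k $$ (?p k i, ?p k j) = ?t k i * ?t k j * Xs ! k $$ (i, j)"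
        if "k < length Xs" "i < dim_row (Xs ! k)" "j < dim_row (Xs ! k)" for k i j
      proof -
        have k: "k < r" using that len by simp
        have g: "h (s (Suc k)) \<in> carrier G" using h[OF hs k] .
        have "X $$ (?p k i, ?p k j) = ?t k i * ?t k j * X $$ (i, j)"
          using hom_in_carrier[OF hom g] that dim[OF k] unfolding SAut_index_iff[OF X \<phi>M[OF g]] by simp
        then show ?thesis using nth[OF k] nth[OF bs(1)[OF hs(2) k]] by simp
      qed
    qed (use that in \<open>auto simp: N_def\<close>)
    then have "?\<Psi> (h, s) * diag_block_mat Xs * transpose_mat (?\<Psi> (h, s)) = diag_block_mat Xs"
      unfolding \<Psi>_eq by (subst monomial_equivalence_iff[OF sp[OF hs] sp[OF hs] D D]) blast
    then show ?thesis using \<Psi>Mon[OF hs] by (simp add: SAut_carrier[OF D])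
  qed
  have "?\<Psi> \<in> hom (wreath_sym G r) (SAut (diag_block_mat Xs))"
  proof (rule homI)
    fix w assume "w \<in> carrier (wreath_sym G r)"
    then show "?\<Psi> w \<in> carrier (SAut (diag_block_mat Xs))"
      using \<Psi>car unfolding wreath_sym_carrier by auto
  next
    fix w w' assume w: "w \<in> carrier (wreath_sym G r)" and w': "w' \<in> carrier (wreath_sym G r)"
    obtain h0 s0 where eq: "w = (h0, s0)" by (cases w)
    obtain h1 s1 where eq': "w' = (h1, s1)" by (cases w')
    have hs: "h0 \<in> (\<Pi>\<^sub>E i\<in>{1..r}. carrier G)" "s0 permutes {1..r}" using w unfolding
        wreath_sym_carrier eq by auto
    have hs': "h1 \<in> (\<Pi>\<^sub>E i\<in>{1..r}. carrier G)" "s1 permutes {1..r}" using w' unfolding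
        wreath_sym_carrier eq' by auto
    define h2 s2 where "h2 = (\<lambda>i\<in>{1..r}. h0 i \<otimes>\<^bsub>G\<^esub> h1 (inv_into UNIV s0 i))" and "s2 = s0 \<circ> s1"
    have ww: "w \<otimes>\<^bsub>wreath_sym G r\<^esub> w' = (h2, s2)" unfolding eq eq' wreath_sym_mult h2_def s2_def ..
    have "(h2, s2) \<in> carrier (wreath_sym G r)"
      using wreath_sym_closed[OF closed w w'] ww by simp
    then have hs2: "h2 \<in> (\<Pi>\<^sub>E i\<in>{1..r}. carrier G)" "s2 permutes {1..r}" unfolding
        wreath_sym_carrier by auto
    have "?\<Psi> (h2, s2) = ?\<Psi> (h0, s0) * ?\<Psi> (h1, s1)"
    proof (rule Mon_eqI[OF \<Psi>Mon[OF hs2] Mon_mult_closed[OF \<Psi>Mon[OF hs] \<Psi>Mon[OF hs']]])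
      have key: "mon_perm (?\<Psi> (h2, s2)) a = mon_perm (?\<Psi> (h0, s0) * ?\<Psi> (h1, s1)) a \<and>
          mon_sign (?\<Psi> (h2, s2)) a = mon_sign (?\<Psi> (h0, s0) * ?\<Psi> (h1, s1)) a" if a: "a < N" for a
      proof -
        obtain k i where k: "k < r" "i < n" "a = block_pos Xs k i" using pos[OF a] by blast
        let ?k = "block_shift s1 k" and ?g0 = "\<phi> (h0 (s0 (s1 (Suc k))))" and ?g1 = "\<phi> (h1 (s1 (Suc k)))"
        have k': "?k < r" "Suc ?k = s1 (Suc k)" using bs[OF hs'(2) k(1)] by auto
        have g1: "h1 (s1 (Suc k)) \<in> carrier G" using h[OF hs' k(1)] .
        have g0: "h0 (s0 (s1 (Suc k))) \<in> carrier G" using h[OF hs k'(1)] k'(2) by simp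
        have i': "mon_perm ?g1 i < n" using signed_permD(1)[OF Mon_signed_perm[OF \<phi>M[OF g1]] k(2)] .
        have s2k: "s2 (Suc k) = s0 (s1 (Suc k))" "s2 (Suc k) \<in> {1..r}"
          using bs(2)[OF hs2(2) k(1)] by (auto simp: s2_def)
        \<comment> \<open>Counted from one, block \<open>Suc k\<close> is sent to
          \<open>s1 (Suc k)\<close> and from there to \<open>s0 (s1 (Suc k))\<close>. The twist by
          the inverse of \<open>s0\<close> in the product evaluates \<open>h1\<close> at the
          intermediate stop.\<close>
        have "h2 (s2 (Suc k)) = h0 (s2 (Suc k)) \<otimes>\<^bsub>G\<^esub> h1 (inv_into UNIV s0 (s2 (Suc k)))"
          using s2k(2) by (simp add: h2_def)
        also have "inv_into UNIV s0 (s2 (Suc k)) = s1 (Suc k)"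
          unfolding s2k(1) using permutes_inj[OF hs(2)] by (simp add: inv_f_f)
        finally have "\<phi> (h2 (s2 (Suc k))) = ?g0 * ?g1"
          using hom g0 g1 s2k(1) by (simp add: hom_def)
        note prod = this mon_perm_mult[OF \<phi>M[OF g0] \<phi>M[OF g1] k(2)]
        have shift: "block_shift s2 k = block_shift s0 ?k"
          unfolding block_shift_def[of s2] block_shift_def[of s0] k'(2) by (simp add: s2_def)
        have "mon_perm (?\<Psi> (h1, s1)) a = block_pos Xs ?k (mon_perm ?g1 i)"
          "mon_sign (?\<Psi> (h1, s1)) a = mon_sign ?g1 i"
          using perm[OF hs' k(1,2)] k(3) by auto
        moreover have "mon_perm (?\<Psi> (h0, s0)) (block_pos Xs ?k (mon_perm ?g1 i)) =
            block_pos Xs (block_shift s0 ?k) (mon_perm ?g0 (mon_perm ?g1 i))"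
          "mon_sign (?\<Psi> (h0, s0)) (block_pos Xs ?k (mon_perm ?g1 i)) = mon_sign ?g0 (mon_perm ?g1 i)"
          using perm[OF hs k'(1) i'] k'(2) by auto
        moreover have "mon_perm (?\<Psi> (h2, s2)) a = block_pos Xs (block_shift s0 ?k) (mon_perm ?g0
            (mon_perm ?g1 i))"
          "mon_sign (?\<Psi> (h2, s2)) a = mon_sign ?g0 (mon_perm ?g1 i) * mon_sign ?g1 i"
          using perm[OF hs2 k(1,2)] k(3) prod shift by auto
        ultimately show ?thesis
          using mon_perm_mult[OF \<Psi>Mon[OF hs] \<Psi>Mon[OF hs'] a] by simp
      qed
      show "mon_perm (?\<Psi> (h2, s2)) a = mon_perm (?\<Psi> (h0, s0) * ?\<Psi> (h1, s1)) a"
        "mon_sign (?\<Psi> (h2, s2)) a = mon_sign (?\<Psi> (h0, s0) * ?\<Psi> (h1, s1)) a" if "a < N" for a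
        using key[OF that] by auto
    qed
    then show "?\<Psi> (w \<otimes>\<^bsub>wreath_sym G r\<^esub> w') = ?\<Psi> w \<otimes>\<^bsub>SAut (diag_block_mat Xs)\<^esub> ?\<Psi> w'"
      unfolding ww by (simp add: eq eq')
  qed
  moreover have "inj_on ?\<Psi> (carrier (wreath_sym G r))"
  proof (rule inj_onI)
    fix w w' assume w: "w \<in> carrier (wreath_sym G r)" and w': "w' \<in> carrier (wreath_sym G r)" and \<Psi>:
        "?\<Psi> w = ?\<Psi> w'"
    obtain h0 s0 where eq: "w = (h0, s0)" by (cases w)
    obtain h1 s1 where eq': "w' = (h1, s1)" by (cases w')
    have hs: "h0 \<in> (\<Pi>\<^sub>E i\<in>{1..r}. carrier G)" "s0 permutes {1..r}" using w unfolding
        wreath_sym_carrier eq by auto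
    have hs': "h1 \<in> (\<Pi>\<^sub>E i\<in>{1..r}. carrier G)" "s1 permutes {1..r}" using w' unfolding
        wreath_sym_carrier eq' by auto
    have key: "s0 (Suc k) = s1 (Suc k) \<and> h0 (s0 (Suc k)) = h1 (s1 (Suc k))" if k: "k < r" for k
    proof -
      note g0 = h[OF hs k] and g1 = h[OF hs' k]
      note sp0 = Mon_signed_perm[OF \<phi>M[OF g0]] and sp1 = Mon_signed_perm[OF \<phi>M[OF g1]]
      have *: "block_shift s0 k = block_shift s1 k \<and> mon_perm (\<phi> (h0 (s0 (Suc k)))) i = mon_perm (\<phi>
          (h1 (s1 (Suc k)))) i"
        "mon_sign (\<phi> (h0 (s0 (Suc k)))) i = mon_sign (\<phi> (h1 (s1 (Suc k)))) i" if i: "i < n" for i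
      proof -
        have "block_pos Xs (block_shift s0 k) (mon_perm (\<phi> (h0 (s0 (Suc k)))) i) =
            block_pos Xs (block_shift s1 k) (mon_perm (\<phi> (h1 (s1 (Suc k)))) i)"
          using perm(1)[OF hs k i] perm(1)[OF hs' k i] \<Psi> eq eq' by simp
        then show "block_shift s0 k = block_shift s1 k \<and> mon_perm (\<phi> (h0 (s0 (Suc k)))) i = mon_perm
            (\<phi> (h1 (s1 (Suc k)))) i"
          using block_pos_eq_iff[of "block_shift s0 k" Xs _ "block_shift s1 k"] bs(1)[OF hs(2) k]
              bs(1)[OF hs'(2) k]
            dim len signed_permD(1)[OF sp0 i] signed_permD(1)[OF sp1 i] by simp
        show "mon_sign (\<phi> (h0 (s0 (Suc k)))) i = mon_sign (\<phi> (h1 (s1 (Suc k)))) i"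
          using perm(2)[OF hs k i] perm(2)[OF hs' k i] \<Psi> eq eq' by simp
      qed
      \<comment> \<open>The image of a single position, available since \<open>0 < n\<close>,
        already reveals the target block.\<close>
      have "s0 (Suc k) = s1 (Suc k)" using *(1)[OF n] bs(3)[OF hs(2) k] bs(3)[OF hs'(2) k] by metis
      moreover have "\<phi> (h0 (s0 (Suc k))) = \<phi> (h1 (s1 (Suc k)))"
        using * by (intro Mon_eqI[OF \<phi>M[OF g0] \<phi>M[OF g1]]) auto
      ultimately show ?thesis using inj g0 g1 by (auto simp: inj_on_def)
    qed
    have "s0 = s1"
    proof
      fix j show "s0 j = s1 j"
      proof (cases "j \<in> {1..r}")
        case True
        then show ?thesis using key[of "j - 1"] by auto
      next
        case False
        then show ?thesis using permutes_not_in[OF hs(2)] permutes_not_in[OF hs'(2)] by simp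
      qed
    qed
    moreover have "h0 = h1"
    proof (rule PiE_ext[OF hs(1) hs'(1)])
      fix j assume j: "j \<in> {1..r}"
      \<comment> \<open>The comparison in \<open>key\<close> runs over source blocks while
        \<open>h0\<close> and \<open>h1\<close> are indexed by targets; \<open>l\<close> is the
        source that is sent to \<open>j\<close>.\<close>
      define l where "l = inv_into UNIV s0 j"
      have "l \<in> {1..r}" using permutes_in_image[OF permutes_inv[OF hs(2)]] j unfolding l_def by blast
      moreover have "s0 l = j" unfolding l_def using permutes_surj[OF hs(2)] by (simp add: surj_f_inv_f)
      ultimately show "h0 j = h1 j" using key[of "l - 1"] \<open>s0 = s1\<close> by auto
    qed
    ultimately show "w = w'" by (simp add: eq eq')
  qed
  moreover have "carrier (SAut (diag_block_mat Xs)) \<subseteq> ?\<Psi> ` carrier (wreath_sym G r)"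
  proof
    fix M assume M: "M \<in> carrier (SAut (diag_block_mat Xs))"
    have MM: "M \<in> Mon N" using M by (simp add: SAut_carrier[OF D])
    note p = Mon_signed_perm[OF MM]
    have ND: "sum_list (map dim_row Xs) = N" by (simp add: N_def)
    have inv: "\<And>i j. i < N \<Longrightarrow> j < N \<Longrightarrow> diag_block_mat Xs $$ (mon_perm M i, mon_perm M j) =
        mon_sign M i * mon_sign M j * diag_block_mat Xs $$ (i, j)"
      using M unfolding SAut_index_iff[OF D MM] by blast
    obtain \<sigma> q where \<sigma>: "bij_betw \<sigma> {..<length Xs} {..<length Xs}"
      "\<And>k. k < length Xs \<Longrightarrow> dim_row (Xs ! \<sigma> k) = dim_row (Xs ! k)"
      "\<And>k. k < length Xs \<Longrightarrow> signed_perm (dim_row (Xs ! k)) (q k) (\<lambda>i. mon_sign M (block_pos Xs k i))"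
      "\<And>k i j. k < length Xs \<Longrightarrow> i < dim_row (Xs ! k) \<Longrightarrow> j < dim_row (Xs ! k) \<Longrightarrow>
         Xs ! \<sigma> k $$ (q k i, q k j) = mon_sign M (block_pos Xs k i) * mon_sign M (block_pos Xs k j)
             * Xs ! k $$ (i, j)"
      "\<And>k i. k < length Xs \<Longrightarrow> i < dim_row (Xs ! k) \<Longrightarrow> mon_perm M (block_pos Xs k i) = block_pos Xs (\<sigma>
          k) (q k i)"
      by (rule diag_block_congruence_blocks[OF connXs connXs ND ND p inv]; (assumption | rule that))
    have \<sigma>r: "bij_betw \<sigma> {..<r} {..<r}" using \<sigma>(1) len by simp
    have \<sigma>l: "\<sigma> k < r" if "k < r" for k using bij_betwE[OF \<sigma>r] that by auto
    \<comment> \<open>What \<open>M\<close> does between block \<open>k\<close> and its image, read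
      as a monomial matrix of the size of \<open>X\<close>.\<close>
    define g where "g k = monomial n (q k) (\<lambda>i. mon_sign M (block_pos Xs k i))" for k
    have spq: "signed_perm n (q k) (\<lambda>i. mon_sign M (block_pos Xs k i))" if "k < r" for k
      using \<sigma>(3) that len dim by simp
    have g: "g k \<in> carrier (SAut X)" if k: "k < r" for k
    proof -
      have "g k * X * transpose_mat (g k) = X"
        unfolding g_def using \<sigma>(4)[of k] k len dim[OF k] nth[OF k] nth[OF \<sigma>l[OF k]]
        by (subst monomial_equivalence_iff[OF spq[OF k] spq[OF k] X X]) simp
      then show ?thesis using monomial_in_Mon[OF spq[OF k]] by (simp add: SAut_carrier[OF X] g_def)
    qed
    \<comment> \<open>\<open>\<sigma>\<close> counts blocks from zero, whereas elements of the
      symmetric group permute \<open>{1..r}\<close> and fix everything else.\<close>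
    define s where "s j = (if j \<in> {1..r} then Suc (\<sigma> (j - 1)) else j)" for j
    \<comment> \<open>Entry \<open>j\<close> belongs to the target, so it describes the block that
      \<open>\<sigma>\<close> sends to \<open>j - 1\<close>.\<close>
    define h where "h = (\<lambda>j\<in>{1..r}. inv_into (carrier G) \<phi> (g (inv_into {..<r} \<sigma> (j - 1))))"
    have s: "s permutes {1..r}"
    proof (rule bij_imp_permutes)
      have b1: "bij_betw (\<lambda>j. j - 1) {1..r} {..<r}"
        by (rule bij_betw_byWitness[of _ Suc]) auto
      have b2: "bij_betw Suc {..<r} {1..r}"
        by (rule bij_betw_byWitness[of _ "\<lambda>j. j - 1"]) auto
      have "bij_betw (Suc \<circ> (\<sigma> \<circ> (\<lambda>j. j - 1))) {1..r} {1..r}"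
        by (rule bij_betw_trans[OF bij_betw_trans[OF b1 \<sigma>r] b2])
      then show "bij_betw s {1..r} {1..r}"
        by (rule bij_betw_cong[THEN iffD1, rotated]) (simp add: s_def)
    qed (auto simp: s_def)
    have inv_mem: "inv_into (carrier G) \<phi> M' \<in> carrier G" "\<phi> (inv_into (carrier G) \<phi> M') = M'"
      if "M' \<in> carrier (SAut X)" for M'
      using that surj by (auto intro: inv_into_into f_inv_into_f)
    have inv\<sigma>: "inv_into {..<r} \<sigma> l < r" if "l < r" for l
      using that \<sigma>r inv_into_into[of l \<sigma> "{..<r}"] by (auto simp: bij_betw_def)
    have hc: "h \<in> (\<Pi>\<^sub>E i\<in>{1..r}. carrier G)"
    proof (rule PiE_I)
      fix j assume j: "j \<in> {1..r}"
      then have "j - 1 < r" by auto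
      then show "h j \<in> carrier G" using inv_mem(1)[OF g[OF inv\<sigma>]] j by (simp add: h_def)
    qed (auto simp: h_def)
    have hk: "\<phi> (h (s (Suc k))) = g k" and shift: "block_shift s k = \<sigma> k" if k: "k < r" for k
    proof -
      have "s (Suc k) = Suc (\<sigma> k)" using k by (simp add: s_def)
      then show "block_shift s k = \<sigma> k" by (simp add: block_shift_def)
      have "inv_into {..<r} \<sigma> (\<sigma> k) = k" using \<sigma>r k by (simp add: bij_betw_def inv_into_f_f)
      then have "h (s (Suc k)) = inv_into (carrier G) \<phi> (g k)"
        using \<open>s (Suc k) = Suc (\<sigma> k)\<close> \<sigma>l[OF k] by (simp add: h_def)
      then show "\<phi> (h (s (Suc k))) = g k" using inv_mem(2)[OF g[OF k]] by simp
    qed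
    have key: "mon_perm M a = mon_perm (?\<Psi> (h, s)) a \<and> mon_sign M a = mon_sign (?\<Psi> (h, s)) a" if a:
        "a < N" for a
    proof -
      obtain k i where k: "k < r" "i < n" "a = block_pos Xs k i" using pos[OF a] by blast
      have "mon_perm (g k) i = q k i" "mon_sign (g k) i = mon_sign M a"
        using mon_perm_monomial[OF spq[OF k(1)] k(2)] k(3) by (auto simp: g_def)
      then show ?thesis
        using perm[OF hc s k(1,2)] hk[OF k(1)] shift[OF k(1)] \<sigma>(5)[of k i] k len dim[OF k(1)] by simp
    qed
    have "M = ?\<Psi> (h, s)" using key by (intro Mon_eqI[OF MM \<Psi>Mon[OF hc s]]) auto
    moreover have "(h, s) \<in> carrier (wreath_sym G r)" using hc s unfolding wreath_sym_carrier by simp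
    ultimately show "M \<in> ?\<Psi> ` carrier (wreath_sym G r)" by (rule image_eqI)
  qed
  ultimately have "?\<Psi> \<in> iso (wreath_sym G r) (SAut (diag_block_mat Xs))"
    by (rule hom_bij_imp_iso)
  then have "SAut (diag_block_mat Xs) \<cong> wreath_sym G r"
    by (rule iso_sym_closed) (rule wreath_sym_closed[OF closed])
  then show ?thesis by (simp add: Xs_def)
qed

text \<open>Induction over the distinct blocks: the copies of the first one are not SH-equivalent to
  any later block, so their wreath product splits off as a direct factor.\<close>

lemma SAut_grouped_iso:
  fixes blk :: "'a \<Rightarrow> int mat" and G :: "'a \<Rightarrow> 'b monoid"
  assumes "distinct ds"
    and "\<And>x. x \<in> set ds \<Longrightarrow> index_connected (blk x)"
    and "\<And>x y. x \<in> set ds \<Longrightarrow> y \<in> set ds \<Longrightarrow> SH_equiv (blk x) (blk y) \<Longrightarrow> x = y"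
    and "\<And>x. x \<in> set ds \<Longrightarrow> \<exists>\<phi>. \<phi> \<in> iso (G x) (SAut (blk x))"
    and "\<And>x a b. x \<in> set ds \<Longrightarrow> a \<in> carrier (G x) \<Longrightarrow> b \<in> carrier (G x) \<Longrightarrow> a \<otimes>\<^bsub>G x\<^esub> b \<in> carrier (G x)"
  shows "SAut (diag_block_mat (map blk (concat (map (\<lambda>x. replicate (c x) x) ds)))) \<cong>
    product_group (set ds) (\<lambda>x. wreath_sym (G x) (c x))"
  using assms
proof (induction ds)
  case Nil
  \<comment> \<open>The empty sum is the matrix of size zero, whose only automorphism is itself; the
    empty product has as only element the function that is \<open>undefined\<close>
    everywhere.\<close>
  have 0: "carrier (SAut (0\<^sub>m 0 0)) = {0\<^sub>m 0 0}"
  proof -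
    have "M = 0\<^sub>m 0 0" if "M \<in> carrier_mat 0 0" for M :: "int mat" using that by (intro eq_matI) auto
    moreover have "0\<^sub>m 0 0 \<in> Mon 0" by (simp add: Mon_def)
    ultimately show ?thesis using Mon_carrier[of _ 0] by (auto simp: SAut_def)
  qed
  have "(\<lambda>_. (\<lambda>_. undefined)) \<in> iso (SAut (0\<^sub>m 0 0)) (product_group {} (\<lambda>x. wreath_sym (G x) (c x)))"
    by (auto simp: iso_def hom_def bij_betw_def 0 restrict_def)
  then show ?case by (auto simp: is_iso_def)
next
  case (Cons x ds)
  let ?rest = "concat (map (\<lambda>x. replicate (c x) x) ds)"
  have rest: "set ?rest \<subseteq> set ds" by auto
  have IH: "SAut (diag_block_mat (map blk ?rest)) \<cong> product_group (set ds) (\<lambda>x. wreath_sym (G x) (c x))"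
    using Cons.prems by (intro Cons.IH) auto
  have x: "x \<notin> set ds" using Cons.prems(1) by simp
  have "\<not> SH_equiv X Y" if XY: "X \<in> set (replicate (c x) (blk x))" "Y \<in> set (map blk ?rest)" for X Y
  proof
    assume SH: "SH_equiv X Y"
    obtain y where y: "y \<in> set ds" "Y = blk y" using XY(2) rest by auto
    have "X = blk x" using XY(1) by auto
    then have "x = y" using Cons.prems(3)[of x y] SH y by auto
    then show False using y x by simp
  qed
  then have "SAut (diag_block_mat (replicate (c x) (blk x) @ map blk ?rest)) \<cong>
      SAut (diag_block_mat (replicate (c x) (blk x))) \<times>\<times> SAut (diag_block_mat (map blk ?rest))"
    using Cons.prems(2) rest by (intro SAut_diag_append_iso) auto
  also have "SAut (diag_block_mat (replicate (c x) (blk x))) \<times>\<times> SAut (diag_block_mat (map blk ?rest)) \<cong>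
      wreath_sym (G x) (c x) \<times>\<times> product_group (set ds) (\<lambda>x. wreath_sym (G x) (c x))"
  proof (rule DirProd_cong_iso[OF _ IH])
    obtain \<phi> where \<phi>: "\<phi> \<in> iso (G x) (SAut (blk x))" using Cons.prems(4)[of x] by auto
    show "SAut (diag_block_mat (replicate (c x) (blk x))) \<cong> wreath_sym (G x) (c x)"
      using Cons.prems(2,5)[of x] by (intro SAut_replicate_iso[OF _ \<phi>]) auto
  qed
  also have "wreath_sym (G x) (c x) \<times>\<times> product_group (set ds) (\<lambda>x. wreath_sym (G x) (c x)) \<cong>
      product_group (insert x (set ds)) (\<lambda>x. wreath_sym (G x) (c x))"
    using product_group_insert_iso[OF x, of "\<lambda>x. wreath_sym (G x) (c x)"] .
  finally show ?case by simp
qed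

text \<open>Bringing equal blocks together is a congruence and so changes \<open>SAut\<close> only
  by conjugation.\<close>

theorem SAut_wreath_product_iso:
  fixes blk :: "'a \<Rightarrow> int mat" and G :: "'a \<Rightarrow> 'b monoid"
  assumes conn: "\<And>x. x \<in> set xs \<Longrightarrow> index_connected (blk x)"
    and "\<And>x y. x \<in> set xs \<Longrightarrow> y \<in> set xs \<Longrightarrow> SH_equiv (blk x) (blk y) \<Longrightarrow> x = y"
    and "\<And>x. x \<in> set xs \<Longrightarrow> \<exists>\<phi>. \<phi> \<in> iso (G x) (SAut (blk x))"
    and "\<And>x a b. x \<in> set xs \<Longrightarrow> a \<in> carrier (G x) \<Longrightarrow> b \<in> carrier (G x) \<Longrightarrow> a \<otimes>\<^bsub>G x\<^esub> b \<in> carrier (G x)"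
  shows "SAut (diag_block_mat (map blk xs)) \<cong> wreath_product G xs"
proof -
  let ?ys = "concat (map (\<lambda>x. replicate (count_list xs x) x) (remdups xs))"
  have "mset ?ys = mset xs"
    using mset_concat_replicate[of "remdups xs" "mset xs"] by (simp add: count_mset)
  then have "mset (map blk xs) = mset (map blk ?ys)" by (metis mset_map)
  then have "SH_equiv (diag_block_mat (map blk xs)) (diag_block_mat (map blk ?ys))"
    using conn by (intro diag_block_mset_SH_equiv) (auto simp: index_connected_def)
  then have "SAut (diag_block_mat (map blk xs)) \<cong> SAut (diag_block_mat (map blk ?ys))"
    by (rule SAut_SH_equiv_iso)
  also have "SAut (diag_block_mat (map blk ?ys)) \<cong>
      product_group (set (remdups xs)) (\<lambda>x. wreath_sym (G x) (count_list xs x))"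
    using assms by (intro SAut_grouped_iso) auto
  finally show ?thesis by (simp add: wreath_product_def)
qed

section \<open>Automorphisms of a single skew block\<close>

fun taut_mat :: "nat \<Rightarrow> taut_elem \<Rightarrow> int mat" where
  "taut_mat n (Plain L R) = four_block_mat L (0\<^sub>m n n) (0\<^sub>m n n) R"
| "taut_mat n (Transp L R) = four_block_mat (0\<^sub>m n n) L (- R) (0\<^sub>m n n)"

lemma taut_mat_congruence:
  assumes "x \<in> taut_elems n" "Y \<in> carrier_mat n n"
  shows "taut_mat n x * skew_block Y * transpose_mat (taut_mat n x) = skew_block (taut_op x Y)"
  using assms skew_block_congruence skew_block_congruence_antidiag
  by (auto simp: taut_elems_def dest!: Mon_carrier)

lemma taut_mat_in_Mon: "x \<in> taut_elems n \<Longrightarrow> taut_mat n x \<in> Mon (n + n)"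
  by (auto simp: taut_elems_def intro!: Mon_four_block_diag Mon_four_block_antidiag uminus_in_Mon)

text \<open>The product of two antidiagonal block matrices is diagonal with blocks
  \<open>- (L * R')\<close> and \<open>- (R * L')\<close>, in accordance with the sign rule of
  \<open>taut_mult\<close> for two triples.\<close>

lemma taut_mat_mult:
  assumes "x \<in> taut_elems n" "y \<in> taut_elems n"
  shows "taut_mat n (taut_mult x y) = taut_mat n x * taut_mat n y"
  using assms
  by (auto simp: taut_elems_def mult_four_block_mat[of _ n n _ n _ n _ _ n _ n] dest!: Mon_carrier)

lemma taut_op_carrier:
  assumes "x \<in> taut_elems n" "Y \<in> carrier_mat n n"
  shows "taut_op x Y \<in> carrier_mat n n"
  using assms by (auto simp: taut_elems_def dest!: Mon_carrier)

lemma taut_mult_elems: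
  "x \<in> taut_elems n \<Longrightarrow> y \<in> taut_elems n \<Longrightarrow> taut_mult x y \<in> taut_elems n"
  by (auto simp: taut_elems_def Mon_mult_closed uminus_in_Mon)

lemma skew_block_inj:
  assumes "skew_block X = skew_block Y" "X \<in> carrier_mat n n" "Y \<in> carrier_mat n n"
  shows "X = Y"
proof -
  have "four_block_mat (0\<^sub>m n n) X (- transpose_mat X) (0\<^sub>m n n) = four_block_mat (0\<^sub>m n n) Y (-
      transpose_mat Y) (0\<^sub>m n n)"
    using assms skew_block_eq by metis
  from four_block_mat_eqD(2)[OF this, of n n n n] show ?thesis using assms(2,3) by simp
qed

lemma zero_not_in_Mon: "0 < n \<Longrightarrow> 0\<^sub>m n n \<notin> Mon n"
  by (auto simp: Mon_def)

text \<open>A block diagonal and an antidiagonal matrix can agree only if all their blocks vanish,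
  and a zero matrix of positive size is not monomial.\<close>

lemma inj_on_taut_mat:
  assumes "0 < n"
  shows "inj_on (taut_mat n) (taut_elems n)"
proof (rule inj_onI)
  fix x y assume x: "x \<in> taut_elems n" and y: "y \<in> taut_elems n" and eq: "taut_mat n x = taut_mat n y"
  note D = four_block_mat_eqD[of _ _ _ _ _ _ _ _ n n n n]
  show "x = y"
  proof (cases x)
    case (Plain L R)
    then have LR: "L \<in> Mon n" "R \<in> Mon n" using x by (auto simp: taut_elems_def)
    show ?thesis
    proof (cases y)
      case (Plain L' R')
      then have LR': "L' \<in> Mon n" "R' \<in> Mon n" using y by (auto simp: taut_elems_def)
      have "L = L'" "R = R'"
        using eq D(1,4)[of L "0\<^sub>m n n" "0\<^sub>m n n" R L' "0\<^sub>m n n" "0\<^sub>m n n" R'] LR LR'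
        by (simp_all add: Plain \<open>x = Plain L R\<close> Mon_carrier)
      then show ?thesis using Plain \<open>x = Plain L R\<close> by simp
    next
      case (Transp L' R')
      then have LR': "L' \<in> Mon n" "R' \<in> Mon n" using y by (auto simp: taut_elems_def)
      have "L = 0\<^sub>m n n"
        using eq D(1)[of L "0\<^sub>m n n" "0\<^sub>m n n" R "0\<^sub>m n n" L' "- R'" "0\<^sub>m n n"] LR LR'
        by (simp add: Transp \<open>x = Plain L R\<close> Mon_carrier)
      then show ?thesis using LR zero_not_in_Mon[OF assms] by simp
    qed
  next
    case (Transp L R)
    then have LR: "L \<in> Mon n" "R \<in> Mon n" using x by (auto simp: taut_elems_def)
    show ?thesis
    proof (cases y)
      case (Plain L' R')
      then have LR': "L' \<in> Mon n" "R' \<in> Mon n" using y by (auto simp: taut_elems_def)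
      have "L' = 0\<^sub>m n n"
        using eq D(1)[of "0\<^sub>m n n" L "- R" "0\<^sub>m n n" L' "0\<^sub>m n n" "0\<^sub>m n n" R'] LR LR'
        by (simp add: Plain \<open>x = Transp L R\<close> Mon_carrier)
      then show ?thesis using LR' zero_not_in_Mon[OF assms] by simp
    next
      case (Transp L' R')
      then have LR': "L' \<in> Mon n" "R' \<in> Mon n" using y by (auto simp: taut_elems_def)
      have "L = L'" "- R = - R'"
        using eq D(2,3)[of "0\<^sub>m n n" L "- R" "0\<^sub>m n n" "0\<^sub>m n n" L' "- R'" "0\<^sub>m n n"] LR LR'
        by (simp_all add: Transp \<open>x = Transp L R\<close> Mon_carrier)
      then have "R = R'" by (metis uminus_uminus_mat)
      then show ?thesis using \<open>L = L'\<close> Transp \<open>x = Transp L R\<close> by simp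
    qed
  qed
qed

text \<open>Rows of \<open>Y\<close> are the positions below \<open>n\<close>, columns those from
  \<open>n\<close> on. The ends of an edge lie in opposite halves both before and after applying
  \<open>M\<close>, so the vertices that stay in their own half form a closed set \<open>U\<close>.
  By connectedness \<open>U\<close> is everything, which gives a pair, or empty, which gives a
  triple.\<close>

lemma SAut_skew_block_cases:
  assumes Y: "bip_connected Y" "Y \<in> carrier_mat n n" and M: "M \<in> carrier (SAut (skew_block Y))"
  obtains x where "x \<in> taut_elems n" "M = taut_mat n x" "taut_op x Y = Y"
proof -
  note S = skew_block_carrier[OF Y(2)]
  have MM: "M \<in> Mon (n + n)" "M * skew_block Y * transpose_mat M = skew_block Y"
    using M by (auto simp: SAut_carrier[OF S])
  note p = Mon_signed_perm[OF MM(1)]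
  have eq: "skew_block Y $$ (mon_perm M a, mon_perm M b) = mon_sign M a * mon_sign M b * skew_block
      Y $$ (a, b)"
    if "a < n + n" "b < n + n" for a b
    using M that unfolding SAut_index_iff[OF S MM(1)] by blast
  have n: "0 < n" using bip_connected_dim[OF Y(1)] Y(2) by simp
  have side: "a < n \<longleftrightarrow> \<not> b < n" if "a < n + n" "b < n + n" "skew_block Y $$ (a, b) \<noteq> 0" for a b
    using that Y(2) by (auto simp: skew_block_def split: if_splits)
  define U where "U = {(c, i). i < n \<and> (if c then mon_perm M i < n else \<not> mon_perm M (n + i) < n)}"
  have c: "connected_on (bip_adj Y) (UNIV \<times> {..<n})" using Y by (simp add: bip_connected_def)
  have step: "mon_perm M i < n \<longleftrightarrow> \<not> mon_perm M (n + j) < n" if "i < n" "j < n" "Y $$ (i, j) \<noteq> 0" for i j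
  proof (rule side)
    show "mon_perm M i < n + n" "mon_perm M (n + j) < n + n" using signed_permD(1)[OF p] that by auto
    show "skew_block Y $$ (mon_perm M i, mon_perm M (n + j)) \<noteq> 0"
      using eq[of i "n + j"] that skew_block_index(2)[OF Y(2) that(1,2)] signed_permD(4)[OF p] by simp
  qed
  have "U = UNIV \<times> {..<n}" if "U \<noteq> {}"
  proof (rule connected_onD[OF c _ that])
    show "U \<subseteq> UNIV \<times> {..<n}" by (auto simp: U_def)
    fix x y assume xy: "x \<in> U" "y \<in> UNIV \<times> {..<n}" "bip_adj Y x y"
    obtain b i d j where eqs: "x = (b, i)" "y = (d, j)" by fastforce
    show "y \<in> U"
      using xy step[of i j] step[of j i] unfolding eqs by (cases b; cases d) (simp_all add: U_def)
  qed
  then have "U = UNIV \<times> {..<n} \<or> U = {}" by blast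
  then show ?thesis
  proof
    assume U: "U = UNIV \<times> {..<n}"
    have "mon_perm M a < n" if "a < n" for a
    proof -
      have "(True, a) \<in> U" using that U by simp
      then show ?thesis by (simp add: U_def)
    qed
    then obtain L R where LR: "L \<in> Mon n" "R \<in> Mon n" "M = four_block_mat L (0\<^sub>m n n) (0\<^sub>m n n) R"
      using Mon_block_diag_cases[OF MM(1)] by metis
    have x: "Plain L R \<in> taut_elems n" using LR by (simp add: taut_elems_def)
    have "skew_block (taut_op (Plain L R) Y) = skew_block Y"
      using taut_mat_congruence[OF x Y(2)] LR(3) MM(2) by simp
    from skew_block_inj[OF this taut_op_carrier[OF x Y(2)] Y(2)] show ?thesis
      using that[OF x] LR(3) by simp
  next
    assume U: "U = {}"
    have "n \<le> mon_perm M a" if "a < n" for a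
    proof -
      have "(True, a) \<notin> U" using U by simp
      then show ?thesis using that by (simp add: U_def)
    qed
    then obtain L R where LR: "L \<in> Mon n" "R \<in> Mon n" "M = four_block_mat (0\<^sub>m n n) L R (0\<^sub>m n n)"
      using Mon_block_antidiag_cases[OF MM(1)] by metis
    \<comment> \<open>\<open>taut_mat\<close> negates the lower left block, so the triple has to
      carry \<open>- R\<close>.\<close>
    have x: "Transp L (- R) \<in> taut_elems n" using LR uminus_in_Mon by (simp add: taut_elems_def)
    have Meq: "M = taut_mat n (Transp L (- R))" using LR by simp
    have "skew_block (taut_op (Transp L (- R)) Y) = skew_block Y"
      using taut_mat_congruence[OF x Y(2)] Meq MM(2) by metis
    from skew_block_inj[OF this taut_op_carrier[OF x Y(2)] Y(2)] show ?thesis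
      using that[OF x Meq] by simp
  qed
qed

lemma SAut_skew_block_TAut_iso:
  assumes Y: "bip_connected Y"
  shows "taut_mat (dim_row Y) \<in> iso (TAut Y) (SAut (skew_block Y))"
proof -
  define n where "n = dim_row Y"
  have Yc: "Y \<in> carrier_mat n n" unfolding n_def by (rule bip_connected_carrier[OF Y])
  note S = skew_block_carrier[OF Yc]
  have car: "carrier (TAut Y) = {x \<in> taut_elems n. taut_op x Y = Y}" by (simp add: TAut_def n_def)
  have n: "0 < n" using bip_connected_dim[OF Y] by (simp add: n_def)
  have in_SAut: "taut_mat n x \<in> carrier (SAut (skew_block Y))" if "x \<in> carrier (TAut Y)" for x
    using that taut_mat_congruence[OF _ Yc, of x] taut_mat_in_Mon[of x n] by (simp add: car
        SAut_carrier[OF S])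
  moreover have "taut_mat n (x \<otimes>\<^bsub>TAut Y\<^esub> y) = taut_mat n x \<otimes>\<^bsub>SAut (skew_block Y)\<^esub> taut_mat n y"
    if "x \<in> carrier (TAut Y)" "y \<in> carrier (TAut Y)" for x y
    using that taut_mat_mult[of x n y] by (simp add: car) (simp add: TAut_def)
  ultimately have "taut_mat n \<in> hom (TAut Y) (SAut (skew_block Y))" by (simp add: hom_def)
  moreover have "inj_on (taut_mat n) (carrier (TAut Y))"
    using inj_on_taut_mat[OF n] by (rule inj_on_subset) (auto simp: car)
  moreover have "carrier (SAut (skew_block Y)) \<subseteq> taut_mat n ` carrier (TAut Y)"
  proof
    fix M assume "M \<in> carrier (SAut (skew_block Y))"
    from SAut_skew_block_cases[OF Y Yc this] show "M \<in> taut_mat n ` carrier (TAut Y)"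
      by (auto simp: car)
  qed
  ultimately have "taut_mat n \<in> iso (TAut Y) (SAut (skew_block Y))" by (rule hom_bij_imp_iso)
  then show ?thesis by (simp add: n_def)
qed

text \<open>A triple in \<open>TAut Z\<close> would be an equivalence between \<open>Z\<close> and
  its transpose, so for a class that is not symmetric only the pairs remain.\<close>

lemma SAut_skew_block_Aut_iso:
  assumes Z: "bip_connected Z" and ns: "\<not> symmetric_class Z"
  shows "(\<lambda>(L, R). taut_mat (dim_row Z) (Plain L R)) \<in> iso (Aut Z) (SAut (skew_block Z))"
proof -
  define n where "n = dim_row Z"
  have Zc: "Z \<in> carrier_mat n n" unfolding n_def by (rule bip_connected_carrier[OF Z])
  have n: "0 < n" using bip_connected_dim[OF Z] by (simp add: n_def)
  have iso: "taut_mat n \<in> iso (TAut Z) (SAut (skew_block Z))"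
    using SAut_skew_block_TAut_iso[OF Z] by (simp add: n_def)
  let ?P = "\<lambda>(L, R). Plain L R"
  have no_transp: "Transp L R \<notin> carrier (TAut Z)" for L R
  proof
    assume "Transp L R \<in> carrier (TAut Z)"
    then have "L \<in> Mon n" "R \<in> Mon n" "Z = L * transpose_mat Z * transpose_mat R"
      by (auto simp: TAut_def taut_elems_def n_def)
    then have "H_equiv (transpose_mat Z) Z" using Zc by (intro H_equivI[of _ n L R]) auto
    then show False using ns H_equiv_sym by (auto simp: symmetric_class_def H_class_def)
  qed
  have car: "?P w \<in> carrier (TAut Z) \<longleftrightarrow> w \<in> carrier (Aut Z)" for w
    by (cases w) (auto simp: TAut_def Aut_def taut_elems_def)
  have "?P \<in> hom (Aut Z) (TAut Z)"
    using car by (auto simp: hom_def TAut_def Aut_def)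
  moreover have "inj_on ?P (carrier (Aut Z))" by (auto simp: inj_on_def)
  moreover have "carrier (TAut Z) \<subseteq> ?P ` carrier (Aut Z)"
  proof
    fix x assume x: "x \<in> carrier (TAut Z)"
    then obtain L R where "x = Plain L R" using no_transp by (cases x) auto
    then show "x \<in> ?P ` carrier (Aut Z)" using x car[of "(L, R)"] by (intro image_eqI[of _ _ "(L,
        R)"]) auto
  qed
  ultimately have "?P \<in> iso (Aut Z) (TAut Z)" by (rule hom_bij_imp_iso)
  from iso_set_trans[OF this iso] show ?thesis by (simp add: comp_def case_prod_unfold n_def)
qed

lemma TAut_closed:
  assumes "Y \<in> carrier_mat n n" "x \<in> carrier (TAut Y)" "y \<in> carrier (TAut Y)"
  shows "x \<otimes>\<^bsub>TAut Y\<^esub> y \<in> carrier (TAut Y)"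
  using assms taut_op_mult[of x n y Y] taut_mult_elems[of x n y] by (simp add: TAut_def)

lemma Aut_closed:
  assumes Y: "Y \<in> carrier_mat n n" and "x \<in> carrier (Aut Y)" "y \<in> carrier (Aut Y)"
  shows "x \<otimes>\<^bsub>Aut Y\<^esub> y \<in> carrier (Aut Y)"
proof -
  obtain L R L' R' where eq: "x = (L, R)" "y = (L', R')" by fastforce
  have *: "L \<in> Mon n" "R \<in> Mon n" "L * Y * transpose_mat R = Y"
    "L' \<in> Mon n" "R' \<in> Mon n" "L' * Y * transpose_mat R' = Y"
    using assms by (auto simp: Aut_def eq)
  have "L * L' * Y * transpose_mat (R * R') = Y"
    using Mon_equivalence_comp[OF *(4,5,1,2) Y] *(3,6) by simp
  then show ?thesis using Y * Mon_mult_closed by (simp add: Aut_def eq)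
qed

section \<open>Automorphisms of the representatives\<close>

context antisym_decomposition
begin

text \<open>No SH-equivalence joins blocks of different kinds, so \<open>SAut\<close> is the direct
  product over the three kinds. Within a kind equal blocks form wreath products over the
  automorphisms of one block, which are \<open>SAut X\<close>, \<open>TAut Y\<close> or
  \<open>Aut Z\<close>.\<close>

theorem SAut_Sigma_mat_iso:
  assumes c: "c \<in> choices ms Ls"
  shows "SAut (Sigma_mat As Bs ns Cs os Ls c) \<cong>
    wreath_product SAut (type1_blocks Ls c) \<times>\<times>
    wreath_product TAut (type2_blocks As Bs ns c) \<times>\<times>
    wreath_product Aut (type3_blocks Cs os)"
proof -
  let ?T1 = "type1_blocks Ls c" and ?T2 = "type2_blocks As Bs ns c" and ?T3 = "type3_blocks Cs os"
  have bip1: "bip_connected X" if "X \<in> set ?T1" for X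
    using choices_type1_mem[OF c that] Ls_bip by metis
  have t2: "Y \<in> types" "Y \<in> set As \<union> set Bs \<union> set Cs" if "Y \<in> set ?T2" for Y
    using type2_mem[OF that] by auto
  have t3: "Z \<in> types" "Z \<in> set As \<union> set Bs \<union> set Cs" "\<not> symmetric_class Z" if "Z \<in> set ?T3" for Z
    using type3_mem[OF that] Cs_class by auto
  have disj: "Y \<noteq> Z" if "Y \<in> set ?T2" "Z \<in> set ?T3" for Y Z
    using type2_mem[OF that(1)] type3_mem[OF that(2)] distinct_parts(6,8) by auto
  have conn1: "\<forall>X\<in>set ?T1. index_connected X" using bip1 bip_connected_imp_index_connected by blast
  have conn2: "\<forall>X\<in>set (map skew_block ?T2). index_connected X"
    using t2(1) types_bip index_connected_skew_block unfolding set_map by blast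
  have conn3: "\<forall>X\<in>set (map skew_block ?T3). index_connected X"
    using t3(1) types_bip index_connected_skew_block unfolding set_map by blast
  have conn23: "\<forall>X\<in>set (map skew_block ?T2 @ map skew_block ?T3). index_connected X"
    using conn2 conn3 unfolding set_append by blast
  have Sig: "Sigma_mat As Bs ns Cs os Ls c = diag_block_mat (?T1 @ (map skew_block ?T2 @ map
      skew_block ?T3))"
    by (simp add: Sigma_mat_def)
  have i1: "SAut (diag_block_mat ?T1) \<cong> wreath_product SAut ?T1"
  proof -
    have "SAut (diag_block_mat (map (\<lambda>X. X) ?T1)) \<cong> wreath_product SAut ?T1"
    proof (rule SAut_wreath_product_iso)
      show "index_connected X" if "X \<in> set ?T1" for X using conn1 that by blast
      show "X = X'" if "X \<in> set ?T1" "X' \<in> set ?T1" "SH_equiv X X'" for X X'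
        using that blocks_rigid[OF c c] unfolding blocks_def set_append by blast
      show "\<exists>\<phi>. \<phi> \<in> iso (SAut X) (SAut X)" for X using id_iso by blast
      show "a \<otimes>\<^bsub>SAut X\<^esub> b \<in> carrier (SAut X)"
        if "X \<in> set ?T1" "a \<in> carrier (SAut X)" "b \<in> carrier (SAut X)" for X a b
        using SAut_closed[OF bip_connected_carrier[OF bip1[OF that(1)]] that(2,3)] by simp
    qed
    then show ?thesis by simp
  qed
  have i2: "SAut (diag_block_mat (map skew_block ?T2)) \<cong> wreath_product TAut ?T2"
  proof (rule SAut_wreath_product_iso)
    show "index_connected (skew_block Y)" if "Y \<in> set ?T2" for Y using conn2 that by auto
    show "Y = Y'" if "Y \<in> set ?T2" "Y' \<in> set ?T2" "SH_equiv (skew_block Y) (skew_block Y')" for Y Y'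
      using that t2(2) skew_block_rigid by blast
    show "\<exists>\<phi>. \<phi> \<in> iso (TAut Y) (SAut (skew_block Y))" if "Y \<in> set ?T2" for Y
      using SAut_skew_block_TAut_iso types_bip t2(1)[OF that] by blast
    show "a \<otimes>\<^bsub>TAut Y\<^esub> b \<in> carrier (TAut Y)"
      if "Y \<in> set ?T2" "a \<in> carrier (TAut Y)" "b \<in> carrier (TAut Y)" for Y a b
      using TAut_closed[OF types_carrier[OF t2(1)[OF that(1)]] that(2,3)] .
  qed
  have i3: "SAut (diag_block_mat (map skew_block ?T3)) \<cong> wreath_product Aut ?T3"
  proof (rule SAut_wreath_product_iso)
    show "index_connected (skew_block Y)" if "Y \<in> set ?T3" for Y using conn3 that by auto
    show "Y = Y'" if "Y \<in> set ?T3" "Y' \<in> set ?T3" "SH_equiv (skew_block Y) (skew_block Y')" for Y Y'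
      using that t3(2) skew_block_rigid by blast
    show "\<exists>\<phi>. \<phi> \<in> iso (Aut Y) (SAut (skew_block Y))" if "Y \<in> set ?T3" for Y
      using SAut_skew_block_Aut_iso[OF types_bip[OF t3(1)[OF that]] t3(3)[OF that]] by blast
    show "a \<otimes>\<^bsub>Aut Y\<^esub> b \<in> carrier (Aut Y)"
      if "Y \<in> set ?T3" "a \<in> carrier (Aut Y)" "b \<in> carrier (Aut Y)" for Y a b
      using Aut_closed[OF types_carrier[OF t3(1)[OF that(1)]] that(2,3)] .
  qed
  have "SAut (Sigma_mat As Bs ns Cs os Ls c) \<cong>
      SAut (diag_block_mat ?T1) \<times>\<times> SAut (diag_block_mat (map skew_block ?T2 @ map skew_block ?T3))"
    unfolding Sig
  proof (rule SAut_diag_append_iso[OF conn1 conn23])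
    fix X Y assume X: "X \<in> set ?T1" and "Y \<in> set (map skew_block ?T2 @ map skew_block ?T3)"
    then obtain P where "P \<in> types" "Y = skew_block P" using t2(1) t3(1) unfolding set_append
        set_map by blast
    then show "\<not> SH_equiv X Y" using not_SH_equiv_type1_skew(1)[OF c X] by blast
  qed
  also have "SAut (diag_block_mat ?T1) \<times>\<times> SAut (diag_block_mat (map skew_block ?T2 @ map skew_block
      ?T3)) \<cong>
      wreath_product SAut ?T1 \<times>\<times> wreath_product TAut ?T2 \<times>\<times> wreath_product Aut ?T3"
  proof (rule DirProd_cong_iso[OF i1])
    have "SAut (diag_block_mat (map skew_block ?T2 @ map skew_block ?T3)) \<cong>
        SAut (diag_block_mat (map skew_block ?T2)) \<times>\<times> SAut (diag_block_mat (map skew_block ?T3))"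
    proof (rule SAut_diag_append_iso[OF conn2 conn3])
      fix X Y assume "X \<in> set (map skew_block ?T2)" "Y \<in> set (map skew_block ?T3)"
      then obtain P Q where "P \<in> set ?T2" "Q \<in> set ?T3" "X = skew_block P" "Y = skew_block Q"
        unfolding set_map by blast
      then show "\<not> SH_equiv X Y" using skew_block_rigid t2(2) t3(2) disj by blast
    qed
    also have "SAut (diag_block_mat (map skew_block ?T2)) \<times>\<times> SAut (diag_block_mat (map skew_block
        ?T3)) \<cong>
        wreath_product TAut ?T2 \<times>\<times> wreath_product Aut ?T3"
      by (rule DirProd_cong_iso[OF i2 i3])
    finally show "SAut (diag_block_mat (map skew_block ?T2 @ map skew_block ?T3)) \<cong>
        wreath_product TAut ?T2 \<times>\<times> wreath_product Aut ?T3" .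
  qed
  finally show ?thesis .
qed

end

theorem theorem5p13:
  fixes A :: "int mat"
    and As Bs Cs :: "int mat list"
    and ms ns os :: "nat list"
    and Ls :: "int mat list list"
  assumes "int_weighing A"
    and "length ms = length As" and "length ns = length Bs" and "length os = length Cs"
    and "H_equiv A (diag_block_mat (decomposition_blocks As ms Bs ns Cs os))"
    and "\<forall>X\<in>set (block_types As Bs Cs). primitive X"
    and "\<forall>X\<in>set As. antisymmetric X"
    and "\<forall>X\<in>set Bs. symmetric_class X \<and> (\<forall>Y\<in>H_class X. \<not> antisymmetric Y)"
    and "\<forall>X\<in>set Cs. \<not> symmetric_class X"
    and "\<forall>i<length (block_types As Bs Cs). \<forall>j<length (block_types As Bs Cs). i \<noteq> j \<longrightarrow>
           \<not> H_equiv (block_types As Bs Cs ! i) (block_types As Bs Cs ! j)"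
    and "length Ls = length As"
    and "\<forall>i<length As. classification_list SH_equiv (antisym_members (As ! i))
           {..<length (Ls ! i)} (\<lambda>j. Ls ! i ! j)"
  shows "classification_list SH_equiv (antisym_members A)
           (choices ms Ls) (Sigma_mat As Bs ns Cs os Ls) \<and>
         (\<forall>c\<in>choices ms Ls.
           SAut (Sigma_mat As Bs ns Cs os Ls c) \<cong>
             wreath_product SAut (type1_blocks Ls c) \<times>\<times>
             wreath_product TAut (type2_blocks As Bs ns c) \<times>\<times>
             wreath_product Aut (type3_blocks Cs os))"
proof -
  interpret antisym_decomposition As Bs Cs ms ns os Ls
    by unfold_locales (use assms in blast)+
  show ?thesis
    using Sigma_mat_classification[OF assms(1,5)] SAut_Sigma_mat_iso by blast
qed

end
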